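(* Let $0<\gamma\le1$, $\alpha\in\mathbb{R}$, $0<T\le1$, let $S_t=e^{-t(1-\Delta)}$ on $H^\alpha(\mathbb T^d)$, and let $H\in Z\hat C^{\gamma}(\Delta_T^3;B_\alpha)$ satisfy the parabolic tail condition with parameters $(\beta,\sigma,K)$, $\beta>0$, $0<\sigma<1$. Assume also that the residual continuity criterion holds for the heat spectral rule. Then the heat spectral splitting produces a semigroup Sewing representative $\hat\Lambda^{\mathsf{heat}}_{S,\gamma,\alpha}H:=R^{\mathsf s,\mathrm{heat}}(H)$ (the continuous extension to $\Delta_T^2$ of the dyadic residual). If $0<\gamma<1$, then on sufficiently short time intervals one has $$\hat\Lambda^{\mathsf{heat}}_{S,\gamma,\alpha}H\in C^{\gamma}(\Delta_T^2;B_\alpha),\qquad\hat\delta\hat\Lambda^{\mathsf{heat}}_{S,\gamma,\alpha}H=H,\qquad\|\hat\Lambda^{\mathsf{heat}}_{S,\gamma,\alpha}H\|_{\gamma,\alpha}\le C_T\bigl(\|H\|_{\gamma,\alpha}+K\bigr).$$ At the endpoint $\gamma=1$, $$\hat\Lambda^{\mathsf{heat}}_{S,1,\alpha}H\in C^1_{\log}(\Delta_T^2;B_\alpha),\qquad\hat\delta\hat\Lambda^{\mathsf{heat}}_{S,1,\alpha}H=H,\qquad\|\hat\Lambda^{\mathsf{heat}}_{S,1,\alpha}H\|_{1,\log;\alpha}\le C_T\bigl(\|H\|_{1,\alpha}+K\bigr).$$ On any linear class of defects where $K\le C\|H\|_{\gamma,\alpha}$ and the residual continuity criterion holds uniformly,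 this construction defines a continuous linear Sewing map.
   Context: Let $\mathbb T^d$ be the $d$-dimensional torus, $A_0:=1-\Delta$, $S_t:=e^{-tA_0}$, $B_\alpha:=H^\alpha(\mathbb T^d)$ with $\|x\|_{B_\alpha}=\|x\|_{H^\alpha}:=\|A_0^{\alpha/2}x\|_{L^2}$. $P_{\le N}$ is the $L^2$-orthogonal spectral projection of $A_0$ onto spectral parameters $\lambda\lesssim N^2$ (i.e. $\lambda\le c_0N^2$ for a fixed constant $c_0>0$), $P_{>N}:=\mathrm{Id}-P_{\le N}$, and $N_h:=h^{-\sigma/2}$ for $0<h\le1$. $S_h^{-1}P_{\le N_h}$ is defined spectrally on the finite-dimensional range of $P_{\le N_h}$. $\Delta_T^n:=\{(t_1,\dots,t_n)\in[0,T]^n:0\le t_n\le\dots\le t_1\le T\}$; $C(\Delta_T^n;B_\alpha)$ denotes continuous maps; $(\hat\delta g)_{t_1\dots t_{n+1}}:=\sum_{i=1}^{n+1}(-1)^ig_{t_1\dots\hat t_i\dots t_{n+1}}-(S_{t_1-t_2}-\mathrm{Id})g_{t_2\dots t_{n+1}}$; in particular $(\hat\delta g)_{tus}=g_{ts}-g_{tu}-S_{t-u}g_{us}$ for two-increments. For $g\in C(\Delta_T^2;B_\alpha)$: $\|g\|_{\mu,\alpha}:=\sup_{s<t}\|g_{ts}\|_{B_\alpha}/|t-s|^\mu$ and $\|g\|_{1,\log;\alpha}:=\sup_{s<t}\frac{\|g_{ts}\|_{B_\alpha}}{|t-s|(1+|\log|t-s||)}$; $C^\mu(\Delta_T^2;B_\alpha)$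 and $C^1_{\log}(\Delta_T^2;B_\alpha)$ are the sets of finite norm. For $h\in C(\Delta_T^3;B_\alpha)$: $\|h\|_{\gamma,\alpha}:=\inf\{\sum_{j=1}^m\sup_{s<u<t}\frac{\|h_{j,tus}\|_{B_\alpha}}{|t-u|^{\rho_j}|u-s|^{\gamma-\rho_j}}:h=\sum_{j=1}^mh_j,\ m\in\mathbb{N},\ 0<\rho_j<\gamma\}$; $C^\gamma(\Delta_T^3;B_\alpha)$ is the set of finite norm; $Z\hat C^\gamma(\Delta_T^3;B_\alpha):=\ker\hat\delta\cap C^\gamma(\Delta_T^3;B_\alpha)$. Dyadic recursion with the heat spectral splitting rule. Let $\mathcal D:=\bigcup_{n\ge0}\{kT2^{-n}:0\le k\le2^n\}$; a dyadic interval is an interval between consecutive points of some $\{kT2^{-n}:0\le k\le 2^n\}$. Let $B^H_{ts}:=-H_{ts0}$. A path $I:\mathcal D\to B_\alpha$ is built with $R^{\mathsf s,\mathrm{heat}}_{ts}(H):=B^H_{ts}-I_t+S_{t-s}I_s$ for $s\le t$ in $\mathcal D$: set $I_0:=0$, $I_T:=B^H_{T0}$; once $I$ is defined at the endpoints of a dyadic interval $[a,c]$ with midpoint $b=(a+c)/2$, $h:=c-b=L/2$, $L=c-a$, put $Q_{ca}:=R^{\mathsf s,\mathrm{heat}}_{ca}$, $Y_{cba}:=Q_{ca}-H_{cba}$, and define the child residuals by $$Q_{ba}:=\tfrac12S_h^{-1}P_{\le N_h}Y_{cba},\qquad Q_{cb}:=\tfrac12P_{\le N_h}Y_{cba}+P_{>N_h}Y_{cba},$$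 and $I_b:=B^H_{ba}+S_{b-a}I_a-Q_{ba}$. Parabolic tail condition with parameters $(\beta,\sigma,K)$: for every dyadic parent interval $[a,c]$ with midpoint $b=(a+c)/2$, length $L=c-a$, $h=c-b=L/2$, residual $Q_{ca}$ generated by the dyadic recursion with the heat spectral splitting rule, and $Y_{cba}=Q_{ca}-H_{cba}$, one has $\|P_{>N_h}Y_{cba}\|_{H^\alpha}\le KL^{\gamma+\rho}$ with $\rho:=\sigma\beta/2>0$ (with $L^{1+\rho}$ when $\gamma=1$). Residual continuity criterion: $\lim_{h\downarrow0}\sup\{\|(S_h-\mathrm{Id})R^{\mathsf s,\mathrm{heat}}_{ts}\|_{B_\alpha}:s\le t,\ s,t\in\mathcal D,\ t+h\le T\}=0$. *)

theory Defs
  imports "HOL-Analysis.Analysis" "HOL-Library.Function_Algebras"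
begin

section \<open>Sobolev spaces and the heat semigroup on the torus\<close>

text \<open>
  A distribution on the torus \<open>(\<real>/2\<pi>\<int>)^d\<close>, \<open>d = CARD('d)\<close>, is represented by its family of Fourier
  coefficients. This covers \<open>H^\<alpha>\<close> for every real \<open>\<alpha>\<close>, and every operator below is a Fourier
  multiplier. Addition, subtraction and finite sums are the pointwise ones of
  \<^theory>\<open>HOL-Library.Function_Algebras\<close>. By Parseval, \<open>l2_norm\<close> is the \<open>L^2\<close> norm with respect to
  the normalised Haar measure.
\<close>

type_synonym 'd tdist = "int ^ 'd \<Rightarrow> complex"
type_synonym 'd incr2 = "real \<times> real \<Rightarrow> 'd tdist"
type_synonym 'd incr3 = "real \<times> real \<times> real \<Rightarrow> 'd tdist"

definition smul :: "complex \<Rightarrow> 'd tdist \<Rightarrow> 'd tdist" (infixr \<open>\<cdot>\<^sub>C\<close> 75) where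
  "c \<cdot>\<^sub>C u = (\<lambda>k. c * u k)"

text \<open>The eigenvalue of \<open>A\<^sub>0 = 1 - \<Delta>\<close> on \<open>x \<mapsto> exp (i k \<sqdot> x)\<close>.\<close>

definition eig :: "int ^ 'd::finite \<Rightarrow> real" where
  "eig k = 1 + (\<Sum>i\<in>UNIV. (of_int (k $ i))\<^sup>2)"

definition A0_pow :: "real \<Rightarrow> 'd::finite tdist \<Rightarrow> 'd tdist" where
  "A0_pow r u = (\<lambda>k. of_real (eig k powr r) * u k)"

definition L2_torus :: "'d::finite tdist set" where
  "L2_torus = {u. (\<lambda>k. (cmod (u k))\<^sup>2) summable_on UNIV}"

definition l2_norm :: "'d::finite tdist \<Rightarrow> real" where
  "l2_norm u = sqrt (\<Sum>\<^sub>\<infinity>k. (cmod (u k))\<^sup>2)"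

definition H_space :: "real \<Rightarrow> 'd::finite tdist set" where
  "H_space \<alpha> = {u. A0_pow (\<alpha> / 2) u \<in> L2_torus}"

definition H_norm :: "real \<Rightarrow> 'd::finite tdist \<Rightarrow> real" where
  "H_norm \<alpha> u = l2_norm (A0_pow (\<alpha> / 2) u)"

definition heat :: "real \<Rightarrow> 'd::finite tdist \<Rightarrow> 'd tdist" where
  "heat t u = (\<lambda>k. of_real (exp (- t * eig k)) * u k)"

definition proj_low :: "real \<Rightarrow> real \<Rightarrow> 'd::finite tdist \<Rightarrow> 'd tdist" where
  "proj_low c0 N u = (\<lambda>k. if eig k \<le> c0 * N\<^sup>2 then u k else 0)"

definition proj_high :: "real \<Rightarrow> real \<Rightarrow> 'd::finite tdist \<Rightarrow> 'd tdist" where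
  "proj_high c0 N u = u - proj_low c0 N u"

text \<open>\<open>S\<^sub>h\<^sup>-\<^sup>1 P\<^bsub>\<le>N\<^esub>\<close>\<close>

definition heat_inv_low :: "real \<Rightarrow> real \<Rightarrow> real \<Rightarrow> 'd::finite tdist \<Rightarrow> 'd tdist" where
  "heat_inv_low c0 N h u = (\<lambda>k. of_real (exp (h * eig k)) * proj_low c0 N u k)"

definition cutoff :: "real \<Rightarrow> real \<Rightarrow> real" where
  "cutoff \<sigma> h = h powr (- \<sigma> / 2)"


section \<open>Increments on simplices\<close>

text \<open>
  Increments are total functions, of which only the values on the relevant simplex matter.
  Arguments are in decreasing time order, as in the notation \<open>g\<^bsub>ts\<^esub>\<close>, \<open>h\<^bsub>tus\<^esub>\<close>.
\<close>

definition simplex2 :: "real \<Rightarrow> (real \<times> real) set" where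
  "simplex2 T = {(t, s). 0 \<le> s \<and> s \<le> t \<and> t \<le> T}"

definition simplex3 :: "real \<Rightarrow> (real \<times> real \<times> real) set" where
  "simplex3 T = {(t, u, s). 0 \<le> s \<and> s \<le> u \<and> u \<le> t \<and> t \<le> T}"

definition simplex4 :: "real \<Rightarrow> (real \<times> real \<times> real \<times> real) set" where
  "simplex4 T = {(t, u, v, s). 0 \<le> s \<and> s \<le> v \<and> v \<le> u \<and> u \<le> t \<and> t \<le> T}"

text \<open>\<open>C(D; B\<^sub>\<alpha>)\<close>\<close>

definition C_maps :: "real \<Rightarrow> 'a::topological_space set \<Rightarrow> ('a \<Rightarrow> 'd::finite tdist) set" where
  "C_maps \<alpha> D = {g. (\<forall>x\<in>D. g x \<in> H_space \<alpha>) \<and>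
      (\<forall>x\<in>D. ((\<lambda>y. H_norm \<alpha> (g y - g x)) \<longlongrightarrow> 0) (at x within D))}"

text \<open>
  The twisted coboundary for a general number of times, on lists \<open>[t\<^sub>1, \<dots>, t\<^sub>n\<^sub>+\<^sub>1]\<close>, and its two
  instances on increments of two and three times.
\<close>

definition hat_delta :: "(real list \<Rightarrow> 'd::finite tdist) \<Rightarrow> real list \<Rightarrow> 'd tdist" where
  "hat_delta g ts =
     (\<Sum>i = 1..length ts. (-1) ^ i \<cdot>\<^sub>C g (take (i - 1) ts @ drop i ts))
     - (heat (ts ! 0 - ts ! 1) (g (tl ts)) - g (tl ts))"

definition hat_delta2 :: "'d::finite incr2 \<Rightarrow> real \<times> real \<times> real \<Rightarrow> 'd tdist" where
  "hat_delta2 g = (\<lambda>(t, u, s). hat_delta (\<lambda>r. g (r ! 0, r ! 1)) [t, u, s])"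

definition hat_delta3 :: "'d::finite incr3 \<Rightarrow> real \<times> real \<times> real \<times> real \<Rightarrow> 'd tdist" where
  "hat_delta3 h = (\<lambda>(t, u, v, s). hat_delta (\<lambda>r. h (r ! 0, r ! 1, r ! 2)) [t, u, v, s])"

lemma hat_delta2_eq:
  "hat_delta2 g (t, u, s) = g (t, s) - g (t, u) - heat (t - u) (g (u, s))"
  by (simp add: hat_delta2_def hat_delta_def smul_def fun_eq_iff numeral_eq_Suc
      atLeastAtMostSuc_conv)

lemma hat_delta3_eq:
  "hat_delta3 h (t, u, v, s) =
     h (t, v, s) - h (t, u, s) + h (t, u, v) - heat (t - u) (h (u, v, s))"
  by (simp add: hat_delta3_def hat_delta_def smul_def fun_eq_iff numeral_eq_Suc
      atLeastAtMostSuc_conv)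

text \<open>The norms take values in \<open>[0, \<infinity>]\<close>; they are meaningful for continuous increments only.\<close>

definition norm2 :: "real \<Rightarrow> real \<Rightarrow> real \<Rightarrow> 'd::finite incr2 \<Rightarrow> ennreal" where
  "norm2 T \<mu> \<alpha> g =
     (SUP (t, s) \<in> {(t, s). 0 \<le> s \<and> s < t \<and> t \<le> T}.
        ennreal (H_norm \<alpha> (g (t, s)) / (t - s) powr \<mu>))"

definition norm_log :: "real \<Rightarrow> real \<Rightarrow> 'd::finite incr2 \<Rightarrow> ennreal" where
  "norm_log T \<alpha> g =
     (SUP (t, s) \<in> {(t, s). 0 \<le> s \<and> s < t \<and> t \<le> T}.
        ennreal (H_norm \<alpha> (g (t, s)) / ((t - s) * (1 + \<bar>ln (t - s)\<bar>))))"

definition norm_split :: "real \<Rightarrow> real \<Rightarrow> real \<Rightarrow> real \<Rightarrow> 'd::finite incr3 \<Rightarrow> ennreal" where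
  "norm_split T \<rho> \<rho>' \<alpha> h =
     (SUP (t, u, s) \<in> {(t, u, s). 0 \<le> s \<and> s < u \<and> u < t \<and> t \<le> T}.
        ennreal (H_norm \<alpha> (h (t, u, s)) / ((t - u) powr \<rho> * (u - s) powr \<rho>')))"

definition norm3 :: "real \<Rightarrow> real \<Rightarrow> real \<Rightarrow> 'd::finite incr3 \<Rightarrow> ennreal" where
  "norm3 T \<gamma> \<alpha> h =
     Inf {\<Sum>j<m. norm_split T (\<rho> j) (\<gamma> - \<rho> j) \<alpha> (hs j) | (m::nat) \<rho> hs.
            (\<forall>j<m. 0 < \<rho> j \<and> \<rho> j < \<gamma>) \<and>
            (\<forall>j<m. hs j \<in> C_maps \<alpha> (simplex3 T)) \<and>
            (\<forall>x\<in>simplex3 T. h x = (\<Sum>j<m. hs j x))}"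

definition C2 :: "real \<Rightarrow> real \<Rightarrow> real \<Rightarrow> 'd::finite incr2 set" where
  "C2 T \<mu> \<alpha> = {g \<in> C_maps \<alpha> (simplex2 T). norm2 T \<mu> \<alpha> g < \<infinity>}"

definition C_log :: "real \<Rightarrow> real \<Rightarrow> 'd::finite incr2 set" where
  "C_log T \<alpha> = {g \<in> C_maps \<alpha> (simplex2 T). norm_log T \<alpha> g < \<infinity>}"

definition C3 :: "real \<Rightarrow> real \<Rightarrow> real \<Rightarrow> 'd::finite incr3 set" where
  "C3 T \<gamma> \<alpha> = {h \<in> C_maps \<alpha> (simplex3 T). norm3 T \<gamma> \<alpha> h < \<infinity>}"

definition ZC3 :: "real \<Rightarrow> real \<Rightarrow> real \<Rightarrow> 'd::finite incr3 set" where
  "ZC3 T \<gamma> \<alpha> = {h \<in> C3 T \<gamma> \<alpha>. \<forall>x\<in>simplex4 T. hat_delta3 h x = 0}"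


section \<open>Dyadic recursion with the heat spectral splitting rule\<close>

definition dyadic_pt :: "real \<Rightarrow> nat \<Rightarrow> nat \<Rightarrow> real" where
  "dyadic_pt T n k = real k * T / 2 ^ n"

definition dyadics :: "real \<Rightarrow> real set" where
  "dyadics T = {dyadic_pt T n k | n k. k \<le> 2 ^ n}"

definition B_germ :: "'d::finite incr3 \<Rightarrow> 'd incr2" where
  "B_germ H = (\<lambda>(t, s). - H (t, s, 0))"

text \<open>
  \<open>heat_level c0 \<sigma> T H n k\<close> is the value \<open>I\<^sub>t\<close> at \<open>t = kT/2\<^sup>n\<close>. A point which is new at level \<open>n + 1\<close>
  is the midpoint \<open>b\<close> of a parent interval \<open>[a, c]\<close> of level \<open>n\<close>; its value uses the left child
  residual \<open>Q\<^bsub>ba\<^esub>\<close>. The right child residual is then determined, see \<open>heat_residual_right\<close> below.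
\<close>

primrec heat_level ::
  "real \<Rightarrow> real \<Rightarrow> real \<Rightarrow> 'd::finite incr3 \<Rightarrow> nat \<Rightarrow> nat \<Rightarrow> 'd tdist" where
  "heat_level c0 \<sigma> T H 0 = (\<lambda>k. if k = 0 then 0 else B_germ H (T, 0))"
| "heat_level c0 \<sigma> T H (Suc n) = (\<lambda>k.
     if even k then heat_level c0 \<sigma> T H n (k div 2)
     else
       (let j = k div 2;
            a = dyadic_pt T n j; c = dyadic_pt T n (j + 1); b = (a + c) / 2; h = c - b;
            I_a = heat_level c0 \<sigma> T H n j; I_c = heat_level c0 \<sigma> T H n (j + 1);
            Q_ca = B_germ H (c, a) - I_c + heat (c - a) I_a;
            Y = Q_ca - H (c, b, a);
            Q_ba = (1 / 2) \<cdot>\<^sub>C heat_inv_low c0 (cutoff \<sigma> h) h Y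
        in B_germ H (b, a) + heat (b - a) I_a - Q_ba))"

definition heat_path :: "real \<Rightarrow> real \<Rightarrow> real \<Rightarrow> 'd::finite incr3 \<Rightarrow> real \<Rightarrow> 'd tdist" where
  "heat_path c0 \<sigma> T H t =
     (THE x. \<exists>n k. k \<le> 2 ^ n \<and> t = dyadic_pt T n k \<and> x = heat_level c0 \<sigma> T H n k)"

definition heat_residual :: "real \<Rightarrow> real \<Rightarrow> real \<Rightarrow> 'd::finite incr3 \<Rightarrow> 'd incr2" where
  "heat_residual c0 \<sigma> T H = (\<lambda>(t, s).
     B_germ H (t, s) - heat_path c0 \<sigma> T H t + heat (t - s) (heat_path c0 \<sigma> T H s))"

definition heat_Y :: "real \<Rightarrow> real \<Rightarrow> real \<Rightarrow> 'd::finite incr3 \<Rightarrow> 'd incr3" where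
  "heat_Y c0 \<sigma> T H = (\<lambda>(c, b, a). heat_residual c0 \<sigma> T H (c, a) - H (c, b, a))"

lemma heat_level_add: "heat_level c0 \<sigma> T H (n + m) (2 ^ m * k) = heat_level c0 \<sigma> T H n k"
  by (induction m) (simp_all add: mult.assoc)

lemma heat_path_dyadic_pt:
  assumes T: "0 < T" and k: "k \<le> 2 ^ n"
  shows "heat_path c0 \<sigma> T H (dyadic_pt T n k) = heat_level c0 \<sigma> T H n k"
proof -
  have aux: "heat_level c0 \<sigma> T H n k = heat_level c0 \<sigma> T H n' k'"
    if "dyadic_pt T n k = dyadic_pt T n' k'" "n \<le> n'" for n n' k k' :: nat
  proof -
    obtain m where m: "n' = n + m" using \<open>n \<le> n'\<close> le_Suc_ex by blast
    have "real k' = real (2 ^ m * k)"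
      using that(1) T by (simp add: dyadic_pt_def m power_add field_simps)
    then have "k' = 2 ^ m * k" by linarith
    then show ?thesis using heat_level_add m by metis
  qed
  show ?thesis
    unfolding heat_path_def
  proof (rule the_equality)
    show "\<exists>n' k'. k' \<le> 2 ^ n' \<and> dyadic_pt T n k = dyadic_pt T n' k' \<and>
            heat_level c0 \<sigma> T H n k = heat_level c0 \<sigma> T H n' k'"
      using k by blast
  next
    fix x assume "\<exists>n' k'. k' \<le> 2 ^ n' \<and> dyadic_pt T n k = dyadic_pt T n' k' \<and>
            x = heat_level c0 \<sigma> T H n' k'"
    then obtain n' k' where "dyadic_pt T n k = dyadic_pt T n' k'"
      and x: "x = heat_level c0 \<sigma> T H n' k'" by blast
    then show "x = heat_level c0 \<sigma> T H n k"
      using aux[of n k n' k'] aux[of n' k' n k] by (cases "n \<le> n'") auto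
  qed
qed

lemma heat_path_0: "0 < T \<Longrightarrow> heat_path c0 \<sigma> T H 0 = 0"
  using heat_path_dyadic_pt[of T 0 0] by (simp add: dyadic_pt_def)

lemma heat_path_T: "0 < T \<Longrightarrow> heat_path c0 \<sigma> T H T = B_germ H (T, 0)"
  using heat_path_dyadic_pt[of T 1 0] by (simp add: dyadic_pt_def)

lemma heat_path_mid:
  assumes T: "0 < T" and j: "j < 2 ^ n"
    and "a = dyadic_pt T n j" "c = dyadic_pt T n (j + 1)" "b = (a + c) / 2" "h = c - b"
  shows "heat_path c0 \<sigma> T H b = B_germ H (b, a) + heat (b - a) (heat_path c0 \<sigma> T H a)
           - (1 / 2) \<cdot>\<^sub>C heat_inv_low c0 (cutoff \<sigma> h) h (heat_Y c0 \<sigma> T H (c, b, a))"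
proof -
  have b: "b = dyadic_pt T (Suc n) (2 * j + 1)"
    unfolding assms by (simp add: dyadic_pt_def field_simps)
  have "2 * j + 1 \<le> 2 ^ Suc n" using j by simp
  then have 1: "heat_path c0 \<sigma> T H b = heat_level c0 \<sigma> T H (Suc n) (2 * j + 1)"
    unfolding b by (rule heat_path_dyadic_pt[OF T])
  have 2: "heat_path c0 \<sigma> T H a = heat_level c0 \<sigma> T H n j"
    unfolding assms using j by (intro heat_path_dyadic_pt[OF T]) simp
  have 3: "heat_path c0 \<sigma> T H c = heat_level c0 \<sigma> T H n (j + 1)"
    unfolding assms using j by (intro heat_path_dyadic_pt[OF T]) simp
  have ac: "dyadic_pt T n j = a" "dyadic_pt T n (Suc j) = c"
    using assms by simp_all
  have bc: "(a + c) / 2 = b" "(c - a) / 2 = b - a" using assms by (simp_all add: field_simps)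
  show ?thesis
    unfolding 1 heat_Y_def heat_residual_def prod.case 2 3 by (simp add: Let_def ac bc assms(6))
qed

lemma heat_residual_left:
  assumes "0 < T" "j < 2 ^ n"
    and "a = dyadic_pt T n j" "c = dyadic_pt T n (j + 1)" "b = (a + c) / 2" "h = c - b"
  shows "heat_residual c0 \<sigma> T H (b, a) =
           (1 / 2) \<cdot>\<^sub>C heat_inv_low c0 (cutoff \<sigma> h) h (heat_Y c0 \<sigma> T H (c, b, a))"
  unfolding heat_residual_def by (simp add: heat_path_mid[OF assms])

lemma heat_residual_right:
  fixes H :: "'d::finite incr3"
  assumes T: "0 < T" and j: "j < 2 ^ n"
    and ac: "a = dyadic_pt T n j" "c = dyadic_pt T n (j + 1)" and b: "b = (a + c) / 2"
    and h: "h = c - b"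
    and closed: "\<And>x. x \<in> simplex4 T \<Longrightarrow> hat_delta3 H x = 0"
  shows "heat_residual c0 \<sigma> T H (c, b) =
           (1 / 2) \<cdot>\<^sub>C proj_low c0 (cutoff \<sigma> h) (heat_Y c0 \<sigma> T H (c, b, a))
           + proj_high c0 (cutoff \<sigma> h) (heat_Y c0 \<sigma> T H (c, b, a))"
proof -
  define Y where "Y = heat_Y c0 \<sigma> T H (c, b, a)"
  define I where "I = heat_path c0 \<sigma> T H"
  have "real (j + 1) \<le> real (2 ^ n)" using j by (simp only: of_nat_le_iff)
  then have "real (j + 1) * T \<le> 2 ^ n * T" using T by (intro mult_right_mono) auto
  then have "c \<le> T" "a \<le> c" "0 \<le> a"
    using T by (auto simp: ac dyadic_pt_def field_simps)
  then have "(c, b, a, 0) \<in> simplex4 T" by (auto simp: simplex4_def b)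
  from closed[OF this]
  have Hc: "H (c, a, 0) - H (c, b, 0) + H (c, b, a) - heat (c - b) (H (b, a, 0)) = 0"
    by (simp add: hat_delta3_eq)
  have hh: "b - a = h" "c - a = 2 * h" "c - b = h" "a - b = - h" "b - c = - h"
    using b h by auto
  show ?thesis
    unfolding Y_def[symmetric]
  proof (rule ext)
    fix k :: "int ^ 'd"
    define e :: complex where "e = of_real (exp (- (h * eig k)))"
    have e: "of_real (exp (h * eig k)) * e = 1"
      unfolding e_def by (simp flip: of_real_mult exp_add)
    have "a - c = - (2 * h)" using hh by simp
    then have e2: "of_real (exp ((a - c) * eig k)) = e * e"
      unfolding e_def by (simp flip: of_real_mult exp_add)
    have Hk: "H (c, a, 0) k - H (c, b, 0) k + H (c, b, a) k - e * H (b, a, 0) k = 0"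
      using fun_cong[OF Hc, of k] by (simp add: heat_def hh e_def)
    have Yk: "Y k = - H (c, a, 0) k - I c k + e * e * I a k - H (c, b, a) k"
      by (simp add: Y_def heat_Y_def heat_residual_def B_germ_def I_def heat_def hh e2)
    have Ib: "I b k = - H (b, a, 0) k + e * I a k
                - 1 / 2 * of_real (exp (h * eig k)) * proj_low c0 (cutoff \<sigma> h) Y k"
      unfolding I_def
      by (subst heat_path_mid[OF T j ac b h])
        (simp add: B_germ_def heat_def hh e_def smul_def heat_inv_low_def Y_def)
    have "heat_residual c0 \<sigma> T H (c, b) k = - H (c, b, 0) k - I c k + e * I b k"
      by (simp add: heat_residual_def B_germ_def I_def heat_def hh e_def)
    also have "\<dots> = - H (c, b, 0) k - I c k - e * H (b, a, 0) k + e * e * I a k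
         - 1 / 2 * (of_real (exp (h * eig k)) * e) * proj_low c0 (cutoff \<sigma> h) Y k"
      by (simp add: Ib algebra_simps)
    also have "\<dots> = Y k - 1 / 2 * proj_low c0 (cutoff \<sigma> h) Y k"
      unfolding e using Hk by (simp add: Yk algebra_simps)
    finally show "heat_residual c0 \<sigma> T H (c, b) k =
        ((1 / 2) \<cdot>\<^sub>C proj_low c0 (cutoff \<sigma> h) Y + proj_high c0 (cutoff \<sigma> h) Y) k"
      by (simp add: smul_def proj_high_def)
  qed
qed

definition parabolic_tail ::
  "real \<Rightarrow> real \<Rightarrow> real \<Rightarrow> real \<Rightarrow> real \<Rightarrow> real \<Rightarrow> real \<Rightarrow> 'd::finite incr3 \<Rightarrow> bool" where
  "parabolic_tail c0 T \<gamma> \<alpha> \<beta> \<sigma> K H \<longleftrightarrow>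
     (\<forall>n j. j < 2 ^ n \<longrightarrow>
       (let a = dyadic_pt T n j; c = dyadic_pt T n (j + 1); b = (a + c) / 2;
            L = c - a; h = c - b; \<rho> = \<sigma> * \<beta> / 2
        in H_norm \<alpha> (proj_high c0 (cutoff \<sigma> h) (heat_Y c0 \<sigma> T H (c, b, a)))
             \<le> K * L powr (\<gamma> + \<rho>)))"

definition residual_modulus ::
  "real \<Rightarrow> real \<Rightarrow> real \<Rightarrow> real \<Rightarrow> 'd::finite incr3 \<Rightarrow> real \<Rightarrow> ennreal" where
  "residual_modulus c0 T \<alpha> \<sigma> H h =
     (SUP (t, s) \<in> {(t, s). s \<in> dyadics T \<and> t \<in> dyadics T \<and> s \<le> t \<and> t + h \<le> T}.
        ennreal (H_norm \<alpha> (heat h (heat_residual c0 \<sigma> T H (t, s))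
                            - heat_residual c0 \<sigma> T H (t, s))))"

definition residual_continuity ::
  "real \<Rightarrow> real \<Rightarrow> real \<Rightarrow> real \<Rightarrow> 'd::finite incr3 \<Rightarrow> bool" where
  "residual_continuity c0 T \<alpha> \<sigma> H \<longleftrightarrow> (residual_modulus c0 T \<alpha> \<sigma> H \<longlongrightarrow> 0) (at_right 0)"

text \<open>
  The residual depends linearly on \<open>H\<close>, so on a linear class uniformity can only be meant on bounded
  sets, that is, on the unit ball.
\<close>

definition uniform_residual_continuity ::
  "real \<Rightarrow> real \<Rightarrow> real \<Rightarrow> real \<Rightarrow> real \<Rightarrow> 'd::finite incr3 set \<Rightarrow> bool" where
  "uniform_residual_continuity c0 T \<gamma> \<alpha> \<sigma> V \<longleftrightarrow>
     ((\<lambda>h. SUP H \<in> {H \<in> V. norm3 T \<gamma> \<alpha> H \<le> 1}. residual_modulus c0 T \<alpha> \<sigma> H h) \<longlongrightarrow> 0)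
       (at_right 0)"


section \<open>The heat Sewing map\<close>

definition heat_extension ::
  "real \<Rightarrow> real \<Rightarrow> real \<Rightarrow> real \<Rightarrow> 'd::finite incr3 \<Rightarrow> 'd incr2 \<Rightarrow> bool" where
  "heat_extension c0 T \<alpha> \<sigma> H \<Lambda> \<longleftrightarrow>
     \<Lambda> \<in> C_maps \<alpha> (simplex2 T) \<and>
     (\<forall>s\<in>dyadics T. \<forall>t\<in>dyadics T. s \<le> t \<longrightarrow> \<Lambda> (t, s) = heat_residual c0 \<sigma> T H (t, s))"

text \<open>
  The continuous extension of the dyadic residual, set to zero off the simplex so that it is a
  unique total function. If there is no extension the value is unspecified.
\<close>

definition heat_sewing ::
  "real \<Rightarrow> real \<Rightarrow> real \<Rightarrow> real \<Rightarrow> 'd::finite incr3 \<Rightarrow> 'd incr2" where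
  "heat_sewing c0 T \<alpha> \<sigma> H =
     (THE \<Lambda>. heat_extension c0 T \<alpha> \<sigma> H \<Lambda> \<and> (\<forall>x. x \<notin> simplex2 T \<longrightarrow> \<Lambda> x = 0))"

text \<open>
  Real scalars are used for the class, so that classes of real-valued distributions are included;
  homogeneity is required for every complex scalar for which it makes sense in the class.
\<close>

definition linear_class :: "'d::finite incr3 set \<Rightarrow> bool" where
  "linear_class V \<longleftrightarrow> 0 \<in> V \<and> (\<forall>G\<in>V. \<forall>H\<in>V. G + H \<in> V) \<and>
     (\<forall>c::real. \<forall>H\<in>V. (\<lambda>x. of_real c \<cdot>\<^sub>C H x) \<in> V)"

definition linear_on_class :: "'d::finite incr3 set \<Rightarrow> ('d incr3 \<Rightarrow> 'd incr2) \<Rightarrow> bool" where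
  "linear_on_class V \<Lambda> \<longleftrightarrow>
     (\<forall>G\<in>V. \<forall>H\<in>V. \<Lambda> (G + H) = \<Lambda> G + \<Lambda> H) \<and>
     (\<forall>c. \<forall>H\<in>V. (\<lambda>x. c \<cdot>\<^sub>C H x) \<in> V \<longrightarrow> \<Lambda> (\<lambda>x. c \<cdot>\<^sub>C H x) = (\<lambda>x. c \<cdot>\<^sub>C \<Lambda> H x))"

definition continuous_on_class ::
  "'d::finite incr3 set \<Rightarrow> ('d incr3 \<Rightarrow> ennreal) \<Rightarrow> ('d incr2 \<Rightarrow> ennreal) \<Rightarrow>
   ('d incr3 \<Rightarrow> 'd incr2) \<Rightarrow> bool" where
  "continuous_on_class V norm_in norm_out \<Lambda> \<longleftrightarrow>
     (\<forall>G\<in>V. \<forall>\<epsilon>>0. \<exists>\<delta>>0. \<forall>H\<in>V. norm_in (H - G) < \<delta> \<longrightarrow> norm_out (\<Lambda> H - \<Lambda> G) < \<epsilon>)"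

end

theory Submission
  imports Defs "HOL-Real_Asymp.Real_Asymp"
begin

text \<open>
  Write \<open>L\<^sub>n = T / 2\<^sup>n\<close> and let \<open>R\<close> be the residual of the dyadic path \<open>I\<close>. A level \<open>n\<close> residual \<open>Q\<close>
  passes \<open>Y = Q - H\<close> on to its children: the right one gets half of the low frequencies and all high
  frequencies of \<open>Y\<close>, the left one gets half of the low frequencies, moved backwards by the heat flow.
  Below the cutoff \<open>\<lambda> \<le> c\<^sub>0 h\<^bsup>-\<sigma>\<^esup>\<close> the backward flow over time \<open>h\<close> costs a factor \<open>exp (c\<^sub>0 h\<^bsup>1-\<sigma>\<^esup>)\<close>; above it the
  parabolic tail condition applies. With \<open>M\<close> the norm of \<open>H\<close>, the size \<open>q\<^sub>n\<close> of the level \<open>n\<close>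
  residuals therefore satisfies
  \<open>q\<^bsub>n+1\<^esub> \<le> exp (c\<^sub>0 h\<^bsup>1-\<sigma>\<^esup>) (q\<^sub>n / 2 + (M + K) L\<^sub>n\<^sup>\<gamma>)\<close>. As \<open>\<sigma> < 1\<close>, the product of the exponential
  factors over all levels is finite, and what remains is a scalar recursion: \<open>q\<^sub>n\<close> is of order
  \<open>(M + K) L\<^sub>n\<^sup>\<gamma>\<close> if \<open>\<gamma> < 1\<close>, and of order \<open>(M + K) n L\<^sub>n\<close> at the resonance \<open>\<gamma> = 1\<close>, where the factor
  \<open>n\<close> turns into the logarithm (\<open>R_adjacent\<close>).

  Chen's relation \<open>R\<^bsub>ts\<^esub> = R\<^bsub>tu\<^esub> + S\<^bsub>t-u\<^esub> R\<^bsub>us\<^esub> + H\<^bsub>tus\<^esub>\<close> is a consequence of the cocycle identity alone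
  (\<open>path_residual_chen\<close>), whatever the path is. Joining two dyadic points by chains of adjacent
  intervals of geometrically decreasing length, it extends the bound to all dyadic pairs (\<open>R_dyadic_bound\<close>).

  Extending to real times needs uniform continuity of \<open>I\<close> in \<open>H\<^sup>\<alpha>\<close>. Its increment consists of the
  germ, the residual and \<open>(S\<^bsub>t-s\<^esub> - Id) I\<^sub>s\<close>. The first two are small by the bounds on \<open>H\<close> and \<open>R\<close>; as
  \<open>I\<^sub>s = - R\<^bsub>s0\<^esub>\<close>, the third is what the residual continuity criterion controls
  (\<open>I_increment_small\<close>). So \<open>I\<close> extends to a continuous path \<open>J\<close>, and the residual of \<open>J\<close> is the
  Sewing representative. Its coboundary is \<open>H\<close> by Chen's relation, and its bound follows by Fatou's
  lemma (\<open>heat_sewing_bound\<close>).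

  All steps of the recursion are linear in \<open>H\<close>, and a continuous extension is unique, so the Sewing
  map is linear; it is continuous because it is bounded. All constants are uniform for \<open>T \<le> 1\<close>, so
  that \<open>T\<^sub>0 = 1\<close> is a valid threshold for the short time statement.
\<close>

section \<open>The Sobolev norm through finite sets of frequencies\<close>

definition partial_norm :: "real \<Rightarrow> 'd::finite tdist \<Rightarrow> (int ^ 'd) set \<Rightarrow> real" where
  "partial_norm \<alpha> u F = L2_set (\<lambda>k. eig k powr (\<alpha> / 2) * cmod (u k)) F"

lemma eig_pos: "0 < eig k"
proof -
  have "0 \<le> (\<Sum>i\<in>UNIV. (of_int (k $ i) :: real)\<^sup>2)"
    by (intro sum_nonneg) simp
  then show ?thesis by (simp add: eig_def)
qed

lemma partial_norm_square_sum:
  "(partial_norm \<alpha> u F)\<^sup>2 = (\<Sum>k\<in>F. (cmod (A0_pow (\<alpha> / 2) u k))\<^sup>2)"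
  by (simp add: partial_norm_def L2_set_def A0_pow_def norm_mult sum_nonneg)

text \<open>Membership in \<open>H^\<alpha>\<close> together with a norm bound is a condition on finite sets of frequencies;
  in this form it passes to coefficientwise limits.\<close>

lemma H_space_norm_leI:
  assumes "\<And>F. finite F \<Longrightarrow> partial_norm \<alpha> u F \<le> C"
  shows "u \<in> H_space \<alpha>" "H_norm \<alpha> u \<le> C"
proof -
  let ?f = "\<lambda>k. (cmod (A0_pow (\<alpha> / 2) u k))\<^sup>2"
  have C: "0 \<le> C" using assms[of "{}"] by (simp add: partial_norm_def)
  have le: "sum ?f F \<le> C\<^sup>2" if "finite F" for F
    unfolding partial_norm_square_sum[symmetric]
    using assms[OF that] by (intro power_mono) (simp_all add: partial_norm_def)
  have summ: "?f summable_on UNIV"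
    by (rule nonneg_bdd_above_summable_on) (auto intro!: bdd_aboveI2[where M = "C\<^sup>2"] le)
  then show "u \<in> H_space \<alpha>" by (simp add: H_space_def L2_torus_def)
  have "(\<Sum>\<^sub>\<infinity>k. ?f k) \<le> C\<^sup>2"
    using summ by (rule infsum_le_finite_sums) (use le in auto)
  then show "H_norm \<alpha> u \<le> C"
    unfolding H_norm_def l2_norm_def using C by (intro real_le_lsqrt) (auto intro: infsum_nonneg)
qed

lemma partial_norm_le:
  assumes "u \<in> H_space \<alpha>" "finite F"
  shows "partial_norm \<alpha> u F \<le> H_norm \<alpha> u"
proof -
  have "(partial_norm \<alpha> u F)\<^sup>2 \<le> (\<Sum>\<^sub>\<infinity>k. (cmod (A0_pow (\<alpha> / 2) u k))\<^sup>2)"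
    unfolding partial_norm_square_sum using assms
    by (intro finite_sum_le_infsum) (auto simp: H_space_def L2_torus_def)
  then show ?thesis
    unfolding H_norm_def l2_norm_def by (rule real_le_rsqrt)
qed

lemma H_norm_nonneg [simp]: "0 \<le> H_norm \<alpha> u"
  unfolding H_norm_def l2_norm_def by (simp add: infsum_nonneg)

lemma coeff_le_H_norm:
  assumes "u \<in> H_space \<alpha>"
  shows "eig k powr (\<alpha> / 2) * cmod (u k) \<le> H_norm \<alpha> u"
  using partial_norm_le[OF assms, of "{k}"] by (simp add: partial_norm_def)

lemma partial_norm_triangle: "partial_norm \<alpha> (u + v) F \<le> partial_norm \<alpha> u F + partial_norm \<alpha> v F"
proof -
  have "partial_norm \<alpha> (u + v) F \<le>
      L2_set (\<lambda>k. eig k powr (\<alpha> / 2) * cmod (u k) + eig k powr (\<alpha> / 2) * cmod (v k)) F"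
    unfolding partial_norm_def
    by (intro L2_set_mono) (auto simp flip: distrib_left intro: mult_left_mono norm_triangle_ineq)
  also have "\<dots> \<le> partial_norm \<alpha> u F + partial_norm \<alpha> v F"
    unfolding partial_norm_def by (rule L2_set_triangle_ineq)
  finally show ?thesis .
qed

lemma H_add:
  assumes "u \<in> H_space \<alpha>" "v \<in> H_space \<alpha>"
  shows "u + v \<in> H_space \<alpha>" "H_norm \<alpha> (u + v) \<le> H_norm \<alpha> u + H_norm \<alpha> v"
  using H_space_norm_leI[of \<alpha> "u + v" "H_norm \<alpha> u + H_norm \<alpha> v"]
    order_trans[OF partial_norm_triangle add_mono[OF partial_norm_le[OF assms(1)] partial_norm_le[OF assms(2)]]]
  by blast+

text \<open>The heat flow, the frequency cutoffs and the scalars all act by such multipliers; their bounds on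
  \<open>H^\<alpha>\<close> are instances of this one.\<close>

lemma H_multiplier:
  assumes u: "u \<in> H_space \<alpha>" and v: "\<And>k. cmod (v k) \<le> C * cmod (u k)"
  shows "v \<in> H_space \<alpha>" "0 \<le> C \<Longrightarrow> H_norm \<alpha> v \<le> C * H_norm \<alpha> u"
proof -
  have bound: "partial_norm \<alpha> v F \<le> D * H_norm \<alpha> u" if D: "0 \<le> D" "C \<le> D" and F: "finite F" for D F
  proof -
    have "cmod (v k) \<le> D * cmod (u k)" for k
      using v[of k] mult_right_mono[OF D(2), of "cmod (u k)"] by simp
    then have "partial_norm \<alpha> v F \<le> L2_set (\<lambda>k. D * (eig k powr (\<alpha> / 2) * cmod (u k))) F"
      unfolding partial_norm_def
      by (intro L2_set_mono) (auto simp: mult.left_commute[of D] intro!: mult_left_mono)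
    also have "\<dots> = D * partial_norm \<alpha> u F"
      unfolding partial_norm_def by (simp add: L2_set_right_distrib D)
    also have "\<dots> \<le> D * H_norm \<alpha> u"
      using D by (intro mult_left_mono partial_norm_le u F)
    finally show ?thesis .
  qed
  show "v \<in> H_space \<alpha>" using H_space_norm_leI(1)[of \<alpha> v "max C 0 * H_norm \<alpha> u"] bound[of "max C 0"] by simp
  show "H_norm \<alpha> v \<le> C * H_norm \<alpha> u" if "0 \<le> C"
    using H_space_norm_leI(2)[of \<alpha> v "C * H_norm \<alpha> u"] bound[of C] that by simp
qed

lemma H_zero [simp]: "(0 :: 'd::finite tdist) \<in> H_space \<alpha>" "H_norm \<alpha> (0 :: 'd tdist) = 0"
proof -
  have "partial_norm \<alpha> 0 F \<le> 0" for F :: "(int ^ 'd) set"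
    by (simp add: partial_norm_def L2_set_def)
  from H_space_norm_leI[OF this]
  show "(0 :: 'd tdist) \<in> H_space \<alpha>" "H_norm \<alpha> (0 :: 'd tdist) = 0"
    using H_norm_nonneg[of \<alpha> 0] by (auto intro: antisym)
qed

lemma H_smul:
  assumes "u \<in> H_space \<alpha>"
  shows "c \<cdot>\<^sub>C u \<in> H_space \<alpha>" "H_norm \<alpha> (c \<cdot>\<^sub>C u) \<le> cmod c * H_norm \<alpha> u"
  using H_multiplier[OF assms, of "c \<cdot>\<^sub>C u" "cmod c"] by (simp_all add: smul_def norm_mult)

lemma H_uminus:
  assumes "u \<in> H_space \<alpha>"
  shows "- u \<in> H_space \<alpha>" "H_norm \<alpha> (- u) \<le> H_norm \<alpha> u"
  using H_multiplier[OF assms, of "- u" 1] by simp_all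

lemma H_diff:
  assumes "u \<in> H_space \<alpha>" "v \<in> H_space \<alpha>"
  shows "u - v \<in> H_space \<alpha>" "H_norm \<alpha> (u - v) \<le> H_norm \<alpha> u + H_norm \<alpha> v"
  using H_add[OF assms(1) H_uminus(1)[OF assms(2)]] H_uminus[OF assms(2)] by simp_all

lemma H_sum:
  assumes "\<And>j. j \<in> J \<Longrightarrow> u j \<in> H_space \<alpha>"
  shows "(\<Sum>j\<in>J. u j) \<in> H_space \<alpha> \<and> H_norm \<alpha> (\<Sum>j\<in>J. u j) \<le> (\<Sum>j\<in>J. H_norm \<alpha> (u j))"
  using assms
proof (induction J rule: infinite_finite_induct)
  case (insert j J)
  then have "u j \<in> H_space \<alpha>" "(\<Sum>j\<in>J. u j) \<in> H_space \<alpha>"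
    "H_norm \<alpha> (\<Sum>j\<in>J. u j) \<le> (\<Sum>j\<in>J. H_norm \<alpha> (u j))"
    by blast+
  then show ?case
    unfolding sum.insert[OF insert.hyps]
    using H_add[of "u j" \<alpha> "\<Sum>j\<in>J. u j"] by (meson add_left_mono order_trans)
qed simp_all

lemma H_heat:
  assumes "u \<in> H_space \<alpha>" "0 \<le> t"
  shows "heat t u \<in> H_space \<alpha>" "H_norm \<alpha> (heat t u) \<le> H_norm \<alpha> u"
proof -
  have "cmod (heat t u k) \<le> 1 * cmod (u k)" for k
    using assms(2) eig_pos[of k] by (simp add: heat_def norm_mult mult_left_le_one_le)
  then show "heat t u \<in> H_space \<alpha>" "H_norm \<alpha> (heat t u) \<le> H_norm \<alpha> u"
    using H_multiplier[OF assms(1), of "heat t u" 1] by simp_all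
qed

lemma H_proj_low:
  assumes "u \<in> H_space \<alpha>"
  shows "proj_low c0 N u \<in> H_space \<alpha>" "H_norm \<alpha> (proj_low c0 N u) \<le> H_norm \<alpha> u"
  using H_multiplier[OF assms, of "proj_low c0 N u" 1] by (simp_all add: proj_low_def)

text \<open>On the frequencies that survive the projection, \<open>h \<lambda> \<le> c\<^sub>0 h N\<^sup>2\<close>. For \<open>N = h\<^bsup>-\<sigma>/2\<^esup>\<close> the exponent is
  \<open>c\<^sub>0 h\<^bsup>1-\<sigma>\<^esup>\<close>, which is small on short intervals.\<close>

lemma H_heat_inv_low:
  assumes "u \<in> H_space \<alpha>" "0 \<le> h"
  shows "heat_inv_low c0 N h u \<in> H_space \<alpha>"
    "H_norm \<alpha> (heat_inv_low c0 N h u) \<le> exp (c0 * (h * N\<^sup>2)) * H_norm \<alpha> u"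
proof -
  have "cmod (heat_inv_low c0 N h u k) \<le> exp (c0 * (h * N\<^sup>2)) * cmod (u k)" for k
    using assms(2) mult_left_mono[of "eig k" "c0 * N\<^sup>2" h]
    by (simp add: heat_inv_low_def proj_low_def norm_mult mult_right_mono mult.left_commute[of c0])
  then show "heat_inv_low c0 N h u \<in> H_space \<alpha>"
    "H_norm \<alpha> (heat_inv_low c0 N h u) \<le> exp (c0 * (h * N\<^sup>2)) * H_norm \<alpha> u"
    using H_multiplier[OF assms(1), of "heat_inv_low c0 N h u" "exp (c0 * (h * N\<^sup>2))"] by simp_all
qed

lemma H_norm_coeff_tendsto:
  assumes "\<forall>\<^sub>F x in F. u x - v \<in> H_space \<alpha>" and "((\<lambda>x. H_norm \<alpha> (u x - v)) \<longlongrightarrow> 0) F"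
  shows "((\<lambda>x. u x k) \<longlongrightarrow> v k) F"
proof -
  let ?w = "eig k powr (\<alpha> / 2)"
  have w: "0 < ?w" using eig_pos[of k] by simp
  have "\<forall>\<^sub>F x in F. norm (u x k - v k) \<le> H_norm \<alpha> (u x - v) / ?w"
    using assms(1)
    by eventually_elim (use w coeff_le_H_norm[of _ \<alpha> k] in \<open>fastforce simp: field_simps\<close>)
  moreover have "((\<lambda>x. H_norm \<alpha> (u x - v) / ?w) \<longlongrightarrow> 0) F"
    using tendsto_divide[OF assms(2) tendsto_const[of ?w]] w by simp
  ultimately have "((\<lambda>x. u x k - v k) \<longlongrightarrow> 0) F"
    by (rule Lim_null_comparison)
  then show ?thesis by (simp add: LIM_zero_iff)
qed

text \<open>Fatou's lemma: each partial norm passes to the limit, hence so does a bound on all of them.\<close>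

lemma H_norm_Fatou:
  assumes F: "F \<noteq> bot" and lim: "\<And>k. ((\<lambda>x. u x k) \<longlongrightarrow> v k) F"
    and ev: "\<forall>\<^sub>F x in F. u x \<in> H_space \<alpha> \<and> H_norm \<alpha> (u x) \<le> C x" and C: "(C \<longlongrightarrow> c) F"
  shows "v \<in> H_space \<alpha>" "H_norm \<alpha> v \<le> c"
proof -
  have "partial_norm \<alpha> v A \<le> c" if "finite A" for A
  proof (rule tendsto_le[OF F C])
    show "((\<lambda>x. partial_norm \<alpha> (u x) A) \<longlongrightarrow> partial_norm \<alpha> v A) F"
      unfolding partial_norm_def L2_set_def by (intro tendsto_intros lim)
    show "\<forall>\<^sub>F x in F. partial_norm \<alpha> (u x) A \<le> C x"
      using ev by eventually_elim (use that partial_norm_le order_trans in blast)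
  qed
  then show "v \<in> H_space \<alpha>" "H_norm \<alpha> v \<le> c" using H_space_norm_leI by blast+
qed

text \<open>Strong continuity of the heat semigroup: the series for the squared norm is dominated, uniformly
  in time, by the one for \<open>u\<close>, hence it is continuous in time.\<close>

lemma heat_strongly_continuous:
  assumes u: "u \<in> H_space \<alpha>" and \<tau>: "0 \<le> \<tau>"
  shows "((\<lambda>t. H_norm \<alpha> (heat t u - heat \<tau> u)) \<longlongrightarrow> 0) (at \<tau> within {0..})"
proof -
  define f where "f k t = (cmod (A0_pow (\<alpha> / 2) (heat t u - heat \<tau> u) k))\<^sup>2" for k t
  define M where "M k = (cmod (A0_pow (\<alpha> / 2) u k))\<^sup>2" for k
  have "f k t \<le> M k" if "0 \<le> t" for k t
  proof -
    have "exp (- t * eig k) \<le> 1" "exp (- \<tau> * eig k) \<le> 1"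
      using \<tau> that eig_pos[of k] by simp_all
    then have "\<bar>exp (- t * eig k) - exp (- \<tau> * eig k)\<bar> \<le> 1"
      using exp_ge_zero[of "- t * eig k"] exp_ge_zero[of "- \<tau> * eig k"] by linarith
    then have "cmod (A0_pow (\<alpha> / 2) (heat t u - heat \<tau> u) k) \<le> 1 * cmod (A0_pow (\<alpha> / 2) u k)"
      by (simp add: A0_pow_def heat_def norm_mult mult_left_le_one_le mult_left_mono
          flip: left_diff_distrib of_real_diff)
    then show ?thesis unfolding f_def M_def by (intro power_mono) simp_all
  qed
  moreover have "M summable_on UNIV"
    using u unfolding M_def H_space_def L2_torus_def by simp
  ultimately have "uniform_limit {0..} (\<lambda>X t. \<Sum>k\<in>X. f k t) (\<lambda>t. \<Sum>\<^sub>\<infinity>k. f k t)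
      (finite_subsets_at_top UNIV)"
    by (intro Weierstrass_m_test_general[where M = M]) (auto simp: f_def)
  then have "continuous_on {0..} (\<lambda>t. \<Sum>\<^sub>\<infinity>k. f k t)"
    by (rule uniform_limit_theorem[rotated])
      (auto simp: f_def A0_pow_def heat_def intro!: always_eventually continuous_intros)
  then have "((\<lambda>t. \<Sum>\<^sub>\<infinity>k. f k t) \<longlongrightarrow> (\<Sum>\<^sub>\<infinity>k. f k \<tau>)) (at \<tau> within {0..})"
    using \<tau> by (simp add: continuous_on_def)
  then have "((\<lambda>t. sqrt (\<Sum>\<^sub>\<infinity>k. f k t)) \<longlongrightarrow> sqrt 0) (at \<tau> within {0..})"
    by (intro tendsto_intros) (simp add: f_def A0_pow_def)
  then show ?thesis by (simp add: H_norm_def l2_norm_def f_def)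
qed

lemma heat_add: "heat s (heat t u) = heat (s + t) u"
proof -
  have "exp (- s * eig k) * exp (- t * eig k) = exp (- (s + t) * eig k)" for k :: "int ^ 'a"
    by (simp add: mult_exp_exp algebra_simps)
  then show ?thesis
    by (simp add: heat_def fun_eq_iff flip: of_real_mult mult.assoc)
qed

lemma heat_0 [simp]: "heat 0 u = u"
  by (simp add: heat_def)

lemma heat_diff: "heat t (u - v) = heat t u - heat t v"
  by (rule ext) (simp add: heat_def algebra_simps)

lemma heat_plus: "heat t (u + v) = heat t u + heat t v"
  by (rule ext) (simp add: heat_def algebra_simps)

lemma heat_uminus: "heat t (- u) = - heat t u"
  by (rule ext) (simp add: heat_def algebra_simps)

lemma heat_zero [simp]: "heat t 0 = 0"
  by (rule ext) (simp add: heat_def)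

section \<open>Three-time increments of finite norm\<close>

lemma C_maps_H_space: "g \<in> C_maps \<alpha> D \<Longrightarrow> x \<in> D \<Longrightarrow> g x \<in> H_space \<alpha>"
  by (simp add: C_maps_def)

lemma C_maps_tendsto:
  fixes x :: "'a::t2_space"
  assumes g: "g \<in> C_maps \<alpha> D" and x: "x \<in> D"
    and ev: "\<forall>\<^sub>F n in F. xs n \<in> D" and lim: "(xs \<longlongrightarrow> x) F"
  shows "((\<lambda>n. H_norm \<alpha> (g (xs n) - g x)) \<longlongrightarrow> 0) F" "((\<lambda>n. g (xs n) k) \<longlongrightarrow> g x k) F"
proof -
  have "continuous (at x within D) (\<lambda>y. H_norm \<alpha> (g y - g x))"
    using g x by (simp add: C_maps_def continuous_within)
  then have "((\<lambda>n. H_norm \<alpha> (g (xs n) - g x)) \<longlongrightarrow> H_norm \<alpha> (g x - g x)) F"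
    using ev lim by (rule continuous_within_tendsto_compose)
  then show *: "((\<lambda>n. H_norm \<alpha> (g (xs n) - g x)) \<longlongrightarrow> 0) F" by simp
  show "((\<lambda>n. g (xs n) k) \<longlongrightarrow> g x k) F"
    using * by (rule H_norm_coeff_tendsto[rotated])
      (use ev in \<open>auto elim!: eventually_mono intro!: H_diff C_maps_H_space[OF g] x\<close>)
qed

lemma SUP_ennreal_leD:
  assumes "(SUP x\<in>A. ennreal (f x)) \<le> X" "X < \<infinity>" "x \<in> A"
  shows "f x \<le> enn2real X"
proof -
  have "ennreal (f x) \<le> X" using assms(1,3) by (meson SUP_upper order_trans)
  moreover have "ennreal (enn2real X) = X" using assms(2) by simp
  ultimately have "ennreal (f x) \<le> ennreal (enn2real X)" by simp
  then show ?thesis by (subst (asm) ennreal_le_iff) simp_all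
qed

text \<open>The norms only see times \<open>s < u < t\<close>. By continuity the resulting bound persists on the
  degenerate faces \<open>u = t\<close> and \<open>u = s\<close>, where it says that the increment vanishes.\<close>

lemma norm_split_bound:
  assumes h: "h \<in> C_maps \<alpha> (simplex3 T)" and fin: "norm_split T \<rho> \<rho>' \<alpha> h < \<infinity>"
    and \<rho>: "0 < \<rho>" "0 < \<rho>'" and T: "0 < T" and x: "(t, u, s) \<in> simplex3 T"
  shows "H_norm \<alpha> (h (t, u, s)) \<le> enn2real (norm_split T \<rho> \<rho>' \<alpha> h) * ((t - u) powr \<rho> * (u - s) powr \<rho>')"
proof -
  let ?c = "enn2real (norm_split T \<rho> \<rho>' \<alpha> h)"
  have strict: "H_norm \<alpha> (h (t, u, s)) \<le> ?c * ((t - u) powr \<rho> * (u - s) powr \<rho>')"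
    if "0 \<le> s" "s < u" "u < t" "t \<le> T" for t u s
  proof -
    let ?A = "{(t, u, s). 0 \<le> s \<and> s < u \<and> u < t \<and> t \<le> T}"
    let ?f = "\<lambda>(t, u, s). H_norm \<alpha> (h (t, u, s)) / ((t - u) powr \<rho> * (u - s) powr \<rho>')"
    have "(SUP x\<in>?A. ennreal (?f x)) = norm_split T \<rho> \<rho>' \<alpha> h"
      unfolding norm_split_def by (intro SUP_cong) auto
    then have "?f (t, u, s) \<le> ?c"
      using that fin by (intro SUP_ennreal_leD[of ?f ?A]) auto
    then show ?thesis
      using that by (simp add: divide_le_eq)
  qed
  have s: "0 \<le> s" "s \<le> u" "u \<le> t" "t \<le> T" using x by (auto simp: simplex3_def)
  \<comment> \<open>Move towards the interior point \<open>(T, T/2, 0)\<close> of the simplex.\<close>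
  define \<epsilon> where "\<epsilon> n = inverse (real (Suc n))" for n
  define mv where "mv n r p = (1 - \<epsilon> n) * r + \<epsilon> n * p" for n and r p :: real
  have \<epsilon>: "0 < \<epsilon> n" "\<epsilon> n \<le> 1" for n by (auto simp: \<epsilon>_def field_simps)
  have "(\<lambda>n. mv n r p) \<longlonglongrightarrow> (1 - 0) * r + 0 * p" for r p
    unfolding mv_def \<epsilon>_def by (intro tendsto_intros LIMSEQ_inverse_real_of_nat)
  then have lim: "(\<lambda>n. mv n r p) \<longlonglongrightarrow> r" for r p by simp
  have mono: "mv n r p < mv n r' p'" if "r \<le> r'" "p < p'" for n r p r' p'
    unfolding mv_def using that \<epsilon>[of n] by (intro add_le_less_mono mult_left_mono mult_strict_left_mono) auto
  have "mv n t T \<le> (1 - \<epsilon> n) * T + \<epsilon> n * T" for n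
    unfolding mv_def using s \<epsilon>[of n] by (intro add_mono mult_left_mono) auto
  then have upper: "mv n t T \<le> T" for n by (simp add: algebra_simps)
  have lower: "0 \<le> mv n s 0" for n
    unfolding mv_def using s \<epsilon>[of n] by simp
  let ?x = "\<lambda>n. (mv n t T, mv n u (T / 2), mv n s 0)"
  have order: "mv n s 0 < mv n u (T / 2)" "mv n u (T / 2) < mv n t T" for n
    using s T by (auto intro!: mono)
  have in_simplex: "?x n \<in> simplex3 T" for n
    using order[of n] upper[of n] lower[of n] by (auto simp: simplex3_def)
  have lim_x: "?x \<longlonglongrightarrow> (t, u, s)" by (intro tendsto_Pair lim)
  show ?thesis
  proof (rule H_norm_Fatou(2)[where u = "\<lambda>n. h (?x n)"])
    show "(\<lambda>n. h (?x n) k) \<longlonglongrightarrow> h (t, u, s) k" for k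
      using C_maps_tendsto(2)[OF h x _ lim_x] in_simplex by auto
    show "\<forall>\<^sub>F n in sequentially. h (?x n) \<in> H_space \<alpha> \<and> H_norm \<alpha> (h (?x n)) \<le>
        ?c * ((mv n t T - mv n u (T / 2)) powr \<rho> * (mv n u (T / 2) - mv n s 0) powr \<rho>')"
      using strict[OF lower order upper] C_maps_H_space[OF h in_simplex] by (intro always_eventually) auto
    show "(\<lambda>n. ?c * ((mv n t T - mv n u (T / 2)) powr \<rho> * (mv n u (T / 2) - mv n s 0) powr \<rho>'))
        \<longlonglongrightarrow> ?c * ((t - u) powr \<rho> * (u - s) powr \<rho>')"
      using \<rho> order by (intro tendsto_intros tendsto_powr2 lim always_eventually) (auto intro: less_imp_le)
  qed simp
qed

lemma norm3_decomposition:
  assumes X: "norm3 T \<gamma> \<alpha> H < X" and T: "0 < T"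
  obtains m :: nat and \<rho> c where "\<And>j. j < m \<Longrightarrow> 0 < \<rho> j \<and> \<rho> j < \<gamma> \<and> 0 \<le> c j"
    "(\<Sum>j<m. ennreal (c j)) < X"
    "\<And>t u s. (t, u, s) \<in> simplex3 T \<Longrightarrow>
       H_norm \<alpha> (H (t, u, s)) \<le> (\<Sum>j<m. c j * ((t - u) powr \<rho> j * (u - s) powr (\<gamma> - \<rho> j)))"
proof -
  obtain m :: nat and \<rho> hs where \<rho>: "\<forall>j<m. 0 < \<rho> j \<and> \<rho> j < \<gamma>"
    and hs: "\<forall>j<m. hs j \<in> C_maps \<alpha> (simplex3 T)" and H: "\<forall>x\<in>simplex3 T. H x = (\<Sum>j<m. hs j x)"
    and less: "(\<Sum>j<m. norm_split T (\<rho> j) (\<gamma> - \<rho> j) \<alpha> (hs j)) < X"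
    using X unfolding norm3_def Inf_less_iff by blast
  have "norm_split T (\<rho> j) (\<gamma> - \<rho> j) \<alpha> (hs j) \<le> (\<Sum>j<m. norm_split T (\<rho> j) (\<gamma> - \<rho> j) \<alpha> (hs j))"
    if "j < m" for j
    using that by (intro member_le_sum) auto
  then have fin: "norm_split T (\<rho> j) (\<gamma> - \<rho> j) \<alpha> (hs j) < \<infinity>" if "j < m" for j
    using order_le_less_trans[OF _ order_less_le_trans[OF less top_greatest]] that by simp
  define c where "c j = enn2real (norm_split T (\<rho> j) (\<gamma> - \<rho> j) \<alpha> (hs j))" for j
  show thesis
  proof (rule that[of m \<rho> c])
    show "0 < \<rho> j \<and> \<rho> j < \<gamma> \<and> 0 \<le> c j" if "j < m" for j using \<rho> that by (simp add: c_def)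
    have "(\<Sum>j<m. ennreal (c j)) = (\<Sum>j<m. norm_split T (\<rho> j) (\<gamma> - \<rho> j) \<alpha> (hs j))"
      using fin by (intro sum.cong) (auto simp: c_def)
    then show "(\<Sum>j<m. ennreal (c j)) < X" using less by simp
    fix t u s assume x: "(t, u, s) \<in> simplex3 T"
    have "H_norm \<alpha> (H (t, u, s)) \<le> (\<Sum>j<m. H_norm \<alpha> (hs j (t, u, s)))"
      unfolding bspec[OF H x] using hs x by (intro conjunct2[OF H_sum] C_maps_H_space) auto
    also have "\<dots> \<le> (\<Sum>j<m. c j * ((t - u) powr \<rho> j * (u - s) powr (\<gamma> - \<rho> j)))"
      unfolding c_def using \<rho> hs fin x T by (intro sum_mono norm_split_bound) auto
    finally show "H_norm \<alpha> (H (t, u, s)) \<le> \<dots>" .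
  qed
qed

text \<open>Every admissible splitting of exponents collapses to \<open>(t - s)\<^sup>\<gamma>\<close>, since both \<open>t - u\<close> and \<open>u - s\<close> are
  at most \<open>t - s\<close>. The size estimates below use the increment in this form.\<close>

lemma norm3_bound:
  assumes fin: "norm3 T \<gamma> \<alpha> H < \<infinity>" and T: "0 < T" and x: "(t, u, s) \<in> simplex3 T"
  shows "H_norm \<alpha> (H (t, u, s)) \<le> enn2real (norm3 T \<gamma> \<alpha> H) * (t - s) powr \<gamma>"
proof (rule field_le_epsilon)
  fix e :: real assume e: "0 < e"
  let ?M = "enn2real (norm3 T \<gamma> \<alpha> H)" and ?p = "(t - s) powr \<gamma>"
  \<comment> \<open>Slack for a decomposition of \<open>H\<close> that is optimal up to \<open>d\<close>; the \<open>1\<close> avoids division by zero.\<close>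
  define d where "d = e / (1 + ?p)"
  have p: "0 < 1 + ?p" by (simp add: add_pos_nonneg)
  then have d: "0 < d" using e by (simp add: d_def)
  have s: "0 \<le> s" "s \<le> u" "u \<le> t" using x by (auto simp: simplex3_def)
  have "ennreal ?M < ennreal (?M + d)" using d by (simp add: ennreal_less_iff)
  then have "norm3 T \<gamma> \<alpha> H < ennreal (?M + d)" using fin by simp
  then obtain m :: nat and \<rho> c where \<rho>: "\<And>j. j < m \<Longrightarrow> 0 < \<rho> j \<and> \<rho> j < \<gamma> \<and> 0 \<le> c j"
    and c: "(\<Sum>j<m. ennreal (c j)) < ennreal (?M + d)"
    and le: "\<And>t u s. (t, u, s) \<in> simplex3 T \<Longrightarrow>
       H_norm \<alpha> (H (t, u, s)) \<le> (\<Sum>j<m. c j * ((t - u) powr \<rho> j * (u - s) powr (\<gamma> - \<rho> j)))"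
    by (rule norm3_decomposition[OF _ T]) blast
  have "(\<Sum>j<m. ennreal (c j)) = ennreal (\<Sum>j<m. c j)" using \<rho> by (intro sum_ennreal) auto
  moreover have "0 \<le> (\<Sum>j<m. c j)" using \<rho> by (intro sum_nonneg) auto
  ultimately have c_le: "(\<Sum>j<m. c j) \<le> ?M + d" using c by (simp add: ennreal_less_iff)
  have split: "(t - u) powr \<rho> j * (u - s) powr (\<gamma> - \<rho> j) \<le> ?p" if "j < m" for j
  proof -
    have "(t - u) powr \<rho> j * (u - s) powr (\<gamma> - \<rho> j) \<le> (t - s) powr \<rho> j * (t - s) powr (\<gamma> - \<rho> j)"
      using \<rho>[OF that] s by (intro mult_mono powr_mono2) auto
    then show ?thesis by (simp flip: powr_add)
  qed
  have "H_norm \<alpha> (H (t, u, s)) \<le> (\<Sum>j<m. c j * ?p)"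
    using \<rho> split by (intro order_trans[OF le[OF x]] sum_mono mult_left_mono) auto
  also have "\<dots> \<le> (?M + d) * ?p"
    unfolding sum_distrib_right[symmetric] by (intro mult_right_mono c_le) simp
  also have "\<dots> \<le> ?M * ?p + d * (1 + ?p)"
    using d by (simp add: algebra_simps)
  also have "d * (1 + ?p) = e" using p by (simp add: d_def)
  finally show "H_norm \<alpha> (H (t, u, s)) \<le> ?M * ?p + e" by simp
qed

text \<open>In \<open>H\<^bsub>ts0\<^esub>\<close> the total length is \<open>t\<close>, so the preceding bound does not see a small \<open>t - s\<close>. The factor
  \<open>(t - s)\<close> to the power \<open>\<rho>\<^sub>j\<close> in each summand does; this is the continuity of the germ on the diagonal.\<close>

lemma germ_small:
  assumes fin: "norm3 T \<gamma> \<alpha> H < \<infinity>" and T: "0 < T" and e: "0 < e"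
  shows "\<exists>d>0. \<forall>s t. 0 \<le> s \<and> s \<le> t \<and> t \<le> T \<and> t - s < d \<longrightarrow> H_norm \<alpha> (H (t, s, 0)) < e"
proof -
  obtain m :: nat and \<rho> c where \<rho>: "\<And>j. j < m \<Longrightarrow> 0 < \<rho> j \<and> \<rho> j < \<gamma> \<and> 0 \<le> c j"
    and "(\<Sum>j<m. ennreal (c j)) < \<infinity>"
    and le: "\<And>t u s. (t, u, s) \<in> simplex3 T \<Longrightarrow>
       H_norm \<alpha> (H (t, u, s)) \<le> (\<Sum>j<m. c j * ((t - u) powr \<rho> j * (u - s) powr (\<gamma> - \<rho> j)))"
    by (rule norm3_decomposition[OF fin T]) blast
  let ?f = "\<lambda>r. \<Sum>j<m. c j * (r powr \<rho> j * T powr (\<gamma> - \<rho> j))"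
  have "(?f \<longlongrightarrow> (\<Sum>j<m. c j * (0 powr \<rho> j * T powr (\<gamma> - \<rho> j)))) (at 0 within {0..})"
    using \<rho> by (intro tendsto_intros tendsto_powr2) (auto simp: eventually_at_filter)
  then have "(?f \<longlongrightarrow> 0) (at 0 within {0..})" by simp
  then have "\<forall>\<^sub>F r in at 0 within {0..}. ?f r < e" using e by (rule order_tendstoD)
  then obtain d where d: "0 < d" "\<And>r. 0 \<le> r \<Longrightarrow> r \<noteq> 0 \<Longrightarrow> r < d \<Longrightarrow> ?f r < e"
    by (auto simp: eventually_at dist_real_def)
  have small: "?f r < e" if "0 \<le> r" "r < d" for r
    using d(2)[of r] that e by (cases "r = 0") auto
  show ?thesis
  proof (intro exI[of _ d] conjI allI impI d(1))
    fix s t assume st: "0 \<le> s \<and> s \<le> t \<and> t \<le> T \<and> t - s < d"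
    have "H_norm \<alpha> (H (t, s, 0)) \<le> (\<Sum>j<m. c j * ((t - s) powr \<rho> j * (s - 0) powr (\<gamma> - \<rho> j)))"
      using st by (intro le) (auto simp: simplex3_def)
    also have "\<dots> \<le> ?f (t - s)"
    proof (intro sum_mono mult_left_mono powr_mono2)
      fix j assume "j \<in> {..<m}"
      then show "0 \<le> \<gamma> - \<rho> j" "0 \<le> c j" using \<rho>[of j] by auto
    qed (use st in auto)
    also have "\<dots> < e" using small st by simp
    finally show "H_norm \<alpha> (H (t, s, 0)) < e" .
  qed
qed

text \<open>This is where every exponent being strictly between \<open>0\<close> and \<open>\<gamma>\<close> matters: both powers vanish at zero.\<close>

lemma H_degenerate_zero:
  assumes H: "H \<in> C3 T \<gamma> \<alpha>" and T: "0 < T" and s: "(t, u, s) \<in> simplex3 T" "u = t \<or> u = s"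
  shows "H (t, u, s) = 0"
proof (rule ext)
  fix k
  from H have fin: "norm3 T \<gamma> \<alpha> H < \<infinity>" and HC: "H \<in> C_maps \<alpha> (simplex3 T)" by (simp_all add: C3_def)
  obtain m :: nat and \<rho> c where \<rho>: "\<And>j. j < m \<Longrightarrow> 0 < \<rho> j \<and> \<rho> j < \<gamma> \<and> 0 \<le> c j"
    and "(\<Sum>j<m. ennreal (c j)) < \<infinity>"
    and le: "\<And>t u s. (t, u, s) \<in> simplex3 T \<Longrightarrow>
       H_norm \<alpha> (H (t, u, s)) \<le> (\<Sum>j<m. c j * ((t - u) powr \<rho> j * (u - s) powr (\<gamma> - \<rho> j)))"
    by (rule norm3_decomposition[OF fin T]) blast
  have "(\<Sum>j<m. c j * ((t - u) powr \<rho> j * (u - s) powr (\<gamma> - \<rho> j))) = 0"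
    using s(2) by (intro sum.neutral) auto
  with le[OF s(1)] have "H_norm \<alpha> (H (t, u, s)) \<le> 0" by simp
  then have "eig k powr (\<alpha> / 2) * cmod (H (t, u, s) k) \<le> 0"
    using coeff_le_H_norm[OF C_maps_H_space[OF HC s(1)], of k] by simp
  then show "H (t, u, s) k = 0 k"
    using eig_pos[of k] by (simp add: mult_le_0_iff)
qed

lemma smul_diff: "c \<cdot>\<^sub>C u - c \<cdot>\<^sub>C v = c \<cdot>\<^sub>C (u - v)"
  by (simp add: smul_def fun_eq_iff algebra_simps)

lemma C_maps_smul:
  assumes g: "g \<in> C_maps \<alpha> D"
  shows "(\<lambda>x. c \<cdot>\<^sub>C g x) \<in> C_maps \<alpha> D"
  unfolding C_maps_def
proof (intro CollectI conjI ballI)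
  fix x assume x: "x \<in> D"
  show "c \<cdot>\<^sub>C g x \<in> H_space \<alpha>" by (rule H_smul(1)[OF C_maps_H_space[OF g x]])
  have "((\<lambda>y. H_norm \<alpha> (g y - g x)) \<longlongrightarrow> 0) (at x within D)" using g x by (simp add: C_maps_def)
  then have lim: "((\<lambda>y. cmod c * H_norm \<alpha> (g y - g x)) \<longlongrightarrow> 0) (at x within D)"
    by (rule tendsto_mult_right_zero)
  have "norm (H_norm \<alpha> (c \<cdot>\<^sub>C g y - c \<cdot>\<^sub>C g x)) \<le> cmod c * H_norm \<alpha> (g y - g x)" if "y \<in> D" for y
    unfolding smul_diff real_norm_def abs_of_nonneg[OF H_norm_nonneg]
    by (intro H_smul(2) H_diff(1) C_maps_H_space[OF g] x that)
  then have "\<forall>\<^sub>F y in at x within D. norm (H_norm \<alpha> (c \<cdot>\<^sub>C g y - c \<cdot>\<^sub>C g x)) \<le> cmod c * H_norm \<alpha> (g y - g x)"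
    unfolding eventually_at_filter by (intro always_eventually) blast
  from Lim_null_comparison[OF this lim]
  show "((\<lambda>y. H_norm \<alpha> (c \<cdot>\<^sub>C g y - c \<cdot>\<^sub>C g x)) \<longlongrightarrow> 0) (at x within D)" .
qed

lemma sum_tdist_apply: "(\<Sum>j\<in>J. u j) k = (\<Sum>j\<in>J. (u j :: 'd::finite tdist) k)"
  by (induction J rule: infinite_finite_induct) simp_all

lemma norm3_scale_le_1:
  assumes fin: "norm3 T \<gamma> \<alpha> H < \<infinity>"
  shows "\<exists>r>0. norm3 T \<gamma> \<alpha> (\<lambda>x. of_real r \<cdot>\<^sub>C H x) \<le> 1"
proof -
  obtain m :: nat and \<rho> hs where \<rho>: "\<forall>j<m. 0 < \<rho> j \<and> \<rho> j < \<gamma>"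
    and hs: "\<forall>j<m. hs j \<in> C_maps \<alpha> (simplex3 T)" and H: "\<forall>x\<in>simplex3 T. H x = (\<Sum>j<m. hs j x)"
    and less: "(\<Sum>j<m. norm_split T (\<rho> j) (\<gamma> - \<rho> j) \<alpha> (hs j)) < \<infinity>"
    using fin unfolding norm3_def Inf_less_iff by blast
  \<comment> \<open>One decomposition of finite weight is scaled until its weight is at most \<open>1\<close>.\<close>
  define N where "N = enn2real (\<Sum>j<m. norm_split T (\<rho> j) (\<gamma> - \<rho> j) \<alpha> (hs j))"
  define r where "r = 1 / (1 + N)"
  have N: "0 \<le> N" by (simp add: N_def)
  then have r: "0 < r" "r * N \<le> 1" by (simp_all add: r_def)
  let ?h = "\<lambda>j x. complex_of_real r \<cdot>\<^sub>C hs j x"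
  have C: "?h j \<in> C_maps \<alpha> (simplex3 T)" if "j < m" for j
    using hs that by (intro C_maps_smul) auto
  have split: "norm_split T (\<rho> j) (\<gamma> - \<rho> j) \<alpha> (?h j) \<le> ennreal r * norm_split T (\<rho> j) (\<gamma> - \<rho> j) \<alpha> (hs j)"
    if j: "j < m" for j
    unfolding norm_split_def
  proof (rule SUP_least, clarify)
    fix t u s :: real assume x: "0 \<le> s" "s < u" "u < t" "t \<le> T"
    let ?A = "{(t, u, s). 0 \<le> s \<and> s < u \<and> u < t \<and> t \<le> T}"
    let ?d = "(t - u) powr \<rho> j * (u - s) powr (\<gamma> - \<rho> j)"
    have "hs j (t, u, s) \<in> H_space \<alpha>"
      using hs j x by (intro C_maps_H_space[of _ _ "simplex3 T"]) (auto simp: simplex3_def)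
    then have "H_norm \<alpha> (?h j (t, u, s)) / ?d \<le> r * (H_norm \<alpha> (hs j (t, u, s)) / ?d)"
      using H_smul(2)[of "hs j (t, u, s)" \<alpha> "complex_of_real r"] r by (simp add: divide_right_mono)
    then have "ennreal (H_norm \<alpha> (?h j (t, u, s)) / ?d) \<le> ennreal r * ennreal (H_norm \<alpha> (hs j (t, u, s)) / ?d)"
      using r by (simp add: ennreal_leI flip: ennreal_mult)
    also have "ennreal (H_norm \<alpha> (hs j (t, u, s)) / ?d) \<le> (SUP (t, u, s)\<in>?A.
        ennreal (H_norm \<alpha> (hs j (t, u, s)) / ((t - u) powr \<rho> j * (u - s) powr (\<gamma> - \<rho> j))))"
      using x by (intro SUP_upper2[of "(t, u, s)"]) auto
    finally show "ennreal (H_norm \<alpha> (?h j (t, u, s)) / ?d) \<le> ennreal r * \<dots>"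
      by (simp add: mult_left_mono)
  qed
  have "norm3 T \<gamma> \<alpha> (\<lambda>x. of_real r \<cdot>\<^sub>C H x) \<le> (\<Sum>j<m. norm_split T (\<rho> j) (\<gamma> - \<rho> j) \<alpha> (?h j))"
    unfolding norm3_def
  proof (rule Inf_lower, intro CollectI exI[of _ m] exI[of _ \<rho>] exI[of _ ?h] conjI refl \<rho> allI impI ballI)
    show "?h j \<in> C_maps \<alpha> (simplex3 T)" if "j < m" for j by (rule C[OF that])
    fix x assume "x \<in> simplex3 T"
    then show "complex_of_real r \<cdot>\<^sub>C H x = (\<Sum>j<m. ?h j x)"
      using H by (simp add: smul_def fun_eq_iff sum_distrib_left sum_tdist_apply)
  qed
  also have "\<dots> \<le> (\<Sum>j<m. ennreal r * norm_split T (\<rho> j) (\<gamma> - \<rho> j) \<alpha> (hs j))"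
    using split by (intro sum_mono) auto
  also have "\<dots> = ennreal r * ennreal N"
    using less unfolding sum_distrib_left[symmetric] N_def by simp
  also have "\<dots> \<le> 1"
    using r N by (metis ennreal_1 ennreal_leI ennreal_mult less_imp_le)
  finally show ?thesis using r(1) by blast
qed

section \<open>Weights for the dyadic estimates\<close>

text \<open>A sequence \<open>w\<^sub>n\<close> with \<open>w\<^sub>n / 2 + L\<^sub>n\<^sup>\<gamma> \<le> w\<^bsub>n+1\<^esub>\<close> for \<open>L\<^sub>n = T / 2\<^sup>n\<close>, the recursion obeyed by the
  residuals of adjacent points. For \<open>\<gamma> < 1\<close> the source decays more slowly than the homogeneous solution
  \<open>2\<^sup>-\<^sup>n\<close> and dominates it; at \<open>\<gamma> = 1\<close> both decay alike, hence the factor \<open>n\<close>.\<close>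

definition child_weight :: "real \<Rightarrow> real \<Rightarrow> nat \<Rightarrow> real" where
  "child_weight \<gamma> T n = (if \<gamma> < 1 then 1 / (2 powr - \<gamma> - 1 / 2) * (T / 2 ^ n) powr \<gamma>
     else 2 * real n * (T / 2 ^ n))"

definition chain_const :: "real \<Rightarrow> real" where
  "chain_const \<gamma> = (if \<gamma> < 1 then (1 / (2 powr - \<gamma> - 1 / 2) + 1) / (1 - 2 powr - \<gamma>) else 8)"

text \<open>The weight of a chain starting at level \<open>n\<close>: a sequence whose decrease from \<open>n\<close> to \<open>n + 1\<close> pays for
  one adjacent residual of level \<open>n + 1\<close> and one application of \<open>H\<close> at scale \<open>L\<^sub>n\<close>. For \<open>\<gamma> < 1\<close> its
  constant is the sum of a geometric series with ratio \<open>2\<^bsup>-\<gamma>\<^esup>\<close>; at \<open>\<gamma> = 1\<close> the constant \<open>8\<close> above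
  belongs to the comparison of \<open>2 n + 6\<close> with \<open>1 + \<bar>ln r\<bar>\<close> for intervals of length \<open>r\<close>.\<close>

definition chain_weight :: "real \<Rightarrow> real \<Rightarrow> nat \<Rightarrow> real" where
  "chain_weight \<gamma> T n = (if \<gamma> < 1 then chain_const \<gamma> * (T / 2 ^ n) powr \<gamma>
     else (2 * real n + 6) * (T / 2 ^ n))"

text \<open>The modulus of continuity in the two target norms, for treating both ranges of \<open>\<gamma>\<close> at once.\<close>

definition gauge :: "real \<Rightarrow> real \<Rightarrow> real" where
  "gauge \<gamma> r = (if \<gamma> < 1 then r powr \<gamma> else r * (1 + \<bar>ln r\<bar>))"

lemma half_less_powr: "\<gamma> < 1 \<Longrightarrow> 1 / 2 < (2 :: real) powr - \<gamma>"
  using powr_less_mono[of "-1" "- \<gamma>" 2] by (simp add: powr_minus)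

lemma powr_less_one: "0 < \<gamma> \<Longrightarrow> (2 :: real) powr - \<gamma> < 1"
  using powr_less_mono[of "- \<gamma>" 0 2] by simp

lemma half_powr: "0 \<le> x \<Longrightarrow> (x / 2) powr \<gamma> = 2 powr - \<gamma> * (x :: real) powr \<gamma>"
  by (simp add: powr_divide powr_minus divide_simps)

lemma child_weight_step:
  assumes "0 < \<gamma>" "\<gamma> \<le> 1" "0 < T"
  shows "child_weight \<gamma> T n / 2 + (T / 2 ^ n) powr \<gamma> \<le> child_weight \<gamma> T (Suc n)"
proof (cases "\<gamma> < 1")
  case True
  define q where "q = (2 :: real) powr - \<gamma>"
  define x where "x = (T / 2 ^ n) powr \<gamma>"
  have q: "1 / 2 < q" using half_less_powr[OF True] by (simp add: q_def)
  have "(T / 2 ^ Suc n) powr \<gamma> = q * x"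
    using half_powr[of "T / 2 ^ n" \<gamma>] assms by (simp add: q_def x_def mult.commute)
  then show ?thesis
    using True q by (simp add: child_weight_def flip: x_def q_def) (simp add: field_simps)
next
  case False
  then show ?thesis using assms by (simp add: child_weight_def field_simps)
qed

lemma chain_const_ge:
  assumes "0 < \<gamma>" "\<gamma> < 1"
  shows "1 / (2 powr - \<gamma> - 1 / 2) + 1 \<le> chain_const \<gamma>"
proof -
  have "0 < 1 / (2 powr - \<gamma> - 1 / 2) + (1 :: real)"
    using half_less_powr[OF assms(2)] by (intro add_pos_pos) auto
  then show ?thesis
    using powr_less_one[OF assms(1)] assms(2) by (simp add: chain_const_def le_divide_eq mult_le_cancel_left1)
qed

lemma chain_weight_step:
  assumes "0 < \<gamma>" "\<gamma> \<le> 1" "0 < T"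
  shows "chain_weight \<gamma> T (Suc n) + child_weight \<gamma> T (Suc n) + (T / 2 ^ n) powr \<gamma> \<le> chain_weight \<gamma> T n"
proof (cases "\<gamma> < 1")
  case True
  define q where "q = (2 :: real) powr - \<gamma>"
  define x where "x = (T / 2 ^ n) powr \<gamma>"
  define D where "D = 1 / (q - 1 / 2)"
  define c where "c = chain_const \<gamma>"
  have q: "1 / 2 < q" "q < 1" using half_less_powr[OF True] powr_less_one assms by (simp_all add: q_def)
  have x: "0 \<le> x" by (simp add: x_def)
  have D: "0 < D" using q by (simp add: D_def)
  have c: "c * (1 - q) = D + 1"
    using True q by (simp add: c_def chain_const_def D_def flip: q_def)
  have "(T / 2 ^ Suc n) powr \<gamma> = q * x"
    using half_powr[of "T / 2 ^ n" \<gamma>] assms by (simp add: q_def x_def mult.commute)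
  moreover have "D * q \<le> D" using D q by simp
  then have "(c * q + D * q + 1) * x \<le> c * x"
    using c x by (intro mult_right_mono) (auto simp: algebra_simps)
  ultimately show ?thesis
    using True by (simp add: child_weight_def chain_weight_def algebra_simps flip: x_def q_def D_def c_def)
next
  case False
  then show ?thesis using assms by (simp add: chain_weight_def child_weight_def field_simps)
qed

lemma weights_le_chain_weight:
  assumes "0 < \<gamma>" "\<gamma> \<le> 1" "0 < T"
  shows "0 \<le> child_weight \<gamma> T n" "child_weight \<gamma> T n \<le> chain_weight \<gamma> T n"
    "(T / 2 ^ n) powr \<gamma> \<le> chain_weight \<gamma> T n"
proof -
  have *: "0 \<le> child_weight \<gamma> T n \<and> child_weight \<gamma> T n \<le> chain_weight \<gamma> T n \<and>
     (T / 2 ^ n) powr \<gamma> \<le> chain_weight \<gamma> T n"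
  proof (cases "\<gamma> < 1")
    case True
    define D where "D = 1 / ((2 :: real) powr - \<gamma> - 1 / 2)"
    have D: "0 < D" "D + 1 \<le> chain_const \<gamma>"
      using half_less_powr[OF True] chain_const_ge[OF assms(1) True] by (simp_all add: D_def)
    then have "D * x \<le> chain_const \<gamma> * x" "1 * x \<le> chain_const \<gamma> * x" if "0 \<le> x" for x
      using that mult_right_mono[of 1 "chain_const \<gamma>" x] by (auto intro!: mult_right_mono)
    from this[of "(T / 2 ^ n) powr \<gamma>"] show ?thesis
      using True D by (simp add: child_weight_def chain_weight_def flip: D_def)
  next
    case False
    then have "\<gamma> = 1" using assms by simp
    then show ?thesis using assms by (simp add: child_weight_def chain_weight_def field_simps)
  qed
  then show "0 \<le> child_weight \<gamma> T n" "child_weight \<gamma> T n \<le> chain_weight \<gamma> T n"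
    "(T / 2 ^ n) powr \<gamma> \<le> chain_weight \<gamma> T n" by auto
qed

lemma chain_weight_nonneg: "0 < \<gamma> \<Longrightarrow> \<gamma> \<le> 1 \<Longrightarrow> 0 < T \<Longrightarrow> 0 \<le> chain_weight \<gamma> T n"
  using weights_le_chain_weight[of \<gamma> T n] by linarith

lemma chain_const_pos: "0 < \<gamma> \<Longrightarrow> \<gamma> \<le> 1 \<Longrightarrow> 0 < chain_const \<gamma>"
proof (cases "\<gamma> < 1")
  case True
  assume "0 < \<gamma>"
  moreover have "0 < 1 / ((2 :: real) powr - \<gamma> - 1 / 2)" using half_less_powr[OF True] by simp
  ultimately show ?thesis using chain_const_ge[OF _ True] by linarith
qed (simp add: chain_const_def)

text \<open>At \<open>\<gamma> = 1\<close> the level \<open>n\<close> of an interval of length \<open>T / 2\<^sup>n\<close> is comparable to the logarithm of its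
  length.\<close>

lemma chain_weight_le_gauge:
  assumes \<gamma>: "0 < \<gamma>" "\<gamma> \<le> 1" and T: "0 < T" "T \<le> 1" and r: "T / 2 ^ n \<le> r" "r \<le> 2 * (T / 2 ^ n)" "r \<le> 1"
  shows "chain_weight \<gamma> T n \<le> chain_const \<gamma> * gauge \<gamma> r"
proof (cases "\<gamma> < 1")
  case True
  have "(T / 2 ^ n) powr \<gamma> \<le> r powr \<gamma>" using r \<gamma> T by (intro powr_mono2) auto
  then show ?thesis
    using True chain_const_pos[OF \<gamma>] by (simp add: chain_weight_def gauge_def)
next
  case False
  have "0 < T / 2 ^ n" using T by simp
  then have r0: "0 < r" using r by linarith
  have "r * 2 ^ n \<le> 2 * T" using r(2) by (simp add: field_simps)
  then have "r * 2 ^ n \<le> 2" using T by linarith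
  then have "ln (r * 2 ^ n) \<le> ln 2" using r0 by (intro ln_mono) auto
  then have "ln r + real n * ln 2 \<le> ln 2" using r0 by (simp add: ln_mult ln_realpow)
  moreover have "ln r \<le> 0" using r0 r by simp
  ultimately have "real n * ln 2 \<le> ln 2 + \<bar>ln r\<bar>" by simp
  also have "\<dots> \<le> ln 2 + (2 * ln 2) * \<bar>ln r\<bar>"
    using ln2_ge_two_thirds by (intro add_left_mono) (simp add: mult_le_cancel_right1)
  finally have "ln 2 * real n \<le> ln 2 * (1 + 2 * \<bar>ln r\<bar>)" by (simp add: algebra_simps)
  then have "real n \<le> 1 + 2 * \<bar>ln r\<bar>" using ln_gt_zero[of 2] by (subst (asm) mult_le_cancel_left_pos) auto
  then have "2 * real n + 6 \<le> 8 * (1 + \<bar>ln r\<bar>)" by simp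
  then have "(2 * real n + 6) * (T / 2 ^ n) \<le> (8 * (1 + \<bar>ln r\<bar>)) * r"
    using r T by (intro mult_mono) auto
  then show ?thesis using False by (simp add: chain_weight_def chain_const_def gauge_def mult_ac)
qed

lemma gauge_tendsto: "0 < r \<Longrightarrow> (f \<longlongrightarrow> r) F \<Longrightarrow> ((\<lambda>x. gauge \<gamma> (f x)) \<longlongrightarrow> gauge \<gamma> r) F"
  by (cases "\<gamma> < 1") (auto simp: gauge_def intro!: tendsto_intros)

lemma gauge_tendsto_0:
  assumes "0 < \<gamma>"
  shows "(gauge \<gamma> \<longlongrightarrow> 0) (at_right 0)"
proof (cases "\<gamma> < 1")
  case True
  have "((\<lambda>r. r powr \<gamma>) \<longlongrightarrow> 0 powr \<gamma>) (at_right 0)"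
    using assms by (intro tendsto_powr2 tendsto_intros) (auto simp: eventually_at_filter)
  then show ?thesis using True by (simp add: gauge_def[abs_def])
next
  case False
  have "((\<lambda>r :: real. r * (1 + \<bar>ln r\<bar>)) \<longlongrightarrow> 0) (at_right 0)" by real_asymp
  then show ?thesis using False by (simp add: gauge_def[abs_def])
qed

text \<open>The accumulated cost of the backward heat flow down to level \<open>n\<close>; a halving at level \<open>i\<close> uses
  \<open>h = T / 2\<^bsup>i+1\<^esup>\<close>.\<close>

definition growth :: "real \<Rightarrow> real \<Rightarrow> real \<Rightarrow> nat \<Rightarrow> real" where
  "growth c0 \<sigma> T n = exp (c0 * (\<Sum>i<n. (T / 2 ^ Suc i) powr (1 - \<sigma>)))"

definition growth_bound :: "real \<Rightarrow> real \<Rightarrow> real" where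
  "growth_bound c0 \<sigma> = exp (c0 * (1 / (1 - 2 powr - (1 - \<sigma>))))"

lemma growth_Suc: "growth c0 \<sigma> T (Suc n) = growth c0 \<sigma> T n * exp (c0 * (T / 2 ^ Suc n) powr (1 - \<sigma>))"
  by (simp add: growth_def distrib_left exp_add)

lemma growth_ge_1: "0 < c0 \<Longrightarrow> 1 \<le> growth c0 \<sigma> T n"
  by (simp add: growth_def sum_nonneg)

lemma growth_le_bound:
  assumes "0 < c0" "\<sigma> < 1" "0 < T" "T \<le> 1"
  shows "growth c0 \<sigma> T n \<le> growth_bound c0 \<sigma>"
proof -
  define q where "q = (2 :: real) powr - (1 - \<sigma>)"
  have q: "0 < q" "q < 1" using powr_less_one[of "1 - \<sigma>"] assms by (simp_all add: q_def)
  have half: "(1 / 2 ^ m) powr (1 - \<sigma>) = q ^ m" for m :: nat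
  proof (induction m)
    case (Suc m)
    then show ?case using half_powr[of "1 / 2 ^ m" "1 - \<sigma>"] by (simp add: q_def mult.commute)
  qed simp
  have "(\<Sum>i<n. (T / 2 ^ Suc i) powr (1 - \<sigma>)) \<le> (\<Sum>i<n. q ^ i)"
  proof (rule sum_mono)
    fix i
    have "(T / 2 ^ Suc i) powr (1 - \<sigma>) \<le> (1 / 2 ^ Suc i) powr (1 - \<sigma>)"
      using assms by (intro powr_mono2 divide_right_mono) auto
    also have "\<dots> \<le> q ^ i"
      unfolding half using q by (intro power_decreasing) auto
    finally show "(T / 2 ^ Suc i) powr (1 - \<sigma>) \<le> q ^ i" .
  qed
  also have "\<dots> \<le> (\<Sum>i. q ^ i)"
    using q by (intro sum_le_suminf summable_geometric) auto
  also have "\<dots> = 1 / (1 - q)" using q by (intro suminf_geometric) auto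
  finally show ?thesis
    using assms unfolding growth_def growth_bound_def exp_le_cancel_iff q_def by (intro mult_left_mono) auto
qed

section \<open>Dyadic points\<close>

text \<open>Approximation from below, monotone in \<open>t\<close>: the order of two times survives the approximation, so
  that simplices are approximated by their dyadic points.\<close>

definition dyadic_floor :: "real \<Rightarrow> nat \<Rightarrow> real \<Rightarrow> real" where
  "dyadic_floor T n t = dyadic_pt T n (nat \<lfloor>t * 2 ^ n / T\<rfloor>)"

lemma dyadic_pt_mem: "k \<le> 2 ^ n \<Longrightarrow> dyadic_pt T n k \<in> dyadics T"
  by (auto simp: dyadics_def)

lemma dyadics_bounds: "0 < T \<Longrightarrow> t \<in> dyadics T \<Longrightarrow> 0 \<le> t \<and> t \<le> T"
proof -
  assume T: "0 < T" and "t \<in> dyadics T"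
  then obtain n k where t: "t = dyadic_pt T n k" and k: "k \<le> 2 ^ n" by (auto simp: dyadics_def)
  have "real k \<le> 2 ^ n" using k by (metis of_nat_le_iff of_nat_numeral of_nat_power)
  then show ?thesis using T by (simp add: t dyadic_pt_def divide_le_eq mult.commute)
qed

lemma dyadic_pt_refine: "dyadic_pt T n k = dyadic_pt T (n + m) (2 ^ m * k)"
  by (simp add: dyadic_pt_def power_add)

lemma dyadic_pt_Suc: "dyadic_pt T n (Suc k) = dyadic_pt T n k + T / 2 ^ n"
  by (simp add: dyadic_pt_def field_simps)

lemma dyadic_pt_strict_mono:
  assumes "0 < T"
  shows "dyadic_pt T n j < dyadic_pt T n k \<longleftrightarrow> j < k" "dyadic_pt T n j \<le> dyadic_pt T n k \<longleftrightarrow> j \<le> k"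
    "dyadic_pt T n j = dyadic_pt T n k \<longleftrightarrow> j = k"
  using assms by (simp_all add: dyadic_pt_def divide_less_cancel divide_le_cancel)

lemma dyadic_floor:
  assumes T: "0 < T" and t: "0 \<le> t" "t \<le> T"
  shows "nat \<lfloor>t * 2 ^ n / T\<rfloor> \<le> 2 ^ n" "dyadic_floor T n t \<in> dyadics T"
    "dyadic_floor T n t \<le> t" "t < dyadic_floor T n t + T / 2 ^ n"
proof -
  let ?x = "t * 2 ^ n / T"
  have x: "0 \<le> ?x" "?x \<le> 2 ^ n" using T t by (simp_all add: divide_le_eq mult.commute)
  have "\<lfloor>?x\<rfloor> \<le> 2 ^ n" using x floor_mono[OF x(2)] by simp
  then show "nat \<lfloor>?x\<rfloor> \<le> 2 ^ n" by (simp add: nat_le_iff)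
  then show "dyadic_floor T n t \<in> dyadics T"
    unfolding dyadic_floor_def by (rule dyadic_pt_mem)
  have r: "real (nat \<lfloor>?x\<rfloor>) = of_int \<lfloor>?x\<rfloor>" using x by simp
  have "dyadic_floor T n t = of_int \<lfloor>?x\<rfloor> * (T / 2 ^ n)"
    by (simp add: dyadic_floor_def dyadic_pt_def r)
  moreover have "of_int \<lfloor>?x\<rfloor> * (T / 2 ^ n) \<le> ?x * (T / 2 ^ n)"
    using T by (intro mult_right_mono) auto
  moreover have "?x * (T / 2 ^ n) < (of_int \<lfloor>?x\<rfloor> + 1) * (T / 2 ^ n)"
    using T by (intro mult_strict_right_mono) auto
  moreover have "?x * (T / 2 ^ n) = t" using T by simp
  ultimately show "dyadic_floor T n t \<le> t" "t < dyadic_floor T n t + T / 2 ^ n"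
    by (simp_all add: algebra_simps)
qed

lemma dyadic_floor_mono:
  assumes "0 < T" "s \<le> t"
  shows "dyadic_floor T n s \<le> dyadic_floor T n t"
  unfolding dyadic_floor_def dyadic_pt_strict_mono(2)[OF assms(1)]
  using assms by (intro nat_mono floor_mono divide_right_mono mult_right_mono) auto

lemma dyadic_floor_tendsto:
  assumes T: "0 < T" and t: "0 \<le> t" "t \<le> T"
  shows "(\<lambda>n. dyadic_floor T n t) \<longlonglongrightarrow> t"
proof (rule tendsto_sandwich)
  have "(\<lambda>n. t - T * (1 / 2) ^ n) \<longlonglongrightarrow> t - T * 0"
    by (intro tendsto_diff tendsto_mult tendsto_const LIMSEQ_realpow_zero) auto
  then show "(\<lambda>n. t - T * (1 / 2) ^ n) \<longlonglongrightarrow> t" by simp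
  show "\<forall>\<^sub>F n in sequentially. t - T * (1 / 2) ^ n \<le> dyadic_floor T n t"
  proof (intro always_eventually allI)
    show "t - T * (1 / 2) ^ n \<le> dyadic_floor T n t" for n
      using dyadic_floor(4)[OF assms, of n] by (simp add: power_divide)
  qed
  show "\<forall>\<^sub>F n in sequentially. dyadic_floor T n t \<le> t"
    using dyadic_floor(3)[OF assms] by simp
qed simp

lemma dyadic_floor_eq:
  assumes T: "0 < T" and t: "t \<in> dyadics T"
  shows "\<forall>\<^sub>F n in sequentially. dyadic_floor T n t = t"
proof -
  obtain m k where tm: "t = dyadic_pt T m k" using t by (auto simp: dyadics_def)
  have "dyadic_floor T n t = t" if mn: "m \<le> n" for n
  proof -
    obtain l where n: "n = m + l" using le_Suc_ex[OF mn] by blast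
    have t: "t = dyadic_pt T n (2 ^ l * k)" unfolding tm n by (rule dyadic_pt_refine)
    then have "t * 2 ^ n / T = real (2 ^ l * k)" using T by (simp add: dyadic_pt_def)
    then show ?thesis unfolding dyadic_floor_def by (simp only: floor_of_nat nat_int t[symmetric])
  qed
  then show ?thesis by (rule eventually_sequentiallyI)
qed

lemma dyadics_common_level:
  assumes "s \<in> dyadics T" "t \<in> dyadics T"
  obtains N i j where "s = dyadic_pt T N i" "i \<le> 2 ^ N" "t = dyadic_pt T N j" "j \<le> 2 ^ N"
proof -
  obtain n i where s: "s = dyadic_pt T n i" "i \<le> 2 ^ n" using assms by (auto simp: dyadics_def)
  obtain m j where t: "t = dyadic_pt T m j" "j \<le> 2 ^ m" using assms by (auto simp: dyadics_def)
  show thesis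
  proof (rule that)
    show "s = dyadic_pt T (n + m) (2 ^ m * i)" using s by (simp add: dyadic_pt_refine[symmetric])
    show "t = dyadic_pt T (n + m) (2 ^ n * j)" using t by (simp add: dyadic_pt_refine[symmetric] add.commute[of n])
    show "2 ^ m * i \<le> 2 ^ (n + m)" using s by (simp add: power_add mult.commute)
    show "2 ^ n * j \<le> 2 ^ (n + m)" using t by (simp add: power_add)
  qed
qed

section \<open>Residuals of paths\<close>

definition path_residual :: "'d::finite incr3 \<Rightarrow> (real \<Rightarrow> 'd tdist) \<Rightarrow> 'd incr2" where
  "path_residual H J = (\<lambda>(t, s). B_germ H (t, s) - J t + heat (t - s) (J s))"

lemma heat_residual_path: "heat_residual c0 \<sigma> T H = path_residual H (heat_path c0 \<sigma> T H)"
  by (simp add: heat_residual_def path_residual_def)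

text \<open>The path drops out of the twisted coboundary of its residual, and the cocycle identity for
  \<open>(t, u, s, 0)\<close> says that the germ \<open>- H\<^bsub>ts0\<^esub>\<close> has coboundary \<open>H\<close>.\<close>

lemma path_residual_chen:
  assumes "hat_delta3 H (t, u, s, 0) = 0"
  shows "path_residual H J (t, s) =
     path_residual H J (t, u) + heat (t - u) (path_residual H J (u, s)) + H (t, u, s)"
proof -
  have "H (t, s, 0) - H (t, u, 0) + H (t, u, s) - heat (t - u) (H (u, s, 0)) = 0"
    using assms by (simp add: hat_delta3_eq)
  then have H: "H (t, u, s) = heat (t - u) (H (u, s, 0)) + H (t, u, 0) - H (t, s, 0)"
    by (simp add: algebra_simps)
  show ?thesis
    by (simp add: path_residual_def B_germ_def H heat_plus heat_diff heat_uminus heat_add)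
qed

section \<open>Size of the dyadic residuals\<close>

locale heat_defect =
  fixes \<gamma> \<alpha> \<beta> \<sigma> c0 T K :: real and H :: "'d::finite incr3"
  assumes \<gamma>: "0 < \<gamma>" "\<gamma> \<le> 1" and \<beta>: "0 < \<beta>" and \<sigma>: "0 < \<sigma>" "\<sigma> < 1" and c0: "0 < c0"
    and T: "0 < T" "T \<le> 1"
    and H: "H \<in> ZC3 T \<gamma> \<alpha>" and tail: "parabolic_tail c0 T \<gamma> \<alpha> \<beta> \<sigma> K H"
begin

abbreviation "pt \<equiv> dyadic_pt T"
abbreviation "I \<equiv> heat_path c0 \<sigma> T H"
abbreviation "R \<equiv> heat_residual c0 \<sigma> T H"

definition M :: real where "M = enn2real (norm3 T \<gamma> \<alpha> H)"

definition A :: real where "A = growth_bound c0 \<sigma> * (M + K)"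

lemma H_C3: "H \<in> C3 T \<gamma> \<alpha>"
  using H by (simp add: ZC3_def)

lemma norm3_finite: "norm3 T \<gamma> \<alpha> H < \<infinity>"
  using H_C3 by (simp add: C3_def)

lemma H_C_maps: "H \<in> C_maps \<alpha> (simplex3 T)"
  using H_C3 by (simp add: C3_def)

lemma H_cocycle: "x \<in> simplex4 T \<Longrightarrow> hat_delta3 H x = 0"
  using H by (simp add: ZC3_def)

lemma H_mem: "0 \<le> s \<Longrightarrow> s \<le> u \<Longrightarrow> u \<le> t \<Longrightarrow> t \<le> T \<Longrightarrow> H (t, u, s) \<in> H_space \<alpha>"
  using C_maps_H_space[OF H_C_maps] by (simp add: simplex3_def)

lemma H_bound: "0 \<le> s \<Longrightarrow> s \<le> u \<Longrightarrow> u \<le> t \<Longrightarrow> t \<le> T \<Longrightarrow>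
    H_norm \<alpha> (H (t, u, s)) \<le> M * (t - s) powr \<gamma>"
  using norm3_bound[OF norm3_finite T(1)] by (simp add: simplex3_def M_def)

lemma tail_bound:
  assumes "j < 2 ^ n"
  shows "H_norm \<alpha> (proj_high c0 (cutoff \<sigma> (T / 2 ^ Suc n))
      (heat_Y c0 \<sigma> T H (pt n (Suc j), pt (Suc n) (Suc (2 * j)), pt n j)))
    \<le> K * (T / 2 ^ n) powr (\<gamma> + \<sigma> * \<beta> / 2)"
proof -
  have L: "pt n (Suc j) - pt n j = T / 2 ^ n"
    and b: "(pt n j + pt n (Suc j)) / 2 = pt (Suc n) (Suc (2 * j))"
    and h: "pt n (Suc j) - pt (Suc n) (Suc (2 * j)) = T / 2 ^ Suc n"
    by (simp_all add: dyadic_pt_def field_simps)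
  from tail assms have "H_norm \<alpha> (proj_high c0 (cutoff \<sigma> (pt n (Suc j) - (pt n j + pt n (Suc j)) / 2))
      (heat_Y c0 \<sigma> T H (pt n (Suc j), (pt n j + pt n (Suc j)) / 2, pt n j)))
    \<le> K * (pt n (Suc j) - pt n j) powr (\<gamma> + \<sigma> * \<beta> / 2)"
    unfolding parabolic_tail_def Let_def Suc_eq_plus1[symmetric] by blast
  then show ?thesis unfolding b h L .
qed

text \<open>The tail condition for the interval \<open>[0, T]\<close> already forces the sign.\<close>

lemma K_nonneg: "0 \<le> K"
proof -
  have "0 \<le> K * (T / 2 ^ 0) powr (\<gamma> + \<sigma> * \<beta> / 2)"
    by (rule order_trans[OF H_norm_nonneg tail_bound[of 0 0]]) simp
  then show ?thesis using T by (simp add: zero_le_mult_iff)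
qed

lemma M_nonneg: "0 \<le> M"
  by (simp add: M_def)

lemma A_ge: "M + K \<le> A" "M \<le> A" "0 \<le> A"
proof -
  have "0 < 1 - (2 :: real) powr - (1 - \<sigma>)" using powr_less_one[of "1 - \<sigma>"] \<sigma> by simp
  then have "1 \<le> growth_bound c0 \<sigma>" using c0 unfolding growth_bound_def by simp
  then have "1 * (M + K) \<le> A"
    unfolding A_def using M_nonneg K_nonneg by (intro mult_right_mono) auto
  then show "M + K \<le> A" "M \<le> A" "0 \<le> A" using M_nonneg K_nonneg by auto
qed

lemma germ_mem: "0 \<le> s \<Longrightarrow> s \<le> t \<Longrightarrow> t \<le> T \<Longrightarrow> B_germ H (t, s) \<in> H_space \<alpha>"
  using H_uminus(1)[OF H_mem[of 0 s t]] by (simp add: B_germ_def)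

text \<open>Together with \<open>I\<^sub>0 = 0\<close>, the vanishing of \<open>H\<close> on degenerate simplices gives \<open>R\<^bsub>tt\<^esub> = 0\<close> and
  \<open>I\<^sub>t = - R\<^bsub>t0\<^esub>\<close>.\<close>

lemma germ_diagonal: "0 \<le> t \<Longrightarrow> t \<le> T \<Longrightarrow> B_germ H (t, t) = 0"
  using H_degenerate_zero[OF H_C3 T(1), of t t 0] by (simp add: B_germ_def simplex3_def)

lemma germ_initial: "0 \<le> t \<Longrightarrow> t \<le> T \<Longrightarrow> B_germ H (t, 0) = 0"
  using H_degenerate_zero[OF H_C3 T(1), of t 0 0] by (simp add: B_germ_def simplex3_def)

lemma heat_level_mem: "k \<le> 2 ^ n \<Longrightarrow> heat_level c0 \<sigma> T H n k \<in> H_space \<alpha>"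
proof (induction n arbitrary: k)
  case 0
  then show ?case using germ_mem[of 0 T] T by simp
next
  case (Suc n)
  show ?case
  proof (cases "even k")
    case True
    then show ?thesis using Suc by auto
  next
    case False
    then obtain j where k: "k = Suc (2 * j)" by (metis oddE Suc_eq_plus1)
    have j: "j < 2 ^ n" using Suc.prems k by simp
    define a c where ac: "a = pt n j" "c = pt n (Suc j)"
    define b where "b = (a + c) / 2"
    have "a \<le> c" using T by (simp add: ac dyadic_pt_Suc)
    then have bnds: "0 \<le> a" "a \<le> b" "b \<le> c" "c \<le> T"
      using dyadics_bounds[OF T(1) dyadic_pt_mem, of j n] dyadics_bounds[OF T(1) dyadic_pt_mem, of "Suc j" n] j
      unfolding b_def by (auto simp flip: ac)
    have I: "heat_level c0 \<sigma> T H n j \<in> H_space \<alpha>" "heat_level c0 \<sigma> T H n (Suc j) \<in> H_space \<alpha>"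
      using Suc.IH j by auto
    have "heat_level c0 \<sigma> T H (Suc n) k = B_germ H (b, a) + heat (b - a) (heat_level c0 \<sigma> T H n j) - (1 / 2) \<cdot>\<^sub>C
        heat_inv_low c0 (cutoff \<sigma> (c - b)) (c - b) (B_germ H (c, a) - heat_level c0 \<sigma> T H n (Suc j)
          + heat (c - a) (heat_level c0 \<sigma> T H n j) - H (c, b, a))"
      by (simp add: k Let_def ac b_def)
    also have "\<dots> \<in> H_space \<alpha>"
      using bnds I by (intro H_diff H_add H_smul H_heat H_heat_inv_low germ_mem H_mem) auto
    finally show ?thesis .
  qed
qed

lemma I_mem: "t \<in> dyadics T \<Longrightarrow> I t \<in> H_space \<alpha>"
  using heat_level_mem by (auto simp: dyadics_def heat_path_dyadic_pt[OF T(1)])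

lemma I_0: "I 0 = 0"
  by (rule heat_path_0[OF T(1)])

lemma R_mem: "s \<in> dyadics T \<Longrightarrow> t \<in> dyadics T \<Longrightarrow> s \<le> t \<Longrightarrow> R (t, s) \<in> H_space \<alpha>"
  using dyadics_bounds[OF T(1)]
  by (auto simp: heat_residual_def intro!: H_add H_diff germ_mem I_mem H_heat)

lemma R_diagonal: "t \<in> dyadics T \<Longrightarrow> R (t, t) = 0"
  using germ_diagonal[of t] dyadics_bounds[OF T(1), of t] by (simp add: heat_residual_def)

lemma R_diagonal_norm: "t \<in> dyadics T \<Longrightarrow> H_norm \<alpha> (R (t, t)) = 0"
  by (simp only: R_diagonal H_zero(2))

lemma R_split:
  assumes "0 \<le> s" "s \<le> u" "u \<le> t" "t \<le> T"
  shows "R (t, s) = R (t, u) + heat (t - u) (R (u, s)) + H (t, u, s)"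
  unfolding heat_residual_path
  by (rule path_residual_chen, rule H_cocycle) (use assms in \<open>simp add: simplex4_def\<close>)

lemma R_triangle:
  assumes "s \<in> dyadics T" "u \<in> dyadics T" "t \<in> dyadics T" "s \<le> u" "u \<le> t"
  shows "H_norm \<alpha> (R (t, s)) \<le> H_norm \<alpha> (R (t, u)) + H_norm \<alpha> (R (u, s)) + M * (t - s) powr \<gamma>"
proof -
  note bnd = dyadics_bounds[OF T(1) assms(1)] dyadics_bounds[OF T(1) assms(3)]
  have mem: "R (t, u) \<in> H_space \<alpha>" "R (u, s) \<in> H_space \<alpha>" "H (t, u, s) \<in> H_space \<alpha>"
    using assms bnd by (auto intro: R_mem H_mem)
  have "H_norm \<alpha> (R (t, s)) \<le> H_norm \<alpha> (R (t, u)) + H_norm \<alpha> (heat (t - u) (R (u, s))) + H_norm \<alpha> (H (t, u, s))"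
    using R_split[of s u t] assms bnd mem H_add H_heat(1)[of "R (u, s)" \<alpha> "t - u"]
    by (smt (verit))
  also have "\<dots> \<le> H_norm \<alpha> (R (t, u)) + H_norm \<alpha> (R (u, s)) + M * (t - s) powr \<gamma>"
    using assms bnd mem by (intro add_mono H_heat H_bound) auto
  finally show ?thesis .
qed

text \<open>The splitting halves the residual of the parent up to the factor \<open>exp (c\<^sub>0 h\<^bsup>1 - \<sigma>\<^esup>)\<close> for the
  backward heat flow below the cutoff, plus the high frequency part that only the right child carries.
  The product of these factors over all levels converges because \<open>\<sigma> < 1\<close>.\<close>

lemma R_adjacent:
  assumes "j < 2 ^ n"
  shows "H_norm \<alpha> (R (pt n (Suc j), pt n j)) \<le> growth c0 \<sigma> T n * (M + K) * child_weight \<gamma> T n"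
  using assms
proof (induction n arbitrary: j)
  case 0
  have "R (T, 0) = 0"
    by (simp add: heat_residual_def I_0 heat_path_T[OF T(1)])
  then have "R (pt 0 (Suc j), pt 0 j) = 0" using 0 by (simp add: dyadic_pt_def)
  moreover have "0 \<le> growth c0 \<sigma> T 0 * (M + K) * child_weight \<gamma> T 0"
    using M_nonneg K_nonneg weights_le_chain_weight(1)[OF \<gamma> T(1)] by (simp add: growth_def)
  ultimately show ?case by (metis H_zero(2))
next
  case (Suc n)
  define i where "i = j div 2"
  have i: "i < 2 ^ n" using Suc.prems by (simp add: i_def)
  define a c b h where abc: "a = pt n i" "c = pt n (i + 1)" "b = (a + c) / 2" and h: "h = c - b"
  define L where "L = T / 2 ^ n"
  have L: "0 < L" "L \<le> 1" using T by (auto simp: L_def divide_le_eq intro: order_trans[of _ 1])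
  have ca: "c = a + L" "h = L / 2" "b = a + L / 2"
    by (simp_all add: abc h L_def dyadic_pt_Suc field_simps)
  have b: "b = pt (Suc n) (Suc (2 * i))" by (simp add: abc dyadic_pt_def field_simps)
  have a': "a = pt (Suc n) (2 * i)" and c': "c = pt (Suc n) (Suc (Suc (2 * i)))"
    by (simp_all add: abc dyadic_pt_def field_simps)
  have dy: "a \<in> dyadics T" "c \<in> dyadics T" using i by (auto simp: abc intro!: dyadic_pt_mem)
  note bnd = dyadics_bounds[OF T(1) dy(1)] dyadics_bounds[OF T(1) dy(2)]
  define Y where "Y = heat_Y c0 \<sigma> T H (c, b, a)"
  define G where "G = growth c0 \<sigma> T n"
  define E where "E = exp (c0 * h powr (1 - \<sigma>))"
  define w where "w = child_weight \<gamma> T n"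
  have G: "1 \<le> G" using growth_ge_1[OF c0] by (simp add: G_def)
  have E: "1 \<le> E" using c0 by (simp add: E_def)
  have w: "0 \<le> w" using weights_le_chain_weight(1)[OF \<gamma> T(1)] by (simp add: w_def)
  have MK: "0 \<le> M + K" using M_nonneg K_nonneg by simp
  have Hm: "H (c, b, a) \<in> H_space \<alpha>" using bnd L by (intro H_mem) (auto simp: ca)
  have Rm: "R (c, a) \<in> H_space \<alpha>" using dy L by (intro R_mem) (auto simp: ca)
  have Y: "Y \<in> H_space \<alpha>" unfolding Y_def heat_Y_def prod.case by (intro H_diff Hm Rm)
  have IH: "H_norm \<alpha> (R (c, a)) \<le> G * (M + K) * w"
    using Suc.IH[OF i] by (simp add: abc G_def w_def)
  have "H_norm \<alpha> Y \<le> H_norm \<alpha> (R (c, a)) + H_norm \<alpha> (H (c, b, a))"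
    unfolding Y_def heat_Y_def prod.case by (intro H_diff Hm Rm)
  also have "\<dots> \<le> G * (M + K) * w + M * L powr \<gamma>"
    using IH H_bound[of a b c] bnd L by (intro add_mono) (auto simp: ca)
  finally have Y_le: "H_norm \<alpha> Y \<le> G * (M + K) * w + M * L powr \<gamma>" .
  have low: "h * (cutoff \<sigma> h)\<^sup>2 = h powr (1 - \<sigma>)"
    using L by (simp add: cutoff_def ca powr_diff powr_minus power2_eq_square field_simps flip: powr_add)
  \<comment> \<open>Both children obey the same bound, the right one because \<open>E \<ge> 1\<close>.\<close>
  have child: "H_norm \<alpha> (R (pt (Suc n) (Suc j), pt (Suc n) j)) \<le> E * (H_norm \<alpha> Y / 2) + K * L powr \<gamma>"
  proof (cases "even j")
    case True
    then have j: "j = 2 * i" by (simp add: i_def)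
    have "R (b, a) = (1 / 2) \<cdot>\<^sub>C heat_inv_low c0 (cutoff \<sigma> h) h Y"
      unfolding Y_def by (rule heat_residual_left[OF T(1) i abc h])
    then have "H_norm \<alpha> (R (b, a)) \<le> 1 / 2 * H_norm \<alpha> (heat_inv_low c0 (cutoff \<sigma> h) h Y)"
      using H_smul(2)[OF H_heat_inv_low(1)[OF Y], of h "1 / 2"] L by (simp add: ca)
    also have "\<dots> \<le> 1 / 2 * (E * H_norm \<alpha> Y)"
      using H_heat_inv_low(2)[OF Y, of h c0 "cutoff \<sigma> h"] L unfolding low by (simp add: ca(2) E_def)
    also have "\<dots> \<le> E * (H_norm \<alpha> Y / 2) + K * L powr \<gamma>"
      using K_nonneg by simp
    finally show ?thesis unfolding j a'[symmetric] b[symmetric] .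
  next
    case False
    then have j: "j = Suc (2 * i)" by (simp add: i_def)
    have R: "R (c, b) = (1 / 2) \<cdot>\<^sub>C proj_low c0 (cutoff \<sigma> h) Y + proj_high c0 (cutoff \<sigma> h) Y"
      unfolding Y_def by (rule heat_residual_right[OF T(1) i abc h H_cocycle])
    have mem: "proj_low c0 (cutoff \<sigma> h) Y \<in> H_space \<alpha>" "proj_high c0 (cutoff \<sigma> h) Y \<in> H_space \<alpha>"
      unfolding proj_high_def by (intro H_diff H_proj_low Y)+
    have "H_norm \<alpha> (R (c, b)) \<le> H_norm \<alpha> ((1 / 2) \<cdot>\<^sub>C proj_low c0 (cutoff \<sigma> h) Y) +
        H_norm \<alpha> (proj_high c0 (cutoff \<sigma> h) Y)"
      unfolding R by (intro H_add H_smul mem)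
    moreover have "H_norm \<alpha> ((1 / 2) \<cdot>\<^sub>C proj_low c0 (cutoff \<sigma> h) Y) \<le> 1 / 2 * H_norm \<alpha> Y"
      using H_smul(2)[OF mem(1), of "1 / 2"] H_proj_low(2)[OF Y, of c0 "cutoff \<sigma> h"] by simp
    moreover have "1 / 2 * H_norm \<alpha> Y \<le> E * (H_norm \<alpha> Y / 2)"
      using mult_right_mono[OF E, of "H_norm \<alpha> Y / 2"] by simp
    moreover have "H_norm \<alpha> (proj_high c0 (cutoff \<sigma> h) Y) \<le> K * L powr (\<gamma> + \<sigma> * \<beta> / 2)"
      using tail_bound[OF i] unfolding Y_def b abc(1,2) ca(2) L_def by (simp add: mult.commute)
    moreover have "K * L powr (\<gamma> + \<sigma> * \<beta> / 2) \<le> K * L powr \<gamma>"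
      using L \<beta> \<sigma> K_nonneg by (intro mult_left_mono powr_mono') auto
    ultimately show ?thesis unfolding j b[symmetric] c'[symmetric] by linarith
  qed
  also have "\<dots> \<le> E * ((G * (M + K) * w + M * L powr \<gamma>) / 2) + K * L powr \<gamma>"
    using E Y_le by (intro add_right_mono mult_left_mono divide_right_mono) auto
  also have "\<dots> \<le> G * E * (M + K) * (w / 2 + L powr \<gamma>)"
  proof -
    have GE: "E \<le> G * E" "1 \<le> G * E" using G E mult_mono[of 1 G 1 E] by auto
    then have le: "E * (M * L powr \<gamma>) \<le> (G * E) * (M * L powr \<gamma>)" "1 * (K * L powr \<gamma>) \<le> G * E * (K * L powr \<gamma>)"
      "0 \<le> (G * E) * (M * L powr \<gamma>)"
      using M_nonneg K_nonneg E by (intro mult_right_mono mult_nonneg_nonneg; simp)+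
    have eq1: "E * ((G * (M + K) * w + M * L powr \<gamma>) / 2) =
        G * E * (M + K) * (w / 2) + E * (M * L powr \<gamma>) / 2"
      by (simp add: algebra_simps add_divide_distrib)
    have eq2: "G * E * (M + K) * (w / 2 + L powr \<gamma>) =
        G * E * (M + K) * (w / 2) + G * E * (M * L powr \<gamma>) + G * E * (K * L powr \<gamma>)"
      by (simp add: algebra_simps)
    have "u + z \<le> v" if "x \<le> y" "1 * z \<le> z'" "0 \<le> y" "u = p + x / 2" "v = p + y + z'"
      for u v x y z z' p :: real using that by simp
    from this[OF le eq1 eq2] show ?thesis .
  qed
  also have "\<dots> \<le> G * E * (M + K) * child_weight \<gamma> T (Suc n)"
    using child_weight_step[OF \<gamma> T(1), of n] G E MK by (intro mult_left_mono) (auto simp: w_def L_def)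
  also have "G * E = growth c0 \<sigma> T (Suc n)"
    by (simp add: G_def E_def growth_Suc ca L_def mult.commute)
  finally show ?case .
qed

lemma R_adjacent_le:
  assumes "j < 2 ^ n"
  shows "H_norm \<alpha> (R (pt n (Suc j), pt n j)) \<le> A * child_weight \<gamma> T n"
proof -
  have "growth c0 \<sigma> T n * (M + K) * child_weight \<gamma> T n \<le> A * child_weight \<gamma> T n"
    unfolding A_def using M_nonneg K_nonneg
    by (intro mult_right_mono growth_le_bound c0 \<sigma> T weights_le_chain_weight(1) \<gamma>) auto
  then show ?thesis using R_adjacent[OF assms] by simp
qed

text \<open>From a point of level \<open>n\<close> a nearby dyadic point is reached by a chain of adjacent intervals of
  strictly increasing levels; the chain weight dominates the sum of their contributions.\<close>

lemma chain_step:
  assumes "x \<le> y + z + M * r powr \<gamma>" "y \<le> A * child_weight \<gamma> T (Suc n)" "z \<le> A * chain_weight \<gamma> T (Suc n)"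
    "0 \<le> r" "r \<le> T / 2 ^ n"
  shows "x \<le> A * chain_weight \<gamma> T n"
proof -
  have "M * r powr \<gamma> \<le> A * (T / 2 ^ n) powr \<gamma>"
    using assms A_ge M_nonneg \<gamma> by (intro mult_mono powr_mono2) auto
  then have "x \<le> A * (chain_weight \<gamma> T (Suc n) + child_weight \<gamma> T (Suc n) + (T / 2 ^ n) powr \<gamma>)"
    using assms by (simp add: algebra_simps)
  also have "\<dots> \<le> A * chain_weight \<gamma> T n"
    using A_ge chain_weight_step[OF \<gamma> T(1)] by (intro mult_left_mono) auto
  finally show ?thesis .
qed

lemma chain_weight_mono: "A * chain_weight \<gamma> T (Suc n) \<le> A * chain_weight \<gamma> T n"
  using chain_step[of "A * chain_weight \<gamma> T (Suc n)" 0 "A * chain_weight \<gamma> T (Suc n)" 0 n]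
    A_ge weights_le_chain_weight(1)[OF \<gamma> T(1)] T by simp

lemma R_chain_left:
  assumes "k \<le> 2 ^ n" "i \<le> 2 ^ (n + m)" "pt (n + m) i \<le> pt n k" "pt n k - pt (n + m) i \<le> T / 2 ^ n"
  shows "H_norm \<alpha> (R (pt n k, pt (n + m) i)) \<le> A * chain_weight \<gamma> T n"
  using assms
proof (induction m arbitrary: n k)
  case 0
  then have "pt n k \<le> pt n (Suc i)" by (simp add: dyadic_pt_Suc)
  then have "k \<le> Suc i" "i \<le> k"
    using 0 by (simp_all add: dyadic_pt_strict_mono[OF T(1)])
  then consider "i = k" | "k = Suc i" by linarith
  then show ?case
  proof cases
    case 1
    then show ?thesis
      using 0 A_ge chain_weight_nonneg[OF \<gamma> T(1)] by (simp add: R_diagonal_norm dyadic_pt_mem)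
  next
    case 2
    then have "H_norm \<alpha> (R (pt n k, pt n i)) \<le> A * child_weight \<gamma> T n" using 0 R_adjacent_le by simp
    also have "\<dots> \<le> A * chain_weight \<gamma> T n"
      using A_ge weights_le_chain_weight(2)[OF \<gamma> T(1)] by (intro mult_left_mono)
    finally show ?thesis by simp
  qed
next
  case (Suc m)
  define p s where ps: "p = pt n k" "s = pt (n + Suc m) i"
  have s: "s = pt (Suc n + m) i" and i: "i \<le> 2 ^ (Suc n + m)" using Suc.prems ps by simp_all
  have p: "p = pt (Suc n) (2 * k)" by (simp add: ps dyadic_pt_def)
  have le: "s \<le> p" "p - s \<le> T / 2 ^ n" using Suc.prems ps by simp_all
  show ?case
  proof (cases "p - s \<le> T / 2 ^ Suc n")
    case True
    have "H_norm \<alpha> (R (p, s)) \<le> A * chain_weight \<gamma> T (Suc n)"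
      using Suc.IH[of "2 * k" "Suc n", OF _ i, folded p s] Suc.prems(1) le True by simp
    then show ?thesis unfolding ps[symmetric] using chain_weight_mono[of n] by linarith
  next
    case False
    have step: "0 < T / 2 ^ Suc n" using T by simp
    have "0 \<le> s" using dyadics_bounds[OF T(1) dyadic_pt_mem[OF i]] by (simp only: s)
    then have "0 < p" using False step by linarith
    then have "k \<noteq> 0" by (cases "k = 0") (auto simp: p dyadic_pt_def)
    then obtain l where l: "k = Suc l" using not0_implies_Suc by blast
    define u where "u = pt (Suc n) (Suc (2 * l))"
    have p': "p = pt (Suc n) (Suc (Suc (2 * l)))" using p l by simp
    then have pu: "p = u + T / 2 ^ Suc n" by (simp add: u_def dyadic_pt_Suc)
    have l2: "Suc (2 * l) < 2 ^ Suc n" using l Suc.prems by simp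
    have dy: "u \<in> dyadics T" "p \<in> dyadics T" "s \<in> dyadics T"
      using l2 i Suc.prems(1) unfolding u_def s ps(1) by (auto intro!: dyadic_pt_mem)
    have half: "T / 2 ^ n = T / 2 ^ Suc n + T / 2 ^ Suc n" by simp
    have us: "s \<le> u" "u - s \<le> T / 2 ^ Suc n" "u \<le> p"
      using False le T unfolding half pu by auto
    show ?thesis
      unfolding ps[symmetric]
    proof (rule chain_step)
      show "H_norm \<alpha> (R (p, s)) \<le> H_norm \<alpha> (R (p, u)) + H_norm \<alpha> (R (u, s)) + M * (p - s) powr \<gamma>"
        using dy us by (intro R_triangle)
      show "H_norm \<alpha> (R (p, u)) \<le> A * child_weight \<gamma> T (Suc n)"
        unfolding p' u_def by (rule R_adjacent_le[OF l2])
      show "H_norm \<alpha> (R (u, s)) \<le> A * chain_weight \<gamma> T (Suc n)"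
        using Suc.IH[of "Suc (2 * l)" "Suc n", OF less_imp_le[OF l2] i, folded u_def s] us by simp
    qed (use le in auto)
  qed
qed

text \<open>The same for points to the right. The two cases are not mirror images of each other, as the
  semigroup in Chen's relation always acts on the earlier increment.\<close>

lemma R_chain_right:
  assumes "k \<le> 2 ^ n" "i \<le> 2 ^ (n + m)" "pt n k \<le> pt (n + m) i" "pt (n + m) i - pt n k \<le> T / 2 ^ n"
  shows "H_norm \<alpha> (R (pt (n + m) i, pt n k)) \<le> A * chain_weight \<gamma> T n"
  using assms
proof (induction m arbitrary: n k)
  case 0
  then have "pt n i \<le> pt n (Suc k)" by (simp add: dyadic_pt_Suc)
  then have "i \<le> Suc k" "k \<le> i"
    using 0 by (simp_all add: dyadic_pt_strict_mono[OF T(1)])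
  then consider "i = k" | "i = Suc k" by linarith
  then show ?case
  proof cases
    case 1
    then show ?thesis
      using 0 A_ge chain_weight_nonneg[OF \<gamma> T(1)] by (simp add: R_diagonal_norm dyadic_pt_mem)
  next
    case 2
    then have "H_norm \<alpha> (R (pt n i, pt n k)) \<le> A * child_weight \<gamma> T n" using 0 R_adjacent_le by simp
    also have "\<dots> \<le> A * chain_weight \<gamma> T n"
      using A_ge weights_le_chain_weight(2)[OF \<gamma> T(1)] by (intro mult_left_mono)
    finally show ?thesis by simp
  qed
next
  case (Suc m)
  define p t where pt: "p = pt n k" "t = pt (n + Suc m) i"
  have t: "t = pt (Suc n + m) i" and i: "i \<le> 2 ^ (Suc n + m)" using Suc.prems pt by simp_all
  have p: "p = pt (Suc n) (2 * k)" by (simp add: pt dyadic_pt_def)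
  have le: "p \<le> t" "t - p \<le> T / 2 ^ n" using Suc.prems pt by simp_all
  show ?case
  proof (cases "t - p \<le> T / 2 ^ Suc n")
    case True
    have "H_norm \<alpha> (R (t, p)) \<le> A * chain_weight \<gamma> T (Suc n)"
      using Suc.IH[of "2 * k" "Suc n", OF _ i, folded p t] Suc.prems(1) le True by simp
    then show ?thesis unfolding pt[symmetric] using chain_weight_mono[of n] by linarith
  next
    case False
    define u where "u = pt (Suc n) (Suc (2 * k))"
    have up: "u = p + T / 2 ^ Suc n" by (simp add: u_def p dyadic_pt_Suc)
    have step: "0 < T / 2 ^ Suc n" using T by simp
    have "t \<le> T" using dyadics_bounds[OF T(1) dyadic_pt_mem[OF i]] by (simp only: t)
    then have "p < T" using False step by linarith
    then have "k \<noteq> 2 ^ n" by (cases "k = 2 ^ n") (auto simp: pt(1) dyadic_pt_def)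
    then have k2: "2 * k < 2 ^ Suc n" "Suc (2 * k) \<le> 2 ^ Suc n" using Suc.prems by auto
    have dy: "u \<in> dyadics T" "p \<in> dyadics T" "t \<in> dyadics T"
      using k2 i Suc.prems(1) unfolding u_def t pt(1) by (auto intro!: dyadic_pt_mem)
    have half: "T / 2 ^ n = T / 2 ^ Suc n + T / 2 ^ Suc n" by simp
    have us: "p \<le> u" "t - u \<le> T / 2 ^ Suc n" "u \<le> t"
      using False le T unfolding half up by auto
    show ?thesis
      unfolding pt[symmetric]
    proof (rule chain_step)
      show "H_norm \<alpha> (R (t, p)) \<le> H_norm \<alpha> (R (u, p)) + H_norm \<alpha> (R (t, u)) + M * (t - p) powr \<gamma>"
        using R_triangle[OF dy(2,1,3)] us by simp
      show "H_norm \<alpha> (R (u, p)) \<le> A * child_weight \<gamma> T (Suc n)"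
        unfolding p u_def by (rule R_adjacent_le[OF k2(1)])
      show "H_norm \<alpha> (R (t, u)) \<le> A * chain_weight \<gamma> T (Suc n)"
        using Suc.IH[of "Suc (2 * k)" "Suc n", OF k2(2) i, folded u_def t] us by simp
    qed (use le in auto)
  qed
qed

text \<open>Two dyadic points at distance comparable to \<open>T / 2\<^sup>n\<close> have one or two consecutive points of level
  \<open>n\<close> between them, from which chains lead to both.\<close>

lemma R_dyadic_bound:
  assumes "s \<in> dyadics T" "t \<in> dyadics T" "s < t"
  shows "H_norm \<alpha> (R (t, s)) \<le> 7 * A * chain_const \<gamma> * gauge \<gamma> (t - s)"
proof -
  define r where "r = t - s"
  note bnd = dyadics_bounds[OF T(1) assms(1)] dyadics_bounds[OF T(1) assms(2)]
  have r: "0 < r" "r \<le> T" using assms bnd by (auto simp: r_def)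
  \<comment> \<open>The first level with \<open>L\<^sub>n \<le> r\<close>; then also \<open>r \<le> 2 L\<^sub>n\<close>.\<close>
  obtain n0 where "(1 / 2) ^ n0 < r / T" using real_arch_pow_inv[of "r / T" "1 / 2"] r T by auto
  then have ex: "T / 2 ^ n0 \<le> r" using T by (simp add: power_divide field_simps)
  define n where "n = (LEAST n. T / 2 ^ n \<le> r)"
  have n1: "T / 2 ^ n \<le> r" unfolding n_def by (rule LeastI[of _ n0], rule ex)
  have n2: "r \<le> 2 * (T / 2 ^ n)"
  proof (cases n)
    case 0
    then show ?thesis using r by simp
  next
    case (Suc n')
    then have "\<not> T / 2 ^ n' \<le> r" using not_less_Least[of n' "\<lambda>n. T / 2 ^ n \<le> r"] by (simp add: n_def)
    then show ?thesis by (simp add: Suc)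
  qed
  define L where "L = T / 2 ^ n"
  define W where "W = A * chain_weight \<gamma> T n"
  have L: "0 < L" "L \<le> r" "r \<le> 2 * L" using T n1 n2 by (simp_all add: L_def)
  have W: "0 \<le> W" using A_ge chain_weight_nonneg[OF \<gamma> T(1)] by (simp add: W_def)
  obtain N i j where s0: "s = pt N i" "i \<le> 2 ^ N" and t0: "t = pt N j" "j \<le> 2 ^ N"
    using dyadics_common_level[OF assms(1,2)] .
  have s: "s = pt (n + N) (2 ^ n * i)" "2 ^ n * i \<le> 2 ^ (n + N)"
    using s0 by (simp_all add: power_add dyadic_pt_refine[of T N i n] add.commute[of n])
  have t: "t = pt (n + N) (2 ^ n * j)" "2 ^ n * j \<le> 2 ^ (n + N)"
    using t0 by (simp_all add: power_add dyadic_pt_refine[of T N j n] add.commute[of n])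
  define k where "k = nat \<lfloor>t * 2 ^ n / T\<rfloor>"
  define p where "p = pt n k"
  have k: "k \<le> 2 ^ n" and p: "p \<le> t" "t < p + L" "p \<in> dyadics T"
    using dyadic_floor[OF T(1), of t n] bnd by (auto simp: k_def p_def dyadic_floor_def L_def)
  have sp: "s \<le> p" using p L by (simp add: r_def)
  \<comment> \<open>Each application of \<open>H\<close> below is at a scale of at most \<open>2 L\<^sub>n\<close>.\<close>
  have jump: "M * x powr \<gamma> \<le> 2 * W" if "0 \<le> x" "x \<le> 2 * L" for x
  proof -
    have "x powr \<gamma> \<le> (2 * L) powr \<gamma>" using that \<gamma> by (intro powr_mono2) auto
    also have "\<dots> = 2 powr \<gamma> * L powr \<gamma>" using L by (simp add: powr_mult)
    also have "\<dots> \<le> 2 * chain_weight \<gamma> T n"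
      using weights_le_chain_weight(3)[OF \<gamma> T(1), of n] \<gamma> powr_mono[of \<gamma> 1 2]
      by (intro mult_mono) (auto simp: L_def)
    finally have "M * x powr \<gamma> \<le> A * (2 * chain_weight \<gamma> T n)"
      using A_ge by (intro mult_mono) auto
    then show ?thesis by (simp add: W_def)
  qed
  have tp: "H_norm \<alpha> (R (t, p)) \<le> W"
    unfolding p_def t(1) W_def by (rule R_chain_right[OF k t(2)]) (use p in \<open>auto simp flip: p_def t(1) L_def\<close>)
  have ps: "H_norm \<alpha> (R (p, s)) \<le> 4 * W"
  proof (cases "p - s \<le> L")
    case True
    have "H_norm \<alpha> (R (p, s)) \<le> W"
      unfolding p_def s(1) W_def by (rule R_chain_left[OF k s(2)]) (use sp True in \<open>auto simp flip: p_def s(1) L_def\<close>)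
    then show ?thesis using W by simp
  next
    case False
    have "0 < p" using False bnd L by linarith
    then have "k \<noteq> 0" by (cases "k = 0") (auto simp: p_def dyadic_pt_def)
    then obtain l where l: "k = Suc l" using not0_implies_Suc by blast
    \<comment> \<open>As \<open>p - s \<le> 2 L\<^sub>n\<close>, one adjacent interval to the left of \<open>p\<close> comes close enough to \<open>s\<close>.\<close>
    define u where "u = pt n l"
    have pu: "p = u + L" by (simp add: p_def l u_def dyadic_pt_Suc L_def)
    have u: "l \<le> 2 ^ n" "l < 2 ^ n" "u \<in> dyadics T" using l k by (auto simp: u_def intro: dyadic_pt_mem)
    have us: "s \<le> u" "u - s \<le> L" "p - s \<le> 2 * L" using False pu p L by (auto simp: r_def)
    have "H_norm \<alpha> (R (p, u)) \<le> A * child_weight \<gamma> T n"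
      unfolding p_def u_def l by (rule R_adjacent_le[OF u(2)])
    also have "\<dots> \<le> W"
      unfolding W_def using A_ge weights_le_chain_weight(2)[OF \<gamma> T(1)] by (intro mult_left_mono)
    finally have pu_le: "H_norm \<alpha> (R (p, u)) \<le> W" .
    have us_le: "H_norm \<alpha> (R (u, s)) \<le> W"
      unfolding u_def s(1) W_def by (rule R_chain_left[OF u(1) s(2)]) (use us in \<open>auto simp flip: u_def s(1) L_def\<close>)
    have "H_norm \<alpha> (R (p, s)) \<le> H_norm \<alpha> (R (p, u)) + H_norm \<alpha> (R (u, s)) + M * (p - s) powr \<gamma>"
      using us L pu by (intro R_triangle assms u p) auto
    then show ?thesis using pu_le us_le jump[of "p - s"] us sp by linarith
  qed
  have "H_norm \<alpha> (R (t, s)) \<le> H_norm \<alpha> (R (t, p)) + H_norm \<alpha> (R (p, s)) + M * (t - s) powr \<gamma>"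
    using sp p by (intro R_triangle assms) auto
  then have "H_norm \<alpha> (R (t, s)) \<le> 7 * W"
    using tp ps jump[of "t - s"] r L by (simp add: r_def)
  also have "\<dots> \<le> 7 * (A * (chain_const \<gamma> * gauge \<gamma> r))"
    unfolding W_def using A_ge T r by (intro mult_left_mono chain_weight_le_gauge \<gamma> T n1 n2) auto
  finally show ?thesis by (simp add: r_def mult_ac)
qed

end

section \<open>Continuous extension of the dyadic residual\<close>

lemma H_norm_minus_commute: "H_norm \<alpha> (u - v) = H_norm \<alpha> (v - u)"
proof -
  have "cmod (A0_pow (\<alpha> / 2) (u - v) k) = cmod (A0_pow (\<alpha> / 2) (v - u) k)" for k
    by (simp add: A0_pow_def norm_mult norm_minus_commute)
  then show ?thesis by (simp only: H_norm_def l2_norm_def)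
qed

lemma heat_extension_tendsto:
  assumes T: "0 < T" and ex: "heat_extension c0 T \<alpha> \<sigma> H \<Lambda>" and ts: "(t, s) \<in> simplex2 T"
  shows "(\<lambda>n. heat_residual c0 \<sigma> T H (dyadic_floor T n t, dyadic_floor T n s) k) \<longlonglongrightarrow> \<Lambda> (t, s) k"
proof -
  let ?x = "\<lambda>n. (dyadic_floor T n t, dyadic_floor T n s)"
  have st: "0 \<le> s" "s \<le> t" "t \<le> T" using ts by (auto simp: simplex2_def)
  note dt = dyadic_floor[OF T, of t] and ds = dyadic_floor[OF T, of s]
  have mem: "dyadic_floor T n t \<in> dyadics T" "dyadic_floor T n s \<in> dyadics T" for n
    using dt(2) ds(2) st by simp_all
  have le: "dyadic_floor T n s \<le> dyadic_floor T n t" for n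
    using dyadic_floor_mono[OF T] st by simp
  have "?x n \<in> simplex2 T" for n
    using dyadics_bounds[OF T mem(1)] dyadics_bounds[OF T mem(2)] le[of n] by (simp add: simplex2_def)
  moreover have "?x \<longlonglongrightarrow> (t, s)"
    using st by (intro tendsto_Pair dyadic_floor_tendsto T) auto
  ultimately have "(\<lambda>n. \<Lambda> (?x n) k) \<longlonglongrightarrow> \<Lambda> (t, s) k"
    by (intro C_maps_tendsto(2)[where \<alpha> = \<alpha>, OF _ ts]) (use ex in \<open>auto simp: heat_extension_def\<close>)
  moreover have "\<Lambda> (?x n) = heat_residual c0 \<sigma> T H (?x n)" for n
    using ex mem le by (simp add: heat_extension_def)
  ultimately show ?thesis by simp
qed

text \<open>The dyadic points of the simplex are dense in it, so an extension is determined by the residual.\<close>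

lemma heat_sewing_eqI:
  assumes T: "0 < T" and ex: "heat_extension c0 T \<alpha> \<sigma> H \<Lambda>" and zero: "\<And>x. x \<notin> simplex2 T \<Longrightarrow> \<Lambda> x = 0"
  shows "heat_sewing c0 T \<alpha> \<sigma> H = \<Lambda>"
  unfolding heat_sewing_def
proof (rule the_equality)
  show "heat_extension c0 T \<alpha> \<sigma> H \<Lambda> \<and> (\<forall>x. x \<notin> simplex2 T \<longrightarrow> \<Lambda> x = 0)"
    using ex zero by blast
  fix \<Lambda>' assume \<Lambda>': "heat_extension c0 T \<alpha> \<sigma> H \<Lambda>' \<and> (\<forall>x. x \<notin> simplex2 T \<longrightarrow> \<Lambda>' x = 0)"
  show "\<Lambda>' = \<Lambda>"
  proof (intro ext)
    fix x k
    show "\<Lambda>' x k = \<Lambda> x k"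
    proof (cases "x \<in> simplex2 T")
      case True
      then obtain t s where x: "x = (t, s)" "(t, s) \<in> simplex2 T" by (cases x) auto
      show ?thesis
        unfolding x(1)
        by (rule LIMSEQ_unique[OF heat_extension_tendsto[OF T conjunct1[OF \<Lambda>'] x(2)]
              heat_extension_tendsto[OF T ex x(2)]])
    next
      case False
      then have "\<Lambda>' x = 0" "\<Lambda> x = 0" using zero \<Lambda>' by blast+
      then show ?thesis by simp
    qed
  qed
qed

definition sewing_const :: "real \<Rightarrow> real \<Rightarrow> real \<Rightarrow> real" where
  "sewing_const c0 \<sigma> \<gamma> = 7 * growth_bound c0 \<sigma> * chain_const \<gamma>"

lemma sewing_const_nonneg: "0 < \<gamma> \<Longrightarrow> \<gamma> \<le> 1 \<Longrightarrow> 0 \<le> sewing_const c0 \<sigma> \<gamma>"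
  using chain_const_pos[of \<gamma>] by (simp add: sewing_const_def growth_bound_def)

locale continuous_heat_defect = heat_defect \<gamma> \<alpha> \<beta> \<sigma> c0 T K H
  for \<gamma> \<alpha> \<beta> \<sigma> c0 T K :: real and H :: "'d::finite incr3" +
  assumes residual_cont: "residual_continuity c0 T \<alpha> \<sigma> H"
begin

lemma residual_small:
  assumes e: "0 < e"
  shows "\<exists>d>0. \<forall>h s t. 0 < h \<and> h < d \<and> s \<in> dyadics T \<and> t \<in> dyadics T \<and> s \<le> t \<and> t + h \<le> T \<longrightarrow>
    H_norm \<alpha> (heat h (R (t, s)) - R (t, s)) < e"
proof -
  have "\<forall>\<^sub>F h in at_right 0. residual_modulus c0 T \<alpha> \<sigma> H h < ennreal e"
    using residual_cont e unfolding residual_continuity_def by (intro order_tendstoD) auto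
  then obtain d where d: "0 < d" "\<And>h. 0 < h \<Longrightarrow> h < d \<Longrightarrow> residual_modulus c0 T \<alpha> \<sigma> H h < ennreal e"
    unfolding eventually_at_right_field by auto
  show ?thesis
  proof (intro exI[of _ d] conjI d(1) allI impI)
    fix h s t assume a: "0 < h \<and> h < d \<and> s \<in> dyadics T \<and> t \<in> dyadics T \<and> s \<le> t \<and> t + h \<le> T"
    have "ennreal (H_norm \<alpha> (heat h (R (t, s)) - R (t, s))) \<le> residual_modulus c0 T \<alpha> \<sigma> H h"
      unfolding residual_modulus_def using a by (intro SUP_upper2[of "(t, s)"]) auto
    also have "\<dots> < ennreal e" using d a by blast
    finally show "H_norm \<alpha> (heat h (R (t, s)) - R (t, s)) < e" by (simp add: ennreal_less_iff)
  qed
qed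

lemma I_eq_R: "t \<in> dyadics T \<Longrightarrow> I t = - R (t, 0)"
  using dyadics_bounds[OF T(1), of t] by (simp add: heat_residual_def germ_initial I_0)

lemma zero_dyadic: "0 \<in> dyadics T"
  using dyadic_pt_mem[of 0 0 T] by (simp add: dyadic_pt_def)

text \<open>For dyadic \<open>s \<le> t\<close> the increment \<open>I\<^sub>t - I\<^sub>s\<close> is the germ, minus the residual, plus
  \<open>(S\<^bsub>t-s\<^esub> - Id) I\<^sub>s\<close>. Since \<open>I\<^sub>s = - R\<^bsub>s0\<^esub>\<close>, the last term is exactly what the continuity criterion
  controls, uniformly in \<open>s\<close>.\<close>

lemma I_increment_small:
  assumes e: "0 < e"
  shows "\<exists>d>0. \<forall>s\<in>dyadics T. \<forall>t\<in>dyadics T. s < t \<and> t - s < d \<longrightarrow> H_norm \<alpha> (I t - I s) < e"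
proof -
  obtain d1 where d1: "0 < d1" "\<forall>s t. 0 \<le> s \<and> s \<le> t \<and> t \<le> T \<and> t - s < d1 \<longrightarrow> H_norm \<alpha> (H (t, s, 0)) < e / 3"
    using germ_small[OF norm3_finite T(1), of "e / 3"] e by auto
  obtain d2 where d2: "0 < d2" "\<forall>h s t. 0 < h \<and> h < d2 \<and> s \<in> dyadics T \<and> t \<in> dyadics T \<and> s \<le> t \<and> t + h \<le> T \<longrightarrow>
    H_norm \<alpha> (heat h (R (t, s)) - R (t, s)) < e / 3"
    using residual_small[of "e / 3"] e by auto
  have "((\<lambda>r. 7 * A * chain_const \<gamma> * gauge \<gamma> r) \<longlongrightarrow> 7 * A * chain_const \<gamma> * 0) (at_right 0)"
    by (intro tendsto_mult tendsto_const gauge_tendsto_0 \<gamma>)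
  then have "\<forall>\<^sub>F r in at_right 0. 7 * A * chain_const \<gamma> * gauge \<gamma> r < e / 3"
    using e by (intro order_tendstoD) auto
  then obtain d3 where d3: "0 < d3" "\<And>r. 0 < r \<Longrightarrow> r < d3 \<Longrightarrow> 7 * A * chain_const \<gamma> * gauge \<gamma> r < e / 3"
    unfolding eventually_at_right_field by auto
  show ?thesis
  proof (intro exI[of _ "min d1 (min d2 d3)"] conjI ballI impI)
    show "0 < min d1 (min d2 d3)" using d1 d2 d3 by simp
    fix s t assume dy: "s \<in> dyadics T" "t \<in> dyadics T" and st: "s < t \<and> t - s < min d1 (min d2 d3)"
    note bnd = dyadics_bounds[OF T(1) dy(1)] dyadics_bounds[OF T(1) dy(2)]
    let ?D = "heat (t - s) (R (s, 0)) - R (s, 0)"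
    have germ: "H_norm \<alpha> (B_germ H (t, s)) < e / 3"
    proof -
      have "H_norm \<alpha> (B_germ H (t, s)) \<le> H_norm \<alpha> (H (t, s, 0))"
        using H_uminus(2)[OF H_mem[of 0 s t]] bnd st by (simp add: B_germ_def)
      also have "\<dots> < e / 3" using d1 st bnd by simp
      finally show ?thesis .
    qed
    have res: "H_norm \<alpha> (R (t, s)) < e / 3"
      using R_dyadic_bound[OF dy] d3(2)[of "t - s"] st by simp
    have D: "H_norm \<alpha> ?D < e / 3"
      using d2(2) st dy bnd zero_dyadic by simp
    have "R (t, s) = B_germ H (t, s) - I t - heat (t - s) (R (s, 0))"
      by (simp add: heat_residual_def[of c0 \<sigma> T H, THEN fun_cong, of "(t, s)"] I_eq_R[OF dy(1)] heat_uminus)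
    then have eq: "I t - I s = (B_germ H (t, s) - R (t, s)) - ?D"
      unfolding I_eq_R[OF dy(1)] by (simp add: algebra_simps)
    have mem: "B_germ H (t, s) \<in> H_space \<alpha>" "R (t, s) \<in> H_space \<alpha>" "?D \<in> H_space \<alpha>"
      using dy st bnd zero_dyadic by (auto intro!: germ_mem R_mem H_diff H_heat)
    have "H_norm \<alpha> (I t - I s) \<le> H_norm \<alpha> (B_germ H (t, s)) + H_norm \<alpha> (R (t, s)) + H_norm \<alpha> ?D"
      unfolding eq
      by (rule order_trans[OF H_diff(2)[OF H_diff(1)[OF mem(1,2)] mem(3)]
            add_right_mono[OF H_diff(2)[OF mem(1,2)]]])
    also have "\<dots> < e / 3 + e / 3 + e / 3" by (intro add_strict_mono germ res D)
    finally show "H_norm \<alpha> (I t - I s) < e" by simp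
  qed
qed

lemma I_uniformly_continuous:
  assumes e: "0 < e"
  shows "\<exists>d>0. \<forall>s\<in>dyadics T. \<forall>t\<in>dyadics T. \<bar>t - s\<bar> < d \<longrightarrow> H_norm \<alpha> (I t - I s) < e"
proof -
  obtain d where d: "0 < d" "\<And>s t. s \<in> dyadics T \<Longrightarrow> t \<in> dyadics T \<Longrightarrow> s < t \<Longrightarrow> t - s < d \<Longrightarrow> H_norm \<alpha> (I t - I s) < e"
    using I_increment_small[OF e] by blast
  have "H_norm \<alpha> (I t - I s) < e" if "s \<in> dyadics T" "t \<in> dyadics T" "\<bar>t - s\<bar> < d" for s t
  proof (cases s t rule: linorder_cases)
    case less
    then show ?thesis using d(2) that by simp
  next
    case equal
    have "H_norm \<alpha> (I t - I s) = 0" unfolding equal diff_self by (rule H_zero(2))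
    then show ?thesis using e by simp
  next
    case greater
    then show ?thesis using d(2)[of t s] that by (simp add: H_norm_minus_commute[of \<alpha> "I t"])
  qed
  then show ?thesis using d(1) by blast
qed

text \<open>The extension of \<open>I\<close> is taken frequency by frequency; that the limit lies in \<open>H\<^sup>\<alpha>\<close> and depends
  continuously on time then follows from uniform estimates on \<open>I\<close> and Fatou's lemma.\<close>

definition J :: "real \<Rightarrow> 'd tdist" where
  "J t = (\<lambda>k. lim (\<lambda>n. I (dyadic_floor T n t) k))"

lemma J_tendsto:
  assumes t: "0 \<le> t" "t \<le> T"
  shows "(\<lambda>n. I (dyadic_floor T n t) k) \<longlonglongrightarrow> J t k"
proof -
  let ?w = "eig k powr (\<alpha> / 2)"
  have w: "0 < ?w" using eig_pos[of k] by simp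
  have "Cauchy (\<lambda>n. I (dyadic_floor T n t) k)"
  proof (rule CauchyI)
    fix e :: real assume "0 < e"
    then obtain d where d: "0 < d" "\<And>s t. s \<in> dyadics T \<Longrightarrow> t \<in> dyadics T \<Longrightarrow> \<bar>t - s\<bar> < d \<Longrightarrow> H_norm \<alpha> (I t - I s) < ?w * e"
      using I_uniformly_continuous[of "?w * e"] w by (metis mult_pos_pos)
    obtain N where N: "\<And>n. N \<le> n \<Longrightarrow> \<bar>dyadic_floor T n t - t\<bar> < d / 2"
      using LIMSEQ_D[OF dyadic_floor_tendsto[OF T(1) t], of "d / 2"] d(1) by auto
    have "norm (I (dyadic_floor T m t) k - I (dyadic_floor T n t) k) < e" if "N \<le> m" "N \<le> n" for m n
    proof -
      let ?a = "dyadic_floor T m t" and ?b = "dyadic_floor T n t"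
      have mem: "?a \<in> dyadics T" "?b \<in> dyadics T" using dyadic_floor(2)[OF T(1) t] by auto
      have "\<bar>?a - ?b\<bar> < d" using N[OF that(1)] N[OF that(2)] by linarith
      then have "H_norm \<alpha> (I ?a - I ?b) < ?w * e" using d(2) mem by blast
      moreover have "?w * cmod (I ?a k - I ?b k) \<le> H_norm \<alpha> (I ?a - I ?b)"
        using coeff_le_H_norm[OF H_diff(1)[OF I_mem I_mem]] mem by fastforce
      ultimately have "?w * cmod (I ?a k - I ?b k) < ?w * e" by linarith
      then show ?thesis using w by simp
    qed
    then show "\<exists>N. \<forall>m\<ge>N. \<forall>n\<ge>N. norm (I (dyadic_floor T m t) k - I (dyadic_floor T n t) k) < e" by blast
  qed
  then show ?thesis
    unfolding J_def by (simp add: Cauchy_convergent_iff convergent_LIMSEQ_iff)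
qed

lemma J_dyadic:
  assumes "t \<in> dyadics T"
  shows "J t = I t"
proof (rule ext)
  fix k
  have "\<forall>\<^sub>F n in sequentially. I (dyadic_floor T n t) k = I t k"
    using dyadic_floor_eq[OF T(1) assms] by eventually_elim simp
  then have "(\<lambda>n. I (dyadic_floor T n t) k) \<longlonglongrightarrow> I t k"
    by (rule tendsto_eventually)
  with J_tendsto[of t k] show "J t k = I t k"
    using dyadics_bounds[OF T(1) assms] by (auto intro: LIMSEQ_unique)
qed

lemma J_uniformly_continuous:
  assumes e: "0 < e"
  shows "\<exists>d>0. \<forall>s t. 0 \<le> s \<and> s \<le> T \<and> 0 \<le> t \<and> t \<le> T \<and> \<bar>t - s\<bar> < d \<longrightarrow>
    J t - J s \<in> H_space \<alpha> \<and> H_norm \<alpha> (J t - J s) \<le> e"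
proof -
  obtain d where d: "0 < d" "\<And>s t. s \<in> dyadics T \<Longrightarrow> t \<in> dyadics T \<Longrightarrow> \<bar>t - s\<bar> < d \<Longrightarrow> H_norm \<alpha> (I t - I s) < e"
    using I_uniformly_continuous[OF e] by blast
  have "J t - J s \<in> H_space \<alpha> \<and> H_norm \<alpha> (J t - J s) \<le> e"
    if a: "0 \<le> s" "s \<le> T" "0 \<le> t" "t \<le> T" "\<bar>t - s\<bar> < d" for s t
  proof -
    let ?u = "\<lambda>n. I (dyadic_floor T n t) - I (dyadic_floor T n s)"
    have mem: "dyadic_floor T n t \<in> dyadics T" "dyadic_floor T n s \<in> dyadics T" for n
      using dyadic_floor(2)[OF T(1)] a by auto
    have lim: "(\<lambda>n. ?u n k) \<longlonglongrightarrow> (J t - J s) k" for k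
      unfolding minus_apply using a by (intro tendsto_diff J_tendsto)
    have "(\<lambda>n. \<bar>dyadic_floor T n t - dyadic_floor T n s\<bar>) \<longlonglongrightarrow> \<bar>t - s\<bar>"
      using a by (intro tendsto_rabs tendsto_diff dyadic_floor_tendsto T)
    then have "\<forall>\<^sub>F n in sequentially. \<bar>dyadic_floor T n t - dyadic_floor T n s\<bar> < d"
      using a by (intro order_tendstoD) auto
    then have ev: "\<forall>\<^sub>F n in sequentially. ?u n \<in> H_space \<alpha> \<and> H_norm \<alpha> (?u n) \<le> e"
      by eventually_elim (use d(2) mem in \<open>auto intro!: H_diff I_mem less_imp_le\<close>)
    show ?thesis
      using H_norm_Fatou[OF sequentially_bot lim ev tendsto_const] by blast
  qed
  then show ?thesis using d(1) by blast
qed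

lemma J_mem:
  assumes t: "0 \<le> t" "t \<le> T"
  shows "J t \<in> H_space \<alpha>"
proof -
  obtain d where d: "0 < d" "\<And>s t. 0 \<le> s \<Longrightarrow> s \<le> T \<Longrightarrow> 0 \<le> t \<Longrightarrow> t \<le> T \<Longrightarrow> \<bar>t - s\<bar> < d \<Longrightarrow> J t - J s \<in> H_space \<alpha>"
    using J_uniformly_continuous[of 1] by auto
  obtain n where n: "\<bar>dyadic_floor T n t - t\<bar> < d"
    using LIMSEQ_D[OF dyadic_floor_tendsto[OF T(1) t] d(1)] by auto
  define s where "s = dyadic_floor T n t"
  have s: "s \<in> dyadics T" using dyadic_floor(2)[OF T(1) t] by (simp add: s_def)
  have "J t - J s \<in> H_space \<alpha>"
    using n dyadics_bounds[OF T(1) s] t by (intro d(2)) (auto simp: s_def abs_minus_commute)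
  moreover have "J s \<in> H_space \<alpha>" using s by (simp add: J_dyadic I_mem)
  ultimately have "(J t - J s) + J s \<in> H_space \<alpha>" by (rule H_add)
  then show ?thesis by simp
qed

definition \<Lambda> :: "'d incr2" where
  "\<Lambda> x = (if x \<in> simplex2 T then path_residual H J x else 0)"

lemma germ_C_maps: "B_germ H \<in> C_maps \<alpha> (simplex2 T)"
  unfolding C_maps_def
proof (intro CollectI conjI ballI)
  fix x assume x: "x \<in> simplex2 T"
  obtain t s where ts: "x = (t, s)" by (cases x)
  show "B_germ H x \<in> H_space \<alpha>" using x germ_mem by (auto simp: simplex2_def)
  let ?e = "\<lambda>y. (fst y, snd y, 0 :: real)"
  have ev: "\<forall>\<^sub>F y in at x within simplex2 T. ?e y \<in> simplex3 T"
    by (auto simp: eventually_at_filter simplex2_def simplex3_def split_beta)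
  have lim: "(?e \<longlongrightarrow> ?e x) (at x within simplex2 T)"
    by (intro tendsto_intros)
  have "?e x \<in> simplex3 T" using x by (auto simp: simplex2_def simplex3_def)
  from C_maps_tendsto(1)[OF H_C_maps this ev lim]
  have "((\<lambda>y. H_norm \<alpha> (H (?e y) - H (?e x))) \<longlongrightarrow> 0) (at x within simplex2 T)" .
  moreover have "H_norm \<alpha> (B_germ H y - B_germ H x) = H_norm \<alpha> (H (?e y) - H (?e x))" for y
    by (subst H_norm_minus_commute) (simp add: B_germ_def split_beta)
  ultimately show "((\<lambda>y. H_norm \<alpha> (B_germ H y - B_germ H x)) \<longlongrightarrow> 0) (at x within simplex2 T)"
    by simp
qed

lemma J_continuous:
  assumes lim: "(f \<longlongrightarrow> t) F" and ev: "\<forall>\<^sub>F y in F. 0 \<le> f y \<and> f y \<le> T" and t: "0 \<le> t" "t \<le> T"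
  shows "((\<lambda>y. H_norm \<alpha> (J (f y) - J t)) \<longlongrightarrow> 0) F"
proof (rule tendstoI)
  fix e :: real assume e: "0 < e"
  obtain d where d: "0 < d" "\<And>s t. 0 \<le> s \<Longrightarrow> s \<le> T \<Longrightarrow> 0 \<le> t \<Longrightarrow> t \<le> T \<Longrightarrow> \<bar>t - s\<bar> < d \<Longrightarrow> H_norm \<alpha> (J t - J s) \<le> e / 2"
    using J_uniformly_continuous[of "e / 2"] e by (metis half_gt_zero)
  have "\<forall>\<^sub>F y in F. dist (f y) t < d" using lim d(1) by (rule tendstoD)
  with ev show "\<forall>\<^sub>F y in F. dist (H_norm \<alpha> (J (f y) - J t)) 0 < e"
  proof eventually_elim
    case (elim y)
    then have "H_norm \<alpha> (J (f y) - J t) \<le> e / 2" using t by (intro d(2)) (auto simp: dist_real_def)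
    then show ?case using e by simp
  qed
qed

lemma \<Lambda>_C_maps: "\<Lambda> \<in> C_maps \<alpha> (simplex2 T)"
  unfolding C_maps_def
proof (intro CollectI conjI ballI)
  fix x assume x: "x \<in> simplex2 T"
  obtain t s where ts: "x = (t, s)" by (cases x)
  have st: "0 \<le> s" "s \<le> t" "t \<le> T" using x by (auto simp: ts simplex2_def)
  show "\<Lambda> x \<in> H_space \<alpha>"
    using x st by (auto simp: \<Lambda>_def ts path_residual_def intro!: H_add H_diff germ_mem J_mem H_heat)
  let ?F = "at x within simplex2 T"
  let ?b = "\<lambda>y. H_norm \<alpha> (B_germ H y - B_germ H x)"
  let ?t = "\<lambda>y. H_norm \<alpha> (J (fst y) - J t)"
  let ?s = "\<lambda>y. H_norm \<alpha> (J (snd y) - J s)"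
  let ?h = "\<lambda>y. H_norm \<alpha> (heat (fst y - snd y) (J s) - heat (t - s) (J s))"
  have ev: "\<forall>\<^sub>F y in ?F. y \<in> simplex2 T" by (auto simp: eventually_at_filter)
  have lim: "(fst \<longlongrightarrow> t) ?F" "(snd \<longlongrightarrow> s) ?F"
    unfolding ts by (auto intro: tendsto_eq_intros)
  have b: "(?b \<longlongrightarrow> 0) ?F" using germ_C_maps x by (simp add: C_maps_def)
  have jt: "(?t \<longlongrightarrow> 0) ?F"
    by (rule J_continuous[OF lim(1)]) (use ev st in \<open>auto elim!: eventually_mono simp: simplex2_def\<close>)
  have js: "(?s \<longlongrightarrow> 0) ?F"
    by (rule J_continuous[OF lim(2)]) (use ev st in \<open>auto elim!: eventually_mono simp: simplex2_def\<close>)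
  have "continuous (at (t - s) within {0..}) (\<lambda>r. H_norm \<alpha> (heat r (J s) - heat (t - s) (J s)))"
    using heat_strongly_continuous[OF J_mem, of s "t - s"] st by (simp add: continuous_within)
  moreover have "\<forall>\<^sub>F y in ?F. fst y - snd y \<in> {0..}"
    using ev by (auto elim!: eventually_mono simp: simplex2_def)
  moreover have "((\<lambda>y. fst y - snd y) \<longlongrightarrow> t - s) ?F" by (intro tendsto_diff lim)
  ultimately have "(?h \<longlongrightarrow> H_norm \<alpha> (heat (t - s) (J s) - heat (t - s) (J s))) ?F"
    by (rule continuous_within_tendsto_compose)
  then have h: "(?h \<longlongrightarrow> 0) ?F" by simp
  have sum: "((\<lambda>y. ?b y + ?t y + (?s y + ?h y)) \<longlongrightarrow> 0 + 0 + (0 + 0)) ?F"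
    by (intro tendsto_add b jt js h)
  have "\<forall>\<^sub>F y in ?F. norm (H_norm \<alpha> (\<Lambda> y - \<Lambda> x)) \<le> ?b y + ?t y + (?s y + ?h y)"
    using ev
  proof eventually_elim
    case (elim y)
    obtain t' s' where y: "y = (t', s')" by (cases y)
    then have y': "fst y = t'" "snd y = s'" by simp_all
    have st': "0 \<le> s'" "s' \<le> t'" "t' \<le> T" using elim by (auto simp: y simplex2_def)
    have mem: "B_germ H y - B_germ H x \<in> H_space \<alpha>" "J t' - J t \<in> H_space \<alpha>" "J s' - J s \<in> H_space \<alpha>"
      "heat (t' - s') (J s) - heat (t - s) (J s) \<in> H_space \<alpha>" "heat (t' - s') (J s' - J s) \<in> H_space \<alpha>"
      unfolding y ts using st st' by (auto intro!: H_diff germ_mem J_mem H_heat)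
    have eq: "\<Lambda> y - \<Lambda> x = (B_germ H y - B_germ H x) - (J t' - J t) +
        (heat (t' - s') (J s' - J s) + (heat (t' - s') (J s) - heat (t - s) (J s)))"
      using x elim by (simp add: \<Lambda>_def y ts path_residual_def heat_diff)
    have "H_norm \<alpha> (\<Lambda> y - \<Lambda> x) \<le> ?b y + ?t y + (H_norm \<alpha> (heat (t' - s') (J s' - J s)) + ?h y)"
      unfolding eq y'
      by (intro order_trans[OF H_add(2)] add_mono H_add H_diff mem)
    also have "\<dots> \<le> ?b y + ?t y + (?s y + ?h y)"
      using H_heat(2)[OF mem(3), of "t' - s'"] st' by (simp add: y)
    finally show ?case by simp
  qed
  then show "((\<lambda>y. H_norm \<alpha> (\<Lambda> y - \<Lambda> x)) \<longlongrightarrow> 0) ?F"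
    by (rule Lim_null_comparison) (use sum in simp)
qed

lemma \<Lambda>_extension: "heat_extension c0 T \<alpha> \<sigma> H \<Lambda>"
  unfolding heat_extension_def
proof (intro conjI \<Lambda>_C_maps ballI impI)
  fix s t assume a: "s \<in> dyadics T" "t \<in> dyadics T" "s \<le> t"
  then have "(t, s) \<in> simplex2 T" using dyadics_bounds[OF T(1)] by (simp add: simplex2_def)
  then show "\<Lambda> (t, s) = R (t, s)"
    using a by (simp add: \<Lambda>_def heat_residual_path path_residual_def J_dyadic)
qed

lemma heat_sewing_eq: "heat_sewing c0 T \<alpha> \<sigma> H = \<Lambda>"
  by (rule heat_sewing_eqI[OF T(1) \<Lambda>_extension]) (simp add: \<Lambda>_def)

lemma heat_sewing_extension: "heat_extension c0 T \<alpha> \<sigma> H (heat_sewing c0 T \<alpha> \<sigma> H)"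
  unfolding heat_sewing_eq by (rule \<Lambda>_extension)

lemma heat_sewing_coboundary:
  assumes x: "x \<in> simplex3 T"
  shows "hat_delta2 (heat_sewing c0 T \<alpha> \<sigma> H) x = H x"
proof -
  obtain t u s where tus: "x = (t, u, s)" by (cases x)
  have le: "0 \<le> s" "s \<le> u" "u \<le> t" "t \<le> T" using x by (auto simp: tus simplex3_def)
  have "hat_delta3 H (t, u, s, 0) = 0" using le by (intro H_cocycle) (simp add: simplex4_def)
  note chen = path_residual_chen[OF this, of J]
  have \<Lambda>: "\<Lambda> (t, s) = path_residual H J (t, s)" "\<Lambda> (t, u) = path_residual H J (t, u)"
    "\<Lambda> (u, s) = path_residual H J (u, s)"
    using le by (simp_all add: \<Lambda>_def simplex2_def)
  show ?thesis
    unfolding tus heat_sewing_eq hat_delta2_eq \<Lambda> chen by simp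
qed

text \<open>The dyadic bound passes to real times by lower semicontinuity of the norm; the gauge is continuous
  away from zero.\<close>

lemma heat_sewing_bound:
  assumes st: "0 \<le> s" "s < t" "t \<le> T"
  shows "H_norm \<alpha> (heat_sewing c0 T \<alpha> \<sigma> H (t, s)) \<le> sewing_const c0 \<sigma> \<gamma> * (M + K) * gauge \<gamma> (t - s)"
proof -
  let ?t = "\<lambda>n. dyadic_floor T n t" and ?s = "\<lambda>n. dyadic_floor T n s"
  have x: "(t, s) \<in> simplex2 T" using st by (simp add: simplex2_def)
  have lim: "(\<lambda>n. R (?t n, ?s n) k) \<longlonglongrightarrow> heat_sewing c0 T \<alpha> \<sigma> H (t, s) k" for k
    by (rule heat_extension_tendsto[OF T(1) heat_sewing_extension x])
  have diff: "(\<lambda>n. ?t n - ?s n) \<longlonglongrightarrow> t - s"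
    using st by (intro tendsto_diff dyadic_floor_tendsto T) auto
  then have "\<forall>\<^sub>F n in sequentially. 0 < ?t n - ?s n"
    using st by (intro order_tendstoD) auto
  then have ev: "\<forall>\<^sub>F n in sequentially. R (?t n, ?s n) \<in> H_space \<alpha> \<and>
      H_norm \<alpha> (R (?t n, ?s n)) \<le> 7 * A * chain_const \<gamma> * gauge \<gamma> (?t n - ?s n)"
    by eventually_elim (use st in \<open>intro conjI R_mem R_dyadic_bound dyadic_floor(2) T; simp\<close>)
  have "(\<lambda>n. 7 * A * chain_const \<gamma> * gauge \<gamma> (?t n - ?s n)) \<longlonglongrightarrow> 7 * A * chain_const \<gamma> * gauge \<gamma> (t - s)"
    using st by (intro tendsto_mult tendsto_const gauge_tendsto diff) auto
  from H_norm_Fatou(2)[OF sequentially_bot lim ev this]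
  show ?thesis by (simp add: sewing_const_def A_def mult_ac)
qed

text \<open>The norms of increments are extended nonnegative reals, whereas the estimates above are between
  reals. All quantities on the right are finite here.\<close>

lemma const_times_norms:
  "ennreal (sewing_const c0 \<sigma> \<gamma> * (M + K)) = ennreal (sewing_const c0 \<sigma> \<gamma>) * (norm3 T \<gamma> \<alpha> H + ennreal K)"
  using sewing_const_nonneg[OF \<gamma>] M_nonneg K_nonneg norm3_finite
  by (simp add: ennreal_mult M_def)

lemma norm2_heat_sewing:
  assumes "\<gamma> < 1"
  shows "norm2 T \<gamma> \<alpha> (heat_sewing c0 T \<alpha> \<sigma> H) \<le> ennreal (sewing_const c0 \<sigma> \<gamma>) * (norm3 T \<gamma> \<alpha> H + ennreal K)"
  unfolding norm2_def
proof (rule SUP_least, clarify)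
  fix t s assume st: "0 \<le> s" "s < t" "t \<le> T"
  show "ennreal (H_norm \<alpha> (heat_sewing c0 T \<alpha> \<sigma> H (t, s)) / (t - s) powr \<gamma>)
      \<le> ennreal (sewing_const c0 \<sigma> \<gamma>) * (norm3 T \<gamma> \<alpha> H + ennreal K)"
    unfolding const_times_norms[symmetric] using heat_sewing_bound[OF st] st assms
    by (intro ennreal_leI) (simp add: gauge_def divide_le_eq)
qed

lemma norm_log_heat_sewing:
  assumes "\<gamma> = 1"
  shows "norm_log T \<alpha> (heat_sewing c0 T \<alpha> \<sigma> H) \<le> ennreal (sewing_const c0 \<sigma> \<gamma>) * (norm3 T \<gamma> \<alpha> H + ennreal K)"
  unfolding norm_log_def
proof (rule SUP_least, clarify)
  fix t s assume st: "0 \<le> s" "s < t" "t \<le> T"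
  then have "0 < (t - s) * (1 + \<bar>ln (t - s)\<bar>)" by (intro mult_pos_pos add_pos_nonneg) auto
  then show "ennreal (H_norm \<alpha> (heat_sewing c0 T \<alpha> \<sigma> H (t, s)) / ((t - s) * (1 + \<bar>ln (t - s)\<bar>)))
      \<le> ennreal (sewing_const c0 \<sigma> \<gamma>) * (norm3 T \<gamma> \<alpha> H + ennreal K)"
    unfolding const_times_norms[symmetric] using heat_sewing_bound[OF st] assms
    by (intro ennreal_leI) (simp add: gauge_def divide_le_eq)
qed

lemma const_times_norms_finite: "ennreal (sewing_const c0 \<sigma> \<gamma>) * (norm3 T \<gamma> \<alpha> H + ennreal K) < \<infinity>"
  unfolding const_times_norms[symmetric] by simp

lemma heat_sewing_C2: "\<gamma> < 1 \<Longrightarrow> heat_sewing c0 T \<alpha> \<sigma> H \<in> C2 T \<gamma> \<alpha>"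
  using order_le_less_trans[OF norm2_heat_sewing const_times_norms_finite] \<Lambda>_C_maps
  by (simp add: C2_def heat_sewing_eq)

lemma heat_sewing_C_log: "\<gamma> = 1 \<Longrightarrow> heat_sewing c0 T \<alpha> \<sigma> H \<in> C_log T \<alpha>"
  using order_le_less_trans[OF norm_log_heat_sewing const_times_norms_finite] \<Lambda>_C_maps
  by (simp add: C_log_def heat_sewing_eq)

end

section \<open>Linearity and continuity on classes of defects\<close>

text \<open>Every step of the recursion applies a Fourier multiplier to a linear combination of values of \<open>H\<close>
  and of the path.\<close>

lemma heat_level_linear:
  assumes F: "\<And>x k. F x k = a * G x k + b * H x k"
  shows "heat_level c0 \<sigma> T F n j k = a * heat_level c0 \<sigma> T G n j k + b * heat_level c0 \<sigma> T H n j k"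
proof -
  \<comment> \<open>At a fixed frequency all operators are multiplications by a number.\<close>
  obtain e where e: "heat t u k = e t * u k" for t u
    by (rule that[of "\<lambda>t. of_real (exp (- t * eig k))"]) (simp add: heat_def)
  obtain f where f: "heat_inv_low c0 N h u k = f N h * u k" for N h u
    by (rule that[of "\<lambda>N h. of_real (exp (h * eig k)) * (if eig k \<le> c0 * N\<^sup>2 then 1 else 0)"])
      (simp add: heat_inv_low_def proj_low_def)
  show ?thesis
  proof (induction n arbitrary: j)
    case 0
    show ?case by (simp add: B_germ_def F[of _ k])
  next
    case (Suc n)
    show ?case by (simp add: Suc Let_def B_germ_def smul_def e f F[of _ k] algebra_simps add_divide_distrib diff_divide_distrib)
  qed
qed

lemma heat_residual_linear:
  assumes T: "0 < T" and s: "s \<in> dyadics T" and t: "t \<in> dyadics T"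
    and F: "\<And>x k. F x k = a * G x k + b * H x k"
  shows "heat_residual c0 \<sigma> T F (t, s) k =
    a * heat_residual c0 \<sigma> T G (t, s) k + b * heat_residual c0 \<sigma> T H (t, s) k"
proof -
  have path: "heat_path c0 \<sigma> T F r k = a * heat_path c0 \<sigma> T G r k + b * heat_path c0 \<sigma> T H r k"
    if "r \<in> dyadics T" for r
    using that heat_level_linear[OF F] by (auto simp: dyadics_def heat_path_dyadic_pt[OF T])
  show ?thesis
    by (simp add: heat_residual_def B_germ_def heat_def path[OF s] path[OF t] F[of _ k] ring_distribs)
qed

lemma heat_residual_plus:
  assumes "0 < T" "s \<in> dyadics T" "t \<in> dyadics T"
  shows "heat_residual c0 \<sigma> T (G + H) (t, s) = heat_residual c0 \<sigma> T G (t, s) + heat_residual c0 \<sigma> T H (t, s)"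
  using heat_residual_linear[OF assms, of "G + H" 1 G 1 H] by (intro ext) simp

lemma heat_residual_smul:
  assumes "0 < T" "s \<in> dyadics T" "t \<in> dyadics T"
  shows "heat_residual c0 \<sigma> T (\<lambda>x. c \<cdot>\<^sub>C H x) (t, s) = c \<cdot>\<^sub>C heat_residual c0 \<sigma> T H (t, s)"
  using heat_residual_linear[OF assms, of "\<lambda>x. c \<cdot>\<^sub>C H x" c H 0 H] by (intro ext) (simp add: smul_def)

lemma C_maps_plus:
  assumes f: "f \<in> C_maps \<alpha> D" and g: "g \<in> C_maps \<alpha> D"
  shows "f + g \<in> C_maps \<alpha> D"
  unfolding C_maps_def
proof (intro CollectI conjI ballI)
  fix x assume x: "x \<in> D"
  show "(f + g) x \<in> H_space \<alpha>"
    by (subst plus_fun_apply) (intro H_add C_maps_H_space[OF f] C_maps_H_space[OF g] x)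
  have "((\<lambda>y. H_norm \<alpha> (f y - f x) + H_norm \<alpha> (g y - g x)) \<longlongrightarrow> 0 + 0) (at x within D)"
    using f g x by (intro tendsto_add) (auto simp: C_maps_def)
  then have lim: "((\<lambda>y. H_norm \<alpha> (f y - f x) + H_norm \<alpha> (g y - g x)) \<longlongrightarrow> 0) (at x within D)" by simp
  have "norm (H_norm \<alpha> ((f + g) y - (f + g) x)) \<le> H_norm \<alpha> (f y - f x) + H_norm \<alpha> (g y - g x)" if "y \<in> D" for y
  proof -
    have "(f + g) y - (f + g) x = (f y - f x) + (g y - g x)" by (simp add: algebra_simps)
    then show ?thesis
      unfolding real_norm_def abs_of_nonneg[OF H_norm_nonneg]
      by (simp only:) (intro H_add(2) H_diff(1) C_maps_H_space[OF f] C_maps_H_space[OF g] x that)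
  qed
  then have "\<forall>\<^sub>F y in at x within D. norm (H_norm \<alpha> ((f + g) y - (f + g) x)) \<le> H_norm \<alpha> (f y - f x) + H_norm \<alpha> (g y - g x)"
    unfolding eventually_at_filter by (intro always_eventually) blast
  from Lim_null_comparison[OF this lim]
  show "((\<lambda>y. H_norm \<alpha> ((f + g) y - (f + g) x)) \<longlongrightarrow> 0) (at x within D)" .
qed

lemma heat_extension_plus:
  assumes T: "0 < T" and \<Gamma>: "heat_extension c0 T \<alpha> \<sigma> G \<Gamma>" and \<Lambda>: "heat_extension c0 T \<alpha> \<sigma> H \<Lambda>"
  shows "heat_extension c0 T \<alpha> \<sigma> (G + H) (\<Gamma> + \<Lambda>)"
  using \<Gamma> \<Lambda> unfolding heat_extension_def
  by (simp add: C_maps_plus heat_residual_plus[OF T])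

lemma heat_extension_smul:
  assumes T: "0 < T" and \<Lambda>: "heat_extension c0 T \<alpha> \<sigma> H \<Lambda>"
  shows "heat_extension c0 T \<alpha> \<sigma> (\<lambda>x. c \<cdot>\<^sub>C H x) (\<lambda>x. c \<cdot>\<^sub>C \<Lambda> x)"
  using \<Lambda> unfolding heat_extension_def
  by (simp add: C_maps_smul heat_residual_smul[OF T])

text \<open>The factor \<open>1 / r\<close> undoes the scaling of the defect into the unit ball.\<close>

lemma residual_modulus_smul:
  assumes T: "0 < T" and r: "0 < r"
    and mem: "\<And>s t. s \<in> dyadics T \<Longrightarrow> t \<in> dyadics T \<Longrightarrow> s \<le> t \<Longrightarrow> heat_residual c0 \<sigma> T H (t, s) \<in> H_space \<alpha>"
    and h: "0 \<le> h"
  shows "residual_modulus c0 T \<alpha> \<sigma> H h \<le>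
    ennreal (1 / r) * residual_modulus c0 T \<alpha> \<sigma> (\<lambda>x. of_real r \<cdot>\<^sub>C H x) h"
  unfolding residual_modulus_def[of _ _ _ _ H]
proof (rule SUP_least, clarify)
  fix t s assume ts: "s \<in> dyadics T" "t \<in> dyadics T" "s \<le> t" "t + h \<le> T"
  let ?D = "heat h (heat_residual c0 \<sigma> T H (t, s)) - heat_residual c0 \<sigma> T H (t, s)"
  let ?E = "heat h (heat_residual c0 \<sigma> T (\<lambda>x. of_real r \<cdot>\<^sub>C H x) (t, s))
    - heat_residual c0 \<sigma> T (\<lambda>x. of_real r \<cdot>\<^sub>C H x) (t, s)"
  have D: "?D \<in> H_space \<alpha>" using mem ts h by (intro H_diff H_heat) auto
  have E: "?E = of_real r \<cdot>\<^sub>C ?D"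
    unfolding heat_residual_smul[OF T ts(1,2)] by (simp add: smul_def heat_def fun_eq_iff algebra_simps)
  have "?D = of_real (1 / r) \<cdot>\<^sub>C ?E" unfolding E using r by (simp add: smul_def fun_eq_iff)
  moreover have "?E \<in> H_space \<alpha>" unfolding E by (rule H_smul(1)[OF D])
  ultimately have "H_norm \<alpha> ?D \<le> cmod (of_real (1 / r)) * H_norm \<alpha> ?E"
    using H_smul(2)[of ?E \<alpha> "of_real (1 / r)"] by metis
  also have "cmod (of_real (1 / r)) = 1 / r" using r by (simp only: norm_of_real) simp
  finally have "H_norm \<alpha> ?D \<le> 1 / r * H_norm \<alpha> ?E" .
  then have "ennreal (H_norm \<alpha> ?D) \<le> ennreal (1 / r) * ennreal (H_norm \<alpha> ?E)"
    using r by (simp add: ennreal_leI flip: ennreal_mult)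
  also have "ennreal (H_norm \<alpha> ?E) \<le> residual_modulus c0 T \<alpha> \<sigma> (\<lambda>x. of_real r \<cdot>\<^sub>C H x) h"
    unfolding residual_modulus_def using ts by (intro SUP_upper2[of "(t, s)"]) auto
  finally show "ennreal (H_norm \<alpha> ?D) \<le> ennreal (1 / r) * \<dots>" by (simp add: mult_left_mono)
qed

text \<open>By homogeneity, smallness of the modulus on the unit ball of a linear class gives the continuity
  criterion for each of its elements.\<close>

lemma (in heat_defect) residual_continuity_of_uniform:
  assumes V: "linear_class V" "H \<in> V" and unif: "uniform_residual_continuity c0 T \<gamma> \<alpha> \<sigma> V"
  shows "residual_continuity c0 T \<alpha> \<sigma> H"
proof -
  obtain r where r: "0 < r" "norm3 T \<gamma> \<alpha> (\<lambda>x. of_real r \<cdot>\<^sub>C H x) \<le> 1"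
    using norm3_scale_le_1[OF norm3_finite] by blast
  let ?S = "\<lambda>h. SUP H \<in> {H \<in> V. norm3 T \<gamma> \<alpha> H \<le> 1}. residual_modulus c0 T \<alpha> \<sigma> H h"
  have rH: "(\<lambda>x. of_real r \<cdot>\<^sub>C H x) \<in> V" using V by (simp add: linear_class_def)
  have le: "residual_modulus c0 T \<alpha> \<sigma> H h \<le> ennreal (1 / r) * ?S h" if "0 < h" for h
  proof -
    have "residual_modulus c0 T \<alpha> \<sigma> H h \<le> ennreal (1 / r) * residual_modulus c0 T \<alpha> \<sigma> (\<lambda>x. of_real r \<cdot>\<^sub>C H x) h"
      by (rule residual_modulus_smul[OF T(1) r(1) R_mem]) (use that in auto)
    also have "\<dots> \<le> ennreal (1 / r) * ?S h"
      using rH r by (intro mult_left_mono SUP_upper) auto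
    finally show ?thesis .
  qed
  have "((\<lambda>h. ennreal (1 / r) * ?S h) \<longlongrightarrow> ennreal (1 / r) * 0) (at_right 0)"
    using unif unfolding uniform_residual_continuity_def by (intro ennreal_tendsto_cmult) auto
  then have lim: "((\<lambda>h. ennreal (1 / r) * ?S h) \<longlongrightarrow> 0) (at_right 0)" by simp
  have ev: "\<forall>\<^sub>F h in at_right 0. residual_modulus c0 T \<alpha> \<sigma> H h \<le> ennreal (1 / r) * ?S h"
    unfolding eventually_at_right_field using le by (auto intro: exI[of _ 1])
  show ?thesis
    unfolding residual_continuity_def
    by (rule tendsto_sandwich[OF _ ev tendsto_const lim]) simp
qed

lemma ennreal_bounded_imp_continuous:
  fixes \<epsilon> :: ennreal
  assumes \<epsilon>: "0 < \<epsilon>" and D: "0 < D"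
  shows "\<exists>\<delta>>0. \<forall>x<\<delta>. ennreal D * x < \<epsilon>"
proof (cases \<epsilon>)
  case (real e)
  show ?thesis
  proof (intro exI[of _ "ennreal (e / D)"] conjI allI impI)
    show "0 < ennreal (e / D)" using \<epsilon> D real by (simp add: ennreal_less_zero_iff)
    fix x assume x: "x < ennreal (e / D)"
    then obtain r where r: "x = ennreal r" "0 \<le> r" by (cases x) auto
    then have "r < e / D" using x by (simp add: ennreal_less_iff)
    then show "ennreal D * x < \<epsilon>"
      using D r real by (simp add: ennreal_less_iff field_simps flip: ennreal_mult)
  qed
next
  case top
  then show ?thesis by (intro exI[of _ top]) (simp add: ennreal_mult_less_top)
qed

text \<open>The bound is applied to \<open>H - G\<close>, which lies in the class since \<open>- 1\<close> is one of the real scalars.\<close>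

lemma continuous_on_class_of_bound:
  assumes V: "linear_class V" and lin: "linear_on_class V \<Lambda>" and D: "0 \<le> D"
    and bound: "\<And>H. H \<in> V \<Longrightarrow> norm_out (\<Lambda> H) \<le> ennreal D * norm_in H"
  shows "continuous_on_class V norm_in norm_out \<Lambda>"
  unfolding continuous_on_class_def
proof (intro ballI allI impI)
  fix G and \<epsilon> :: ennreal assume G: "G \<in> V" and \<epsilon>: "0 < \<epsilon>"
  \<comment> \<open>\<open>D + 1\<close> instead of \<open>D\<close>, to divide by a positive number.\<close>
  obtain \<delta> where \<delta>: "0 < \<delta>" "\<And>x. x < \<delta> \<Longrightarrow> ennreal (D + 1) * x < \<epsilon>"
    using ennreal_bounded_imp_continuous[OF \<epsilon>, of "D + 1"] D by auto
  show "\<exists>\<delta>>0. \<forall>H\<in>V. norm_in (H - G) < \<delta> \<longrightarrow> norm_out (\<Lambda> H - \<Lambda> G) < \<epsilon>"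
  proof (intro exI[of _ \<delta>] conjI \<delta>(1) ballI impI)
    fix H assume H: "H \<in> V" and less: "norm_in (H - G) < \<delta>"
    have "(\<lambda>x. of_real (- 1) \<cdot>\<^sub>C G x) \<in> V" using V G unfolding linear_class_def by blast
    then have "H + (\<lambda>x. of_real (- 1) \<cdot>\<^sub>C G x) \<in> V" using V H unfolding linear_class_def by blast
    moreover have "H + (\<lambda>x. of_real (- 1) \<cdot>\<^sub>C G x) = H - G" by (simp add: fun_eq_iff smul_def)
    ultimately have HG: "H - G \<in> V" by simp
    have "\<Lambda> ((H - G) + G) = \<Lambda> (H - G) + \<Lambda> G" using lin HG G unfolding linear_on_class_def by blast
    then have "\<Lambda> H - \<Lambda> G = \<Lambda> (H - G)" by simp
    then have "norm_out (\<Lambda> H - \<Lambda> G) \<le> ennreal D * norm_in (H - G)" using bound[OF HG] by simp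
    also have "\<dots> \<le> ennreal (D + 1) * norm_in (H - G)" by (intro mult_right_mono ennreal_leI) auto
    also have "\<dots> < \<epsilon>" by (rule \<delta>(2)[OF less])
    finally show "norm_out (\<Lambda> H - \<Lambda> G) < \<epsilon>" .
  qed
qed

theorem theorem7p6:
  fixes \<gamma> \<alpha> \<beta> \<sigma> c0 :: real
  assumes "0 < \<gamma>" and "\<gamma> \<le> 1" and "0 < \<beta>" and "0 < \<sigma>" and "\<sigma> < 1" and "0 < c0"
  shows "\<exists>T0>0. \<forall>T. 0 < T \<and> T \<le> 1 \<longrightarrow>
    (\<exists>C\<ge>0. \<forall>(H :: 'd::finite incr3) K.
       H \<in> ZC3 T \<gamma> \<alpha> \<and> parabolic_tail c0 T \<gamma> \<alpha> \<beta> \<sigma> K H \<and> residual_continuity c0 T \<alpha> \<sigma> H \<longrightarrow>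
       (let \<Lambda> = heat_sewing c0 T \<alpha> \<sigma> H in
          heat_extension c0 T \<alpha> \<sigma> H \<Lambda> \<and>
          (\<forall>x\<in>simplex3 T. hat_delta2 \<Lambda> x = H x) \<and>
          (\<gamma> < 1 \<and> T \<le> T0 \<longrightarrow>
             \<Lambda> \<in> C2 T \<gamma> \<alpha> \<and>
             norm2 T \<gamma> \<alpha> \<Lambda> \<le> ennreal C * (norm3 T \<gamma> \<alpha> H + ennreal K)) \<and>
          (\<gamma> = 1 \<longrightarrow>
             \<Lambda> \<in> C_log T \<alpha> \<and>
             norm_log T \<alpha> \<Lambda> \<le> ennreal C * (norm3 T 1 \<alpha> H + ennreal K)))) \<and>
    (\<forall>(V :: 'd incr3 set) C\<^sub>V::real.
       linear_class V \<and> V \<subseteq> ZC3 T \<gamma> \<alpha> \<and>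
       (\<forall>H\<in>V. \<exists>K. parabolic_tail c0 T \<gamma> \<alpha> \<beta> \<sigma> K H \<and> ennreal K \<le> ennreal C\<^sub>V * norm3 T \<gamma> \<alpha> H) \<and>
       uniform_residual_continuity c0 T \<gamma> \<alpha> \<sigma> V \<longrightarrow>
       (\<forall>H\<in>V. heat_extension c0 T \<alpha> \<sigma> H (heat_sewing c0 T \<alpha> \<sigma> H) \<and>
              (\<forall>x\<in>simplex3 T. hat_delta2 (heat_sewing c0 T \<alpha> \<sigma> H) x = H x)) \<and>
       linear_on_class V (heat_sewing c0 T \<alpha> \<sigma>) \<and>
       (\<gamma> < 1 \<and> T \<le> T0 \<longrightarrow>
          heat_sewing c0 T \<alpha> \<sigma> ` V \<subseteq> C2 T \<gamma> \<alpha> \<and>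
          continuous_on_class V (norm3 T \<gamma> \<alpha>) (norm2 T \<gamma> \<alpha>) (heat_sewing c0 T \<alpha> \<sigma>)) \<and>
       (\<gamma> = 1 \<longrightarrow>
          heat_sewing c0 T \<alpha> \<sigma> ` V \<subseteq> C_log T \<alpha> \<and>
          continuous_on_class V (norm3 T 1 \<alpha>) (norm_log T \<alpha>) (heat_sewing c0 T \<alpha> \<sigma>)))"
proof (rule exI[of _ "1 :: real"], intro conjI allI impI)
  show "0 < (1 :: real)" by simp
next
  fix T :: real assume T: "0 < T \<and> T \<le> 1"
  let ?C = "sewing_const c0 \<sigma> \<gamma>"
  have C: "0 \<le> ?C" using assms by (intro sewing_const_nonneg)
  have defect: "heat_defect \<gamma> \<alpha> \<beta> \<sigma> c0 T K H"
    if "H \<in> ZC3 T \<gamma> \<alpha>" "parabolic_tail c0 T \<gamma> \<alpha> \<beta> \<sigma> K H" for K and H :: "'d incr3"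
    using assms T that by unfold_locales auto
  show "\<exists>C\<ge>0. \<forall>(H :: 'd::finite incr3) K.
       H \<in> ZC3 T \<gamma> \<alpha> \<and> parabolic_tail c0 T \<gamma> \<alpha> \<beta> \<sigma> K H \<and> residual_continuity c0 T \<alpha> \<sigma> H \<longrightarrow>
       (let \<Lambda> = heat_sewing c0 T \<alpha> \<sigma> H in
          heat_extension c0 T \<alpha> \<sigma> H \<Lambda> \<and>
          (\<forall>x\<in>simplex3 T. hat_delta2 \<Lambda> x = H x) \<and>
          (\<gamma> < 1 \<and> T \<le> 1 \<longrightarrow>
             \<Lambda> \<in> C2 T \<gamma> \<alpha> \<and>
             norm2 T \<gamma> \<alpha> \<Lambda> \<le> ennreal C * (norm3 T \<gamma> \<alpha> H + ennreal K)) \<and>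
          (\<gamma> = 1 \<longrightarrow>
             \<Lambda> \<in> C_log T \<alpha> \<and>
             norm_log T \<alpha> \<Lambda> \<le> ennreal C * (norm3 T 1 \<alpha> H + ennreal K)))"
  proof (intro exI[of _ ?C] conjI allI impI C)
    fix H :: "'d incr3" and K
    assume a: "H \<in> ZC3 T \<gamma> \<alpha> \<and> parabolic_tail c0 T \<gamma> \<alpha> \<beta> \<sigma> K H \<and> residual_continuity c0 T \<alpha> \<sigma> H"
    then interpret continuous_heat_defect \<gamma> \<alpha> \<beta> \<sigma> c0 T K H
      using defect by (simp add: continuous_heat_defect_def continuous_heat_defect_axioms_def)
    show "let \<Lambda> = heat_sewing c0 T \<alpha> \<sigma> H in
          heat_extension c0 T \<alpha> \<sigma> H \<Lambda> \<and>
          (\<forall>x\<in>simplex3 T. hat_delta2 \<Lambda> x = H x) \<and>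
          (\<gamma> < 1 \<and> T \<le> 1 \<longrightarrow>
             \<Lambda> \<in> C2 T \<gamma> \<alpha> \<and>
             norm2 T \<gamma> \<alpha> \<Lambda> \<le> ennreal ?C * (norm3 T \<gamma> \<alpha> H + ennreal K)) \<and>
          (\<gamma> = 1 \<longrightarrow>
             \<Lambda> \<in> C_log T \<alpha> \<and>
             norm_log T \<alpha> \<Lambda> \<le> ennreal ?C * (norm3 T 1 \<alpha> H + ennreal K))"
      unfolding Let_def
      using heat_sewing_extension heat_sewing_coboundary norm2_heat_sewing norm_log_heat_sewing
        heat_sewing_C2 heat_sewing_C_log by auto
  qed
next
  fix T :: real and V :: "'d incr3 set" and C\<^sub>V :: real
  assume T: "0 < T \<and> T \<le> 1"
  assume a: "linear_class V \<and> V \<subseteq> ZC3 T \<gamma> \<alpha> \<and>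
       (\<forall>H\<in>V. \<exists>K. parabolic_tail c0 T \<gamma> \<alpha> \<beta> \<sigma> K H \<and> ennreal K \<le> ennreal C\<^sub>V * norm3 T \<gamma> \<alpha> H) \<and>
       uniform_residual_continuity c0 T \<gamma> \<alpha> \<sigma> V"
  let ?S = "heat_sewing c0 T \<alpha> \<sigma> :: 'd incr3 \<Rightarrow> 'd incr2"
  let ?C = "sewing_const c0 \<sigma> \<gamma>"
  define D where "D = ?C * (1 + max C\<^sub>V 0)"
  have C: "0 \<le> ?C" using assms by (intro sewing_const_nonneg)
  then have D: "0 \<le> D" by (simp add: D_def)
  have V: "linear_class V" using a by blast
  have in_V: "\<exists>K. continuous_heat_defect \<gamma> \<alpha> \<beta> \<sigma> c0 T K H \<and> ennreal K \<le> ennreal C\<^sub>V * norm3 T \<gamma> \<alpha> H"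
    if HV: "H \<in> V" for H
  proof -
    obtain K where K: "parabolic_tail c0 T \<gamma> \<alpha> \<beta> \<sigma> K H" "ennreal K \<le> ennreal C\<^sub>V * norm3 T \<gamma> \<alpha> H"
      using a HV by blast
    interpret heat_defect \<gamma> \<alpha> \<beta> \<sigma> c0 T K H
      using assms T a HV K by unfold_locales auto
    have "residual_continuity c0 T \<alpha> \<sigma> H"
      using a by (intro residual_continuity_of_uniform[OF V HV]) auto
    then have "continuous_heat_defect \<gamma> \<alpha> \<beta> \<sigma> c0 T K H" by unfold_locales
    then show ?thesis using K(2) by blast
  qed
  have ext: "heat_extension c0 T \<alpha> \<sigma> H (?S H)" and cob: "\<forall>x\<in>simplex3 T. hat_delta2 (?S H) x = H x"
    and off: "\<And>x. x \<notin> simplex2 T \<Longrightarrow> ?S H x = 0" if HV: "H \<in> V" for H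
  proof -
    obtain K where "continuous_heat_defect \<gamma> \<alpha> \<beta> \<sigma> c0 T K H" using in_V[OF HV] by blast
    then interpret continuous_heat_defect \<gamma> \<alpha> \<beta> \<sigma> c0 T K H .
    show "heat_extension c0 T \<alpha> \<sigma> H (?S H)" "\<forall>x\<in>simplex3 T. hat_delta2 (?S H) x = H x"
      using heat_sewing_extension heat_sewing_coboundary by auto
    show "?S H x = 0" if "x \<notin> simplex2 T" for x using that by (simp add: heat_sewing_eq \<Lambda>_def)
  qed
  have K_le: "ennreal ?C * (X + ennreal K) \<le> ennreal D * X" if K: "ennreal K \<le> ennreal C\<^sub>V * X" for K X
  proof -
    have "ennreal C\<^sub>V * X \<le> ennreal (max C\<^sub>V 0) * X" by (intro mult_right_mono ennreal_leI) auto
    with K have "X + ennreal K \<le> X + ennreal (max C\<^sub>V 0) * X" by (intro add_left_mono) (rule order_trans)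
    also have "\<dots> = ennreal (1 + max C\<^sub>V 0) * X" by (simp add: distrib_right)
    finally have "ennreal ?C * (X + ennreal K) \<le> ennreal ?C * (ennreal (1 + max C\<^sub>V 0) * X)"
      by (intro mult_left_mono) auto
    also have "\<dots> = ennreal D * X" using C by (simp add: D_def ennreal_mult mult.assoc)
    finally show ?thesis .
  qed
  have small: "?S H \<in> C2 T \<gamma> \<alpha>" "norm2 T \<gamma> \<alpha> (?S H) \<le> ennreal D * norm3 T \<gamma> \<alpha> H" if g: "\<gamma> < 1" and HV: "H \<in> V" for H
  proof -
    obtain K where K: "continuous_heat_defect \<gamma> \<alpha> \<beta> \<sigma> c0 T K H" "ennreal K \<le> ennreal C\<^sub>V * norm3 T \<gamma> \<alpha> H"
      using in_V[OF HV] by blast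
    interpret continuous_heat_defect \<gamma> \<alpha> \<beta> \<sigma> c0 T K H by (rule K(1))
    show "?S H \<in> C2 T \<gamma> \<alpha>" by (rule heat_sewing_C2[OF g])
    show "norm2 T \<gamma> \<alpha> (?S H) \<le> ennreal D * norm3 T \<gamma> \<alpha> H"
      by (rule order_trans[OF norm2_heat_sewing[OF g] K_le[OF K(2)]])
  qed
  have log: "?S H \<in> C_log T \<alpha>" "norm_log T \<alpha> (?S H) \<le> ennreal D * norm3 T \<gamma> \<alpha> H" if g: "\<gamma> = 1" and HV: "H \<in> V" for H
  proof -
    obtain K where K: "continuous_heat_defect \<gamma> \<alpha> \<beta> \<sigma> c0 T K H" "ennreal K \<le> ennreal C\<^sub>V * norm3 T \<gamma> \<alpha> H"
      using in_V[OF HV] by blast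
    interpret continuous_heat_defect \<gamma> \<alpha> \<beta> \<sigma> c0 T K H by (rule K(1))
    show "?S H \<in> C_log T \<alpha>" by (rule heat_sewing_C_log[OF g])
    show "norm_log T \<alpha> (?S H) \<le> ennreal D * norm3 T \<gamma> \<alpha> H"
      by (rule order_trans[OF norm_log_heat_sewing[OF g] K_le[OF K(2)]])
  qed
  have lin: "linear_on_class V ?S"
    unfolding linear_on_class_def
  proof (intro conjI ballI allI impI)
    fix G H assume GH: "G \<in> V" "H \<in> V"
    show "?S (G + H) = ?S G + ?S H"
      using T off[OF GH(1)] off[OF GH(2)] by (intro heat_sewing_eqI heat_extension_plus ext GH) auto
  next
    fix c H assume H: "H \<in> V" and "(\<lambda>x. c \<cdot>\<^sub>C H x) \<in> V"
    show "?S (\<lambda>x. c \<cdot>\<^sub>C H x) = (\<lambda>x. c \<cdot>\<^sub>C ?S H x)"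
      using T off[OF H] by (intro heat_sewing_eqI heat_extension_smul ext H) (auto simp: smul_def fun_eq_iff)
  qed
  show "\<forall>H\<in>V. heat_extension c0 T \<alpha> \<sigma> H (?S H) \<and> (\<forall>x\<in>simplex3 T. hat_delta2 (?S H) x = H x)"
    using ext cob by blast
  show "linear_on_class V ?S" by (rule lin)
  show "?S ` V \<subseteq> C2 T \<gamma> \<alpha>" "continuous_on_class V (norm3 T \<gamma> \<alpha>) (norm2 T \<gamma> \<alpha>) ?S"
    if "\<gamma> < 1 \<and> T \<le> 1"
    using small that continuous_on_class_of_bound[OF V lin D] by auto
  show "?S ` V \<subseteq> C_log T \<alpha>" "continuous_on_class V (norm3 T 1 \<alpha>) (norm_log T \<alpha>) ?S"
    if "\<gamma> = 1"
    using log that continuous_on_class_of_bound[OF V lin D, of "norm_log T \<alpha>" "norm3 T 1 \<alpha>"] by auto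
qed

end
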